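(* Let $m=s+2k$, let $I\subset\mathbb{R}$ be a compact or semi-infinite interval (the design space), let $\mathcal{B}=\{b=(b_1,\dots,b_k)^T\in\mathbb{R}^k\mid b_i\notin I;\ b_i\ne b_j\ (i\neq j)\}$, and let $f(t,b)=(f_1(t),\dots,f_m(t))^T$ with $$f_i(t)=t^{i-1}\ (i=1,\dots,s),\qquad f_{s+2i-1}(t,b)=\frac1{t-b_i},\quad f_{s+2i}(t,b)=\frac1{(t-b_i)^2}\ (i=1,\dots,k).$$ (i) If $s=1$, then the Chebyshev points $s_1=s_1(b),\dots,s_m=s_m(b)$ for the system of regression functions $f_1,\dots,f_m$ on the interval $[-1,1]$ are given by the zeros of the polynomial $$(1-t^2)\sum_{i=0}^{4k}d_iU_{-2k+s+i-2}(t),$$ where $U_j(x)$ denotes the $j$th Chebyshev polynomial of the second kind, $U_{-1}(x)=0$, $U_{-n}(x)=-U_{n-2}(x)$, and the factors $d_0,\dots,d_{4k}$ are defined as the coefficients of the polynomial $$\sum_{i=0}^{4k}d_it^i=\prod_{i=1}^k(t-\tau_i)^4,\qquad\text{where}\quad 2b_i=\tau_i+\frac1{\tau_i},\quad i=1,\dots,k.$$ (ii) Let $\Omega_E\subset\mathcal{B}$ denote the set of all $b$ such that an $E$-optimal design for the linear regression model $$Y=\sum_{i=1}^s\beta_it^{i-1}+\sum_{i=1}^k\Big(\frac{\beta_{s+2i-1}}{t-b_i}+\frac{\beta_{s+2i}}{(t-b_i)^2}\Big)+\text{error},\qquad t\in I,$$ is given by the design with masses $w_1,\dots,w_m$ at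 the Chebyshev points $s_1<\dots<s_m$ of the system $f_1,\dots,f_m$ on $I$, where $(w_1,\dots,w_m)^T=JF^{-1}c^*/\|c^*\|^2$. Then $\Omega_E\ne\varnothing$.
   Context: Functions $f_1,\dots,f_m:I\to\mathbb{R}$ form a Chebyshev system on the interval $I$ if there is $\epsilon\in\{-1,1\}$ with $\epsilon\det(f_i(x_j))_{i,j=1}^m>0$ for all $x_1<\dots<x_m$ in $I$. The Chebyshev polynomial of the system is the unique function $c^{*T}f(t)=\sum_{i=1}^mc_i^*f_i(t)$ such that $|c^{*T}f(t)|\le1$ for all $t\in I$ and there exist $m$ points $s_1<\dots<s_m$ in $I$ (Chebyshev points) with $c^{*T}f(s_i)=(-1)^i$, $i=1,\dots,m$; the Chebyshev points are unique if $1\in\mathrm{span}\{f_1,\dots,f_m\}$ and $I$ is bounded and closed. Here $c^*\in\mathbb{R}^m$ is the vector of coefficients, $\|\cdot\|$ the Euclidean norm, $F=(f_i(s_j))_{i,j=1}^m$ and $J=\mathrm{diag}(-1,1,\dots,(-1)^m)$. In part (i) the design space is $I=[-1,1]$ and $b\in\mathcal{B}$. A design is a probability measure $\xi$ with finite support on $I$; its information matrix is $M(\xi,b)=\int_If(t,b)f^T(t,b)\,d\xi(t)$. An $E$-optimal design maximizes the minimum eigenvalue of $M(\xi,b)$ over all designs.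
   Formalization: Assumes k ≥ 1; the τ_i all lie inside or all outside the unit disc (mixed choices give wrong zeros); I is a nondegenerate compact interval, or a closed half-line only when s = 0 (for s ≥ 1, or with an open end, a half-line has no Chebyshev points, so Ω_E would be empty). *)

theory Defs
  imports
    "HOL-Probability.Probability_Mass_Function"
    "HOL-Computational_Algebra.Polynomial"
    "Jordan_Normal_Form.Matrix"
    "Jordan_Normal_Form.Determinant"
    "Jordan_Normal_Form.Gauss_Jordan_Elimination"
    "Jordan_Normal_Form.Spectral_Radius"
begin

no_notation Finite_Cartesian_Product.vec_nth (infixl "$" 90)
no_notation Inner_Product.real_inner_class.inner (infix "\<bullet>" 70)
hide_const (open) Finite_Cartesian_Product.vec Finite_Cartesian_Product.mat
  Determinants.det

text \<open>
  A system of \<open>m\<close> functions is a vector-valued map \<open>f\<close> with values in dimension \<open>m\<close>.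
  Vectors are indexed from 0, so component \<open>i\<close> is the mathematical component \<open>i + 1\<close>, and
  the sign \<open>(-1)^i\<close> of 1-based indexing becomes \<open>(-1) ^ Suc i\<close>.
\<close>

subsection \<open>Chebyshev systems\<close>

definition increasing_points :: "real set \<Rightarrow> nat \<Rightarrow> real vec \<Rightarrow> bool" where
  "increasing_points I m x \<longleftrightarrow>
     x \<in> carrier_vec m \<and> (\<forall>i<m. x $ i \<in> I) \<and> (\<forall>i j. i < j \<longrightarrow> j < m \<longrightarrow> x $ i < x $ j)"

definition value_matrix :: "nat \<Rightarrow> (real \<Rightarrow> real vec) \<Rightarrow> real vec \<Rightarrow> real mat" where
  "value_matrix m f x = mat m m (\<lambda>(i, j). f (x $ j) $ i)"

definition chebyshev_system :: "real set \<Rightarrow> nat \<Rightarrow> (real \<Rightarrow> real vec) \<Rightarrow> bool" where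
  "chebyshev_system I m f \<longleftrightarrow>
     (\<exists>\<epsilon>\<in>{-1, 1}. \<forall>x. increasing_points I m x \<longrightarrow> \<epsilon> * det (value_matrix m f x) > 0)"

text \<open>
  \<open>c\<close> is the coefficient vector of the Chebyshev polynomial of the system \<open>f\<close>, and the entries
  of \<open>x\<close> are Chebyshev points.
\<close>
definition chebyshev_polynomial_points ::
    "real set \<Rightarrow> nat \<Rightarrow> (real \<Rightarrow> real vec) \<Rightarrow> real vec \<Rightarrow> real vec \<Rightarrow> bool" where
  "chebyshev_polynomial_points I m f c x \<longleftrightarrow>
     chebyshev_system I m f \<and> c \<in> carrier_vec m \<and> increasing_points I m x \<and>
     (\<forall>t\<in>I. \<bar>c \<bullet> f t\<bar> \<le> 1) \<and> (\<forall>i<m. c \<bullet> f (x $ i) = (-1) ^ Suc i)"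

subsection \<open>Designs\<close>

definition is_design :: "real set \<Rightarrow> real pmf \<Rightarrow> bool" where
  "is_design I \<xi> \<longleftrightarrow> finite (set_pmf \<xi>) \<and> set_pmf \<xi> \<subseteq> I"

definition information_matrix :: "nat \<Rightarrow> (real \<Rightarrow> real vec) \<Rightarrow> real pmf \<Rightarrow> real mat" where
  "information_matrix m f \<xi> =
     mat m m (\<lambda>(i, j). measure_pmf.expectation \<xi> (\<lambda>t. f t $ i * f t $ j))"

text \<open>Meaningful for real symmetric matrices of positive dimension.\<close>
definition min_eigenvalue :: "real mat \<Rightarrow> real" where
  "min_eigenvalue A = Min (spectrum A)"

definition E_optimal :: "real set \<Rightarrow> nat \<Rightarrow> (real \<Rightarrow> real vec) \<Rightarrow> real pmf \<Rightarrow> bool" where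
  "E_optimal I m f \<xi> \<longleftrightarrow>
     is_arg_max (\<lambda>\<eta>. min_eigenvalue (information_matrix m f \<eta>)) (is_design I) \<xi>"

definition sign_matrix :: "nat \<Rightarrow> real mat" where
  "sign_matrix m = mat m m (\<lambda>(i, j). if i = j then (-1) ^ Suc i else 0)"

text \<open>The vector $J F^{-1} c / \|c\|^2$; \<open>c \<bullet> c\<close> is the squared Euclidean norm, and
  \<open>F\<close> is invertible whenever \<open>f\<close> is a Chebyshev system and the points are increasing.\<close>
definition chebyshev_weights ::
    "nat \<Rightarrow> (real \<Rightarrow> real vec) \<Rightarrow> real vec \<Rightarrow> real vec \<Rightarrow> real vec" where
  "chebyshev_weights m f c x =
     (1 / (c \<bullet> c)) \<cdot>\<^sub>v (sign_matrix m *\<^sub>v (the (mat_inverse (value_matrix m f x)) *\<^sub>v c))"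

definition has_masses_at :: "real pmf \<Rightarrow> nat \<Rightarrow> real vec \<Rightarrow> real vec \<Rightarrow> bool" where
  "has_masses_at \<xi> m w x \<longleftrightarrow>
     set_pmf \<xi> \<subseteq> (\<lambda>i. x $ i) ` {..<m} \<and> (\<forall>i<m. pmf \<xi> (x $ i) = w $ i)"

subsection \<open>The rational model\<close>

definition param_space :: "real set \<Rightarrow> nat \<Rightarrow> real vec set" where
  "param_space I k =
     {b \<in> carrier_vec k. (\<forall>i<k. b $ i \<notin> I) \<and> (\<forall>i<k. \<forall>j<k. i \<noteq> j \<longrightarrow> b $ i \<noteq> b $ j)}"

definition rational_regression :: "nat \<Rightarrow> nat \<Rightarrow> real vec \<Rightarrow> real \<Rightarrow> real vec" where
  "rational_regression s k b t = vec (s + 2 * k) (\<lambda>i.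
     if i < s then t ^ i
     else if even (i - s) then 1 / (t - b $ ((i - s) div 2))
     else 1 / (t - b $ ((i - s) div 2)) ^ 2)"

definition Omega_E :: "real set \<Rightarrow> nat \<Rightarrow> nat \<Rightarrow> real vec set" where
  "Omega_E I s k = {b \<in> param_space I k.
     \<exists>c x \<xi>. chebyshev_polynomial_points I (s + 2 * k) (rational_regression s k b) c x \<and>
       has_masses_at \<xi> (s + 2 * k) (chebyshev_weights (s + 2 * k) (rational_regression s k b) c x) x \<and>
       E_optimal I (s + 2 * k) (rational_regression s k b) \<xi>}"

subsection \<open>Chebyshev polynomials of the second kind\<close>

fun chebyshev_U_nat :: "nat \<Rightarrow> real poly" where
  "chebyshev_U_nat 0 = 1"
| "chebyshev_U_nat (Suc 0) = [:0, 2:]"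
| "chebyshev_U_nat (Suc (Suc n)) = [:0, 2:] * chebyshev_U_nat (Suc n) - chebyshev_U_nat n"

text \<open>Negative indices: $U_{-1} = 0$ and $U_{-n} = -U_{n-2}$ for $n \ge 2$.\<close>
definition chebyshev_U :: "int \<Rightarrow> real poly" where
  "chebyshev_U j =
     (if j \<ge> 0 then chebyshev_U_nat (nat j)
      else if j = -1 then 0
      else - chebyshev_U_nat (nat (- j - 2)))"

definition tau_poly :: "nat \<Rightarrow> real vec \<Rightarrow> real poly" where
  "tau_poly k \<tau> = (\<Prod>i<k. [:- \<tau> $ i, 1:] ^ 4)"

definition chebyshev_points_poly :: "nat \<Rightarrow> nat \<Rightarrow> real vec \<Rightarrow> real poly" where
  "chebyshev_points_poly s k \<tau> =
     [:1, 0, -1:] *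
     (\<Sum>i\<le>4 * k. Polynomial.smult (Polynomial.coeff (tau_poly k \<tau>) i) (chebyshev_U (- 2 * int k + int s + int i - 2)))"

text \<open>
  For $b \notin [-1,1]$ the equation $2b = \tau + 1/\tau$ has two real solutions $\tau$ and
  $1/\tau$, one inside and one outside the unit disc. The solutions for the different poles
  have to be taken on the same side: replacing all of them by their reciprocals only rescales the
  resulting polynomial, whereas mixing the two sides yields different zeros.
\<close>
definition tau_of :: "nat \<Rightarrow> real vec \<Rightarrow> real vec \<Rightarrow> bool" where
  "tau_of k b \<tau> \<longleftrightarrow>
     \<tau> \<in> carrier_vec k \<and> (\<forall>i<k. 2 * b $ i = \<tau> $ i + 1 / \<tau> $ i) \<and>
     ((\<forall>i<k. \<bar>\<tau> $ i\<bar> < 1) \<or> (\<forall>i<k. \<bar>\<tau> $ i\<bar> > 1))"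

text \<open>
  The closed intervals considered as design spaces. On a half-line the Chebyshev points do not
  exist for \<open>s \<ge> 1\<close>: for \<open>s = 1\<close> a function attaining \<open>m\<close> alternating extrema on the half-line
  would make \<open>1 - p\<^sup>2\<close> have too many zeros, and for \<open>s \<ge> 2\<close> boundedness already
  forces the coefficients of the positive powers of \<open>t\<close> to vanish.
\<close>
definition design_space :: "nat \<Rightarrow> real set \<Rightarrow> bool" where
  "design_space s I \<longleftrightarrow>
     (\<exists>u v. u < v \<and> I = {u..v}) \<or> (s = 0 \<and> (\<exists>u. I = {u..} \<or> I = {..u}))"

end

theory Submission
  imports Defs
begin

text \<open>
Multiplied by the common denominator \<open>D(t) = \<Prod>\<^sub>r (t - b\<^sub>r)\<^sup>2\<close>, the span of the regression functions
becomes the space of all polynomials of degree below \<open>m = s + 2 k\<close>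
(\<open>pf_numerator_eq_0_imp\<close>, \<open>pf_numerator_surj\<close>). A Chebyshev polynomial is therefore a polynomial \<open>N\<close>
of degree below \<open>m\<close> with \<open>\<bar>N\<bar> \<le> D\<close> on the design space and \<open>N = \<plusminus> D\<close> with alternating signs at \<open>m\<close>
points; this is the notion \<open>equioscillates\<close>.

Such numerators are written down explicitly. With \<open>2 b\<^sub>r = \<tau>\<^sub>r + 1 / \<tau>\<^sub>r\<close> and \<open>\<bar>\<tau>\<^sub>r\<bar> < 1\<close>, the unimodular function
\<open>\<Phi>(z) = z\<^sup>n \<Prod>\<^sub>r ((z - \<tau>\<^sub>r) / (1 - \<tau>\<^sub>r z))\<^sup>2\<close> with \<open>z = e\<^sup>i\<^sup>\<theta>\<close> and \<open>n = s - 1\<close> satisfies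
\<open>D(cos \<theta>) Re \<Phi> = N(cos \<theta>)\<close> for a polynomial \<open>N\<close>, and its argument runs from \<open>0\<close> to \<open>(m - 1) \<pi>\<close> on
\<open>[0, \<pi>]\<close>, which produces the \<open>m\<close> alternation points on \<open>[-1, 1]\<close> when \<open>s \<ge> 1\<close>
(\<open>equioscillates_interval_tau\<close>). The numerator is unique, because the difference of two candidates
alternates weakly at both systems of points, and Lagrange's formula for its leading coefficient then
forces this coefficient, and all the values, to vanish (\<open>alternating_numerator_unique\<close>). The Chebyshev
points are thus zeros of \<open>Im \<Phi>\<close>, and \<open>sin \<theta> Im \<Phi>\<close> is, up to a positive factor, the value at \<open>cos \<theta>\<close>
of the given polynomial. This polynomial is nonzero of degree at most \<open>m\<close>, so it has no further zeros (\<open>chebyshev_points_eq_zeros\<close>).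

For \<open>s = 0\<close> no constant is available and the function has to vanish at infinity. On \<open>[0, \<infinity>)\<close> the
substitution \<open>cos \<theta> = 1 / (1 + 2 h t)\<close> sends infinity to \<open>\<theta> = \<pi> / 2\<close>. The scale \<open>h\<close> is a free parameter, and it
is chosen by the intermediate value theorem such that the argument of \<open>\<Phi>\<close> at \<open>\<pi> / 2\<close> is
\<open>(2 k - 1/2) \<pi>\<close>: then \<open>Re \<Phi>\<close> vanishes there and has \<open>2 k\<close> alternation points before
(\<open>equioscillates_half_line\<close>). Truncation after the last of these points and scaling give the case of a
compact interval.

E-optimality comes from a sign condition (\<open>E_optimal_chebyshev_design\<close>). Let \<open>g\<^sub>i\<close> be the rows of
\<open>F\<^sup>-\<^sup>1\<close>, that is, the coefficient vectors of the Lagrange functions of the Chebyshev points, and suppose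
that \<open>(-1)\<^sup>i\<^sup>+\<^sup>l g\<^sub>i \<bullet> g\<^sub>l \<ge> 0\<close> for all \<open>i, l\<close>. Then the weights are nonnegative, and
\<open>\<parallel>c\<parallel>\<^sup>2 v\<^sup>T M v - v\<^sup>T v\<close> is the quadratic form of a weighted graph Laplacian in the values of \<open>v\<^sup>T f\<close> at the
points, taken with alternating signs. So \<open>1 / \<parallel>c\<parallel>\<^sup>2\<close> is the least eigenvalue of \<open>M\<close>, whereas
\<open>\<bar>c\<^sup>T f\<bar> \<le> 1\<close> shows that no design has a larger one.

It remains to choose poles for which the sign condition holds. Up to a factor whose sign alternates
with \<open>i\<close>, \<open>g\<^sub>i\<close> is the coefficient vector of
\<open>\<Prod>\<^sub>j\<^sub>\<noteq>\<^sub>i (t - x\<^sub>j) / D(t)\<close>. The coefficients at \<open>1 / (t - b\<^sub>r)\<^sup>2\<close> have equal signs because all points lie on one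
side of the poles. The coefficient at \<open>1 / (t - b\<^sub>r)\<close> is the one at \<open>1 / (t - b\<^sub>r)\<^sup>2\<close> times
\<open>\<Sum> 1 / (b\<^sub>r - x\<^sub>j) - 2 \<Sum> 1 / (b\<^sub>r - b\<^sub>q)\<close>, whose sign is independent of the points when the poles form a tight
cluster with geometrically growing gaps (\<open>pole_cluster_bracket_sign\<close>). This condition is invariant under
scaling, which settles \<open>s = 0\<close>. For \<open>s \<ge> 1\<close> the cluster is moved far away: the coefficients of the
polynomial part are then negligible compared with those of the poles (\<open>cluster_gram_nonneg\<close>).
\<close>

section \<open>Rational functions with prescribed double poles\<close>

definition denom_poly :: "nat set \<Rightarrow> (nat \<Rightarrow> real) \<Rightarrow> real poly" where
  "denom_poly R b = (\<Prod>r\<in>R. [:- b r, 1:] ^ 2)"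

text \<open>
The numerator, over the common denominator, of the function with coefficient vector \<open>a\<close>.
\<close>
definition pf_numerator :: "nat \<Rightarrow> nat \<Rightarrow> (nat \<Rightarrow> real) \<Rightarrow> real vec \<Rightarrow> real poly" where
  "pf_numerator s k b a =
     denom_poly {..<k} b * (\<Sum>i<s. Polynomial.monom (a $ i) i) +
     (\<Sum>r<k. [:a $ (s + 2 * r + 1) - a $ (s + 2 * r) * b r, a $ (s + 2 * r):] *
              denom_poly ({..<k} - {r}) b)"

lemma poly_denom_poly: "poly (denom_poly R b) t = (\<Prod>r\<in>R. (t - b r) ^ 2)"
  by (simp add: denom_poly_def poly_prod)

lemma degree_denom_poly: "finite R \<Longrightarrow> degree (denom_poly R b) = 2 * card R"
  unfolding denom_poly_def
  by (subst degree_prod_sum_eq) (auto simp: degree_power_eq)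

lemma denom_poly_nonzero: "finite R \<Longrightarrow> denom_poly R b \<noteq> 0"
  by (auto simp: denom_poly_def)

lemma denom_poly_remove:
  assumes "finite R" "r \<in> R"
  shows "denom_poly R b = [:- b r, 1:] ^ 2 * denom_poly (R - {r}) b"
  unfolding denom_poly_def using assms by (simp add: prod.remove)

lemma sum_split_poles:
  fixes g :: "nat \<Rightarrow> 'a :: comm_monoid_add"
  shows "(\<Sum>i<s + 2 * k. g i) = (\<Sum>i<s. g i) + (\<Sum>r<k. g (s + 2 * r) + g (s + 2 * r + 1))"
  by (induction k) (auto simp: algebra_simps)

lemma scalar_prod_lessThan:
  "w \<in> carrier_vec m \<Longrightarrow> v \<bullet> w = (\<Sum>i<m. v $ i * w $ i)"
  by (simp add: scalar_prod_def atLeast0LessThan)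

lemma rational_regression_index:
  "i < s \<Longrightarrow> rational_regression s k b t $ i = t ^ i"
  "r < k \<Longrightarrow> rational_regression s k b t $ (s + 2 * r) = 1 / (t - b $ r)"
  "r < k \<Longrightarrow> rational_regression s k b t $ (s + 2 * r + 1) = 1 / (t - b $ r) ^ 2"
  by (auto simp: rational_regression_def)

lemma rational_regression_carrier: "rational_regression s k b t \<in> carrier_vec (s + 2 * k)"
  by (simp add: rational_regression_def)

lemma poly_linear_factor: "poly [:x - y * b, y:] t = x + y * (t - b :: real)"
  by (simp add: algebra_simps)

lemma scalar_prod_rational_regression:
  assumes "\<forall>r<k. t \<noteq> b $ r"
  shows "a \<bullet> rational_regression s k b t =
    poly (pf_numerator s k (($) b) a) t / poly (denom_poly {..<k} (($) b)) t"
proof -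
  let ?D = "poly (denom_poly {..<k} (($) b)) t"
  have D0: "?D \<noteq> 0" using assms by (auto simp: poly_denom_poly)
  have E: "poly ([:a $ (s + 2 * r + 1) - a $ (s + 2 * r) * b $ r, a $ (s + 2 * r):] *
              denom_poly ({..<k} - {r}) (($) b)) t =
     ?D * (a $ (s + 2 * r) / (t - b $ r) + a $ (s + 2 * r + 1) / (t - b $ r) ^ 2)" if "r < k" for r
  proof -
    have "denom_poly {..<k} (($) b) = [:- b $ r, 1:] ^ 2 * denom_poly ({..<k} - {r}) (($) b)"
      using that by (intro denom_poly_remove) auto
    then have D: "?D = (t - b $ r) ^ 2 * poly (denom_poly ({..<k} - {r}) (($) b)) t"
      by (simp add: poly_denom_poly)
    have L: "(x + y * d) * e = d ^ 2 * e * (y / d + x / d ^ 2)" if "d \<noteq> 0" for x y d e :: real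
      using that by (simp add: field_simps power2_eq_square)
    have "t - b $ r \<noteq> 0" using assms that by auto
    then show ?thesis unfolding D poly_mult poly_linear_factor by (rule L)
  qed
  have "a \<bullet> rational_regression s k b t = (\<Sum>i<s. a $ i * t ^ i) +
      (\<Sum>r<k. a $ (s + 2 * r) / (t - b $ r) + a $ (s + 2 * r + 1) / (t - b $ r) ^ 2)"
    unfolding scalar_prod_lessThan[OF rational_regression_carrier] sum_split_poles
    using rational_regression_index by simp
  moreover have "poly (pf_numerator s k (($) b) a) t = ?D * ((\<Sum>i<s. a $ i * t ^ i) +
      (\<Sum>r<k. a $ (s + 2 * r) / (t - b $ r) + a $ (s + 2 * r + 1) / (t - b $ r) ^ 2))"
    unfolding pf_numerator_def poly_add poly_sum distrib_left[of ?D "sum _ {..<s}"]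
  proof (intro arg_cong2[where f = "(+)"])
    show "(\<Sum>r<k. poly ([:a $ (s + 2 * r + 1) - a $ (s + 2 * r) * b $ r, a $ (s + 2 * r):] *
          denom_poly ({..<k} - {r}) (($) b)) t) =
        ?D * (\<Sum>r<k. a $ (s + 2 * r) / (t - b $ r) + a $ (s + 2 * r + 1) / (t - b $ r) ^ 2)"
      unfolding sum_distrib_left by (intro sum.cong refl E) auto
  qed (simp add: poly_sum poly_monom)
  ultimately show ?thesis using D0 by simp
qed

lemma poly_pf_numerator:
  "poly (pf_numerator s k b a) t = poly (denom_poly {..<k} b) t * (\<Sum>j<s. a $ j * t ^ j) +
     (\<Sum>r<k. (a $ (s + 2 * r + 1) + a $ (s + 2 * r) * (t - b r)) * poly (denom_poly ({..<k} - {r}) b) t)"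
  unfolding pf_numerator_def poly_add poly_mult poly_sum poly_monom poly_linear_factor by (rule refl)

lemma degree_pf_numerator:
  assumes "s + 2 * k > 0"
  shows "degree (pf_numerator s k b a) < s + 2 * k"
proof -
  have 1: "degree (denom_poly {..<k} b * (\<Sum>i<s. Polynomial.monom (a $ i) i)) \<le> s + 2 * k - 1"
  proof (cases "s = 0")
    case False
    have "degree (\<Sum>i<s. Polynomial.monom (a $ i) i) \<le> s - 1"
      by (intro degree_sum_le) (auto intro: order.trans[OF degree_monom_le])
    then show ?thesis
      using degree_mult_le[of "denom_poly {..<k} b" "\<Sum>i<s. Polynomial.monom (a $ i) i"] False
      by (simp add: degree_denom_poly)
  qed simp
  have 2: "degree ([:x, y:] * denom_poly ({..<k} - {r}) b) \<le> s + 2 * k - 1" if "r < k" for r x y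
  proof -
    have "degree (denom_poly ({..<k} - {r}) b) = 2 * (k - 1)"
      using that by (simp add: degree_denom_poly)
    moreover have "degree [:x, y:] \<le> 1" by simp
    ultimately show ?thesis
      using degree_mult_le[of "[:x, y:]" "denom_poly ({..<k} - {r}) b"] that by linarith
  qed
  have "degree (pf_numerator s k b a) \<le> s + 2 * k - 1"
    unfolding pf_numerator_def by (intro degree_add_le degree_sum_le 1) (use 2 in auto)
  then show ?thesis using assms by linarith
qed

text \<open>
To second order at the pole \<open>b r\<close> only the two summands belonging to this pole survive; hence the value
and the derivative of the numerator there determine the two coefficients.
\<close>
lemma pf_numerator_local:
  assumes "r < k"
  obtains W where "pf_numerator s k b a =
    [:a $ (s + 2 * r + 1) - a $ (s + 2 * r) * b r, a $ (s + 2 * r):] * denom_poly ({..<k} - {r}) b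
    + [:- b r, 1:] ^ 2 * W"
proof -
  let ?L = "\<lambda>r. [:a $ (s + 2 * r + 1) - a $ (s + 2 * r) * b r, a $ (s + 2 * r):]"
  have a: "[:- b r, 1:] ^ 2 dvd denom_poly R b" if "finite R" "r \<in> R" for R
    using denom_poly_remove[OF that, of b] by simp
  have "[:- b r, 1:] ^ 2 dvd denom_poly {..<k} b * (\<Sum>i<s. Polynomial.monom (a $ i) i) +
    (\<Sum>q\<in>{..<k} - {r}. ?L q * denom_poly ({..<k} - {q}) b)"
    using assms by (intro dvd_add dvd_sum dvd_mult dvd_mult2 a) auto
  then obtain W where W: "denom_poly {..<k} b * (\<Sum>i<s. Polynomial.monom (a $ i) i) +
    (\<Sum>q\<in>{..<k} - {r}. ?L q * denom_poly ({..<k} - {q}) b) = [:- b r, 1:] ^ 2 * W"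
    by (elim dvdE)
  have "pf_numerator s k b a = ?L r * denom_poly ({..<k} - {r}) b + [:- b r, 1:] ^ 2 * W"
    unfolding pf_numerator_def W[symmetric] using assms by (subst sum.remove[of _ r]) (auto simp: algebra_simps)
  then show ?thesis by (rule that)
qed

lemma poly_pf_numerator_at_pole:
  assumes "r < k"
  shows "poly (pf_numerator s k b a) (b r) = a $ (s + 2 * r + 1) * poly (denom_poly ({..<k} - {r}) b) (b r)"
proof -
  obtain W where "pf_numerator s k b a =
    [:a $ (s + 2 * r + 1) - a $ (s + 2 * r) * b r, a $ (s + 2 * r):] * denom_poly ({..<k} - {r}) b
    + [:- b r, 1:] ^ 2 * W" using assms by (rule pf_numerator_local)
  then show ?thesis by (simp add: algebra_simps)
qed

lemma pderiv_pf_numerator_at_pole: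
  assumes "r < k"
  shows "poly (pderiv (pf_numerator s k b a)) (b r) = a $ (s + 2 * r) * poly (denom_poly ({..<k} - {r}) b) (b r)
    + a $ (s + 2 * r + 1) * poly (pderiv (denom_poly ({..<k} - {r}) b)) (b r)"
proof -
  obtain W where "pf_numerator s k b a =
    [:a $ (s + 2 * r + 1) - a $ (s + 2 * r) * b r, a $ (s + 2 * r):] * denom_poly ({..<k} - {r}) b
    + [:- b r, 1:] ^ 2 * W" using assms by (rule pf_numerator_local)
  then show ?thesis
    unfolding power2_eq_square
    by (simp only: pderiv_add pderiv_mult poly_add poly_mult) (simp add: pderiv_pCons algebra_simps)
qed

text \<open>
The pole coefficients vanish by evaluation at the poles to second order; what is left is a multiple of
the polynomial part.
\<close>
lemma pf_numerator_eq_0_imp: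
  assumes b: "inj_on b {..<k}" and a: "a \<in> carrier_vec (s + 2 * k)" and 0: "pf_numerator s k b a = 0"
  shows "a = 0\<^sub>v (s + 2 * k)"
proof -
  have E: "poly (denom_poly ({..<k} - {r}) b) (b r) \<noteq> 0" if "r < k" for r
    using that b by (auto simp: poly_denom_poly inj_on_def)
  have o: "a $ (s + 2 * r + 1) = 0" if "r < k" for r
    using poly_pf_numerator_at_pole[OF that, of s b a] E[OF that] 0 by simp
  have e: "a $ (s + 2 * r) = 0" if "r < k" for r
    using pderiv_pf_numerator_at_pole[OF that, of s b a] E[OF that] o[OF that] 0 by simp
  have "pf_numerator s k b a = denom_poly {..<k} b * (\<Sum>i<s. Polynomial.monom (a $ i) i)"
    unfolding pf_numerator_def using o e by simp
  then have S0: "(\<Sum>i<s. Polynomial.monom (a $ i) i) = 0"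
    using 0 denom_poly_nonzero[of "{..<k}" b] by simp
  have p: "a $ i = 0" if "i < s" for i
  proof -
    have "poly.coeff (\<Sum>i<s. Polynomial.monom (a $ i) i) i = a $ i"
      using that by (simp add: coeff_sum coeff_monom)
    then show ?thesis using S0 by simp
  qed
  have "(\<Sum>i<s + 2 * k. \<bar>a $ i\<bar>) = 0"
    unfolding sum_split_poles using o e p by simp
  then have "\<forall>i<s + 2 * k. a $ i = 0"
    by (subst (asm) sum_nonneg_eq_0_iff) auto
  then show ?thesis using a by (intro eq_vecI) auto
qed

lemma pf_numerator_lincomb:
  assumes "a \<in> carrier_vec (s + 2 * k)"
  shows "pf_numerator s k b a = (\<Sum>i<s + 2 * k. Polynomial.smult (a $ i) (pf_numerator s k b (unit_vec (s + 2 * k) i)))"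
proof -
  have u: "unit_vec (s + 2 * k) i $ j = (if i = j then 1 else 0 :: real)" if "j < s + 2 * k" for i j
    using that by (auto simp: unit_vec_def)
  show ?thesis
  proof (rule poly_ext)
    fix t
    have c: "a $ j = (\<Sum>i<s + 2 * k. a $ i * unit_vec (s + 2 * k) i $ j)" if "j < s + 2 * k" for j
      using that by (simp add: u if_distrib cong: if_cong)
    let ?S = "\<Sum>i<s + 2 * k. a $ i * poly (pf_numerator s k b (unit_vec (s + 2 * k) i)) t"
    have "?S = poly (denom_poly {..<k} b) t * (\<Sum>j<s. (\<Sum>i<s + 2 * k. a $ i * unit_vec (s + 2 * k) i $ j) * t ^ j) +
       (\<Sum>r<k. ((\<Sum>i<s + 2 * k. a $ i * unit_vec (s + 2 * k) i $ (s + 2 * r + 1))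
          + (\<Sum>i<s + 2 * k. a $ i * unit_vec (s + 2 * k) i $ (s + 2 * r)) * (t - b r)) * poly (denom_poly ({..<k} - {r}) b) t)"
      unfolding poly_pf_numerator distrib_left distrib_right sum.distrib sum_distrib_left sum_distrib_right
      by (intro arg_cong2[where f = "(+)"]; subst sum.swap) (simp_all add: mult_ac)
    also have "\<dots> = poly (pf_numerator s k b a) t"
      unfolding poly_pf_numerator[of s k b a] by (intro arg_cong2[where f = "(+)"] arg_cong2[where f = "(*)"] sum.cong refl; rule c[symmetric]) auto
    finally show "poly (pf_numerator s k b a) t = poly (\<Sum>i<s + 2 * k. Polynomial.smult (a $ i) (pf_numerator s k b (unit_vec (s + 2 * k) i))) t"
      by (simp add: poly_sum)
  qed
qed

text \<open>
Partial fraction decomposition. It follows from uniqueness by counting dimensions: the matrix that sends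
coefficient vectors to the coefficients of the numerator is square with trivial kernel.
\<close>
lemma pf_numerator_surj:
  assumes b: "inj_on b {..<k}" and N: "degree N < s + 2 * k"
  obtains a where "a \<in> carrier_vec (s + 2 * k)" "pf_numerator s k b a = N"
proof -
  let ?m = "s + 2 * k"
  define A :: "real mat" where "A = mat ?m ?m (\<lambda>(i, j). poly.coeff (pf_numerator s k b (unit_vec ?m j)) i)"
  have A: "A \<in> carrier_mat ?m ?m" by (simp add: A_def)
  have Av: "(A *\<^sub>v a) $ i = poly.coeff (pf_numerator s k b a) i" if "a \<in> carrier_vec ?m" "i < ?m" for a i
  proof -
    have "(A *\<^sub>v a) $ i = (\<Sum>j<?m. poly.coeff (pf_numerator s k b (unit_vec ?m j)) i * a $ j)"
      using that by (simp add: A_def scalar_prod_def atLeast0LessThan)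
    also have "\<dots> = poly.coeff (pf_numerator s k b a) i"
      unfolding arg_cong[OF pf_numerator_lincomb[OF that(1)], of "\<lambda>p. poly.coeff p i"]
      by (simp add: coeff_sum mult.commute)
    finally show ?thesis .
  qed
  have "det A \<noteq> 0"
  proof
    assume "det A = 0"
    then obtain v where v: "v \<in> carrier_vec ?m" "v \<noteq> 0\<^sub>v ?m" "A *\<^sub>v v = 0\<^sub>v ?m"
      using det_0_iff_vec_prod_zero_field[OF A] by auto
    have "poly.coeff (pf_numerator s k b v) i = 0" for i
    proof (cases "i < ?m")
      case True then show ?thesis using Av[OF v(1) True] v(3) by simp
    next
      case False then show ?thesis using degree_pf_numerator[of s k b v] N by (intro coeff_eq_0) linarith
    qed
    then have "pf_numerator s k b v = 0" by (simp add: poly_eq_iff)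
    then show False using pf_numerator_eq_0_imp[OF b v(1)] v(2) by simp
  qed
  then obtain B where B: "B \<in> carrier_mat ?m ?m" "A * B = 1\<^sub>m ?m"
    using mat_inverse[OF A] det_non_zero_imp_unit[OF A]
    by (metis (no_types, lifting) not_None_eq)
  define a where "a = B *\<^sub>v vec ?m (poly.coeff N)"
  have a: "a \<in> carrier_vec ?m" using B by (simp add: a_def)
  have "A *\<^sub>v a = vec ?m (poly.coeff N)"
    unfolding a_def using A B by (simp add: assoc_mult_mat_vec[symmetric, of _ ?m ?m _ ?m])
  then have "poly.coeff (pf_numerator s k b a) i = poly.coeff N i" if "i < ?m" for i
    using Av[OF a that] that by simp
  moreover have "degree (pf_numerator s k b a) < ?m" by (rule degree_pf_numerator) (use N in linarith)
  then have "poly.coeff (pf_numerator s k b a) i = poly.coeff N i" if "\<not> i < ?m" for i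
    using that N by (simp add: coeff_eq_0)
  ultimately have "pf_numerator s k b a = N" by (metis poly_eq_iff)
  with a show ?thesis by (rule that)
qed

lemma denom_poly_cong: "(\<And>r. r \<in> R \<Longrightarrow> b r = b' r) \<Longrightarrow> denom_poly R b = denom_poly R b'"
  by (simp add: denom_poly_def)

lemma pf_numerator_cong:
  assumes "\<And>r. r < k \<Longrightarrow> b r = b' r" shows "pf_numerator s k b a = pf_numerator s k b' a"
proof -
  have "denom_poly ({..<k} - {r}) b = denom_poly ({..<k} - {r}) b'" "denom_poly {..<k} b = denom_poly {..<k} b'" for r
    using assms by (auto intro!: denom_poly_cong)
  then show ?thesis unfolding pf_numerator_def using assms by (intro arg_cong2[where f = "(+)"] sum.cong) auto
qed

lemma pf_numerator_smult:
  assumes "a \<in> carrier_vec (s + 2 * k)"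
  shows "pf_numerator s k b (c \<cdot>\<^sub>v a) = Polynomial.smult c (pf_numerator s k b a)"
proof (rule poly_ext)
  fix t
  have 1: "(\<Sum>j<s. (c \<cdot>\<^sub>v a) $ j * t ^ j) = c * (\<Sum>j<s. a $ j * t ^ j)"
    unfolding sum_distrib_left using assms by (intro sum.cong) auto
  have 2: "(\<Sum>r<k. ((c \<cdot>\<^sub>v a) $ (s + 2 * r + 1) + (c \<cdot>\<^sub>v a) $ (s + 2 * r) * (t - b r)) * E r) =
      c * (\<Sum>r<k. (a $ (s + 2 * r + 1) + a $ (s + 2 * r) * (t - b r)) * E r)" for E
    unfolding sum_distrib_left using assms by (intro sum.cong) (auto simp: distrib_left distrib_right)
  show "poly (pf_numerator s k b (c \<cdot>\<^sub>v a)) t = poly (Polynomial.smult c (pf_numerator s k b a)) t"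
    unfolding poly_smult poly_pf_numerator 1 2 by (simp only: distrib_left mult.left_commute)
qed

lemma pf_numerator_diff:
  assumes "a \<in> carrier_vec (s + 2 * k)" "a' \<in> carrier_vec (s + 2 * k)"
  shows "pf_numerator s k b (a - a') = pf_numerator s k b a - pf_numerator s k b a'"
proof (rule poly_ext)
  fix t
  have 1: "(\<Sum>j<s. (a - a') $ j * t ^ j) = (\<Sum>j<s. a $ j * t ^ j) - (\<Sum>j<s. a' $ j * t ^ j)"
    unfolding sum_subtractf[symmetric] using assms by (intro sum.cong) (auto simp: left_diff_distrib)
  have 2: "(\<Sum>r<k. ((a - a') $ (s + 2 * r + 1) + (a - a') $ (s + 2 * r) * (t - b r)) * E r) =
      (\<Sum>r<k. (a $ (s + 2 * r + 1) + a $ (s + 2 * r) * (t - b r)) * E r) -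
      (\<Sum>r<k. (a' $ (s + 2 * r + 1) + a' $ (s + 2 * r) * (t - b r)) * E r)" for E
    unfolding sum_subtractf[symmetric] using assms by (intro sum.cong) (auto simp: algebra_simps)
  show "poly (pf_numerator s k b (a - a')) t = poly (pf_numerator s k b a - pf_numerator s k b a') t"
    unfolding poly_diff poly_pf_numerator 1 2 by (simp only: right_diff_distrib)
qed

section \<open>Chebyshev systems and equioscillating numerators\<close>

lemma poly_eq_0_if_many_zeros:
  fixes p :: "real poly"
  assumes "degree p < m" "inj_on x {..<m}" "\<And>i. i < m \<Longrightarrow> poly p (x i) = 0"
  shows "p = 0"
proof (rule ccontr)
  assume p: "p \<noteq> 0"
  have "m = card (x ` {..<m})" using assms(2) by (simp add: card_image)
  also have "\<dots> \<le> card {t. poly p t = 0}"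
    using assms(3) by (intro card_mono poly_roots_finite p) auto
  also have "\<dots> \<le> degree p" by (rule card_poly_roots_bound[OF p])
  finally show False using assms(1) by simp
qed

lemma increasing_points_inj:
  assumes "increasing_points I m x" shows "inj_on (\<lambda>i. x $ i) {..<m}"
proof (rule inj_onI)
  fix i j assume "i \<in> {..<m}" "j \<in> {..<m}" "x $ i = x $ j"
  then show "i = j" using assms unfolding increasing_points_def
    by (metis lessThan_iff less_irrefl linorder_neqE_nat)
qed

lemma param_spaceD:
  assumes "b \<in> param_space I k"
  shows "inj_on (($) b) {..<k}" "\<And>r t. r < k \<Longrightarrow> t \<in> I \<Longrightarrow> t \<noteq> b $ r"
  using assms by (auto simp: param_space_def inj_on_def)

text \<open>
A singular value matrix would give a nonzero numerator of degree below \<open>m\<close> with \<open>m\<close> zeros.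
\<close>
lemma det_value_matrix_rational_nonzero:
  assumes b: "b \<in> param_space I k" and x: "increasing_points I (s + 2 * k) x"
  shows "det (value_matrix (s + 2 * k) (rational_regression s k b) x) \<noteq> 0"
proof
  let ?m = "s + 2 * k" let ?f = "rational_regression s k b"
  let ?F = "value_matrix ?m ?f x"
  assume 0: "det ?F = 0"
  have F: "?F \<in> carrier_mat ?m ?m" by (simp add: value_matrix_def)
  then have "det (transpose_mat ?F) = 0" using 0 det_transpose[OF F] by simp
  then obtain v where v: "v \<in> carrier_vec ?m" "v \<noteq> 0\<^sub>v ?m" "transpose_mat ?F *\<^sub>v v = 0\<^sub>v ?m"
    using det_0_iff_vec_prod_zero_field[of "transpose_mat ?F" ?m] F by auto
  have fc: "?f t \<in> carrier_vec ?m" for t by (rule rational_regression_carrier)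
  have "poly (pf_numerator s k (($) b) v) (x $ j) = 0" if j: "j < ?m" for j
  proof -
    have "col ?F j = ?f (x $ j)"
      using j carrier_vecD[OF fc] by (intro eq_vecI) (auto simp: value_matrix_def)
    then have "v \<bullet> ?f (x $ j) = (transpose_mat ?F *\<^sub>v v) $ j"
      using j F v(1) comm_scalar_prod[OF v(1) fc] by simp
    then have "v \<bullet> ?f (x $ j) = 0" using v(3) j by simp
    moreover have ne: "\<forall>r<k. x $ j \<noteq> b $ r"
      using x j param_spaceD(2)[OF b] by (auto simp: increasing_points_def)
    moreover have "poly (denom_poly {..<k} (($) b)) (x $ j) \<noteq> 0"
      using ne by (auto simp: poly_denom_poly)
    ultimately show ?thesis by (simp add: scalar_prod_rational_regression)
  qed
  moreover have "degree (pf_numerator s k (($) b) v) < ?m"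
    using v(1,2) by (intro degree_pf_numerator) (auto intro: gr0I)
  ultimately have "pf_numerator s k (($) b) v = 0"
    using poly_eq_0_if_many_zeros increasing_points_inj[OF x] by blast
  then show False using pf_numerator_eq_0_imp[OF param_spaceD(1)[OF b] v(1)] v(2) by simp
qed

lemma continuous_on_det:
  fixes A :: "real \<Rightarrow> real mat"
  assumes "\<And>t. A t \<in> carrier_mat m m" "\<And>i j. i < m \<Longrightarrow> j < m \<Longrightarrow> continuous_on T (\<lambda>t. A t $$ (i, j))"
  shows "continuous_on T (\<lambda>t. det (A t))"
  unfolding det_def'[OF assms(1)]
  by (intro continuous_intros assms(2)) (auto dest: permutes_in_image)

text \<open>
The determinant never vanishes, and any two systems of increasing points are joined by a segment of such
systems. Its sign is therefore constant by the intermediate value theorem.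
\<close>
lemma chebyshev_system_rational:
  assumes I: "convex I" and b: "b \<in> param_space I k"
  shows "chebyshev_system I (s + 2 * k) (rational_regression s k b)"
proof -
  let ?m = "s + 2 * k" let ?f = "rational_regression s k b"
  let ?d = "\<lambda>x. det (value_matrix ?m ?f x)"
  have fcont: "continuous_on I (\<lambda>t. ?f t $ i)" if "i < ?m" for i
  proof (cases "i < s")
    case True
    then show ?thesis using that by (simp add: rational_regression_def) (intro continuous_intros)
  next
    case False
    then have "(i - s) div 2 < k" using that by auto
    then have "\<forall>t\<in>I. t - b $ ((i - s) div 2) \<noteq> 0" using param_spaceD(2)[OF b] by auto
    then have "continuous_on I (\<lambda>t. 1 / (t - b $ ((i - s) div 2)))"
      "continuous_on I (\<lambda>t. 1 / (t - b $ ((i - s) div 2)) ^ 2)"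
      by (intro continuous_intros; simp)+
    then show ?thesis using that False by (cases "even i = even s") (simp_all add: rational_regression_def)
  qed
  \<comment> \<open>Any two systems of increasing points are joined by the segment \<open>p\<close>, which stays in the set of such
    systems because the interval is convex.\<close>
  have same: "?d x * ?d y > 0" if x: "increasing_points I ?m x" and y: "increasing_points I ?m y" for x y
  proof (rule ccontr)
    assume neg: "\<not> ?d x * ?d y > 0"
    define p where "p t = vec ?m (\<lambda>i. (1 - t) * x $ i + t * y $ i)" for t :: real
    have pI: "increasing_points I ?m (p t)" if "t \<in> {0..1}" for t
    proof -
      have "p t $ i \<in> I" if "i < ?m" for i
        using that \<open>t \<in> {0..1}\<close> x y I by (auto simp: p_def increasing_points_def convex_alt)
      moreover have "p t $ i < p t $ j" if "i < j" "j < ?m" for i j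
      proof -
        have "x $ i < x $ j" "y $ i < y $ j" using that x y by (auto simp: increasing_points_def)
        then have "(1 - t) * x $ i + t * y $ i < (1 - t) * x $ j + t * y $ j"
          using \<open>t \<in> {0..1}\<close>
          by (cases "t = 0") (auto intro!: add_le_less_mono mult_left_mono mult_strict_left_mono)
        then show ?thesis using that by (simp add: p_def)
      qed
      ultimately show ?thesis by (auto simp: increasing_points_def p_def)
    qed
    have cont: "continuous_on {0..1} (\<lambda>t. ?d (p t))"
    proof (rule continuous_on_det)
      show "value_matrix ?m ?f (p t) \<in> carrier_mat ?m ?m" for t by (simp add: value_matrix_def)
      fix i j assume ij: "i < ?m" "j < ?m"
      have "continuous_on {0..1} (\<lambda>t. ?f (p t $ j) $ i)"
        by (rule continuous_on_compose2[OF fcont[OF ij(1)]])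
          (use ij pI in \<open>auto simp: p_def increasing_points_def intro!: continuous_intros\<close>)
      then show "continuous_on {0..1} (\<lambda>t. value_matrix ?m ?f (p t) $$ (i, j))"
        using ij by (simp add: value_matrix_def)
    qed
    have p01: "p 0 = x" "p 1 = y" using x y by (auto simp: p_def increasing_points_def)
    have "?d x \<noteq> 0" "?d y \<noteq> 0" using det_value_matrix_rational_nonzero[OF b] x y by auto
    then consider "?d x < 0" "?d y > 0" | "?d x > 0" "?d y < 0"
      using neg mult_pos_pos[of "?d x" "?d y"] mult_neg_neg[of "?d x" "?d y"] by linarith
    then have "\<exists>t\<in>{0..1}. ?d (p t) = 0"
    proof cases
      case 1
      then show ?thesis using IVT'[of "\<lambda>t. ?d (p t)" 0 0 1] cont p01 by auto
    next
      case 2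
      then show ?thesis using IVT2'[of "\<lambda>t. ?d (p t)" 1 0 0] cont p01 by auto
    qed
    then show False using det_value_matrix_rational_nonzero[OF b pI] by blast
  qed
  show ?thesis
  proof (cases "\<exists>x. increasing_points I ?m x")
    case True
    then obtain x where x: "increasing_points I ?m x" by blast
    have "sgn (?d x) \<in> {-1, 1}" using det_value_matrix_rational_nonzero[OF b x] by (auto simp: sgn_if)
    moreover have "sgn (?d x) * ?d y > 0" if "increasing_points I ?m y" for y
      using same[OF x that] by (auto simp: sgn_if zero_less_mult_iff)
    ultimately show ?thesis unfolding chebyshev_system_def by blast
  qed (auto simp: chebyshev_system_def)
qed

lemma chebyshev_points_of_numerator:
  assumes I: "convex I" and b: "b \<in> param_space I k" and N: "degree N < s + 2 * k"
    and le: "\<And>t. t \<in> I \<Longrightarrow> \<bar>poly N t\<bar> \<le> poly (denom_poly {..<k} (($) b)) t"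
    and x: "increasing_points I (s + 2 * k) x"
    and alt: "\<And>i. i < s + 2 * k \<Longrightarrow> poly N (x $ i) = (-1) ^ Suc i * poly (denom_poly {..<k} (($) b)) (x $ i)"
  obtains c where "chebyshev_polynomial_points I (s + 2 * k) (rational_regression s k b) c x"
proof -
  let ?D = "poly (denom_poly {..<k} (($) b))"
  obtain c where c: "c \<in> carrier_vec (s + 2 * k)" "pf_numerator s k (($) b) c = N"
    using pf_numerator_surj[OF param_spaceD(1)[OF b] N] .
  have D: "?D t > 0" if "t \<in> I" for t
    using param_spaceD(2)[OF b _ that] unfolding poly_denom_poly by (intro prod_pos) force
  have cf: "c \<bullet> rational_regression s k b t = poly N t / ?D t" if "t \<in> I" for t
    using scalar_prod_rational_regression[of k t b c s] param_spaceD(2)[OF b _ that] c(2) by simp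
  have xI: "x $ i \<in> I" if "i < s + 2 * k" for i using x that by (auto simp: increasing_points_def)
  have "chebyshev_polynomial_points I (s + 2 * k) (rational_regression s k b) c x"
    unfolding chebyshev_polynomial_points_def
  proof (intro conjI allI ballI impI)
    show "\<bar>c \<bullet> rational_regression s k b t\<bar> \<le> 1" if "t \<in> I" for t
      using le[OF that] D[OF that] by (simp add: cf[OF that])
    show "c \<bullet> rational_regression s k b (x $ i) = (- 1) ^ Suc i" if "i < s + 2 * k" for i
      using alt[OF that] D[OF xI[OF that]] by (simp add: cf[OF xI[OF that]])
  qed (use x c chebyshev_system_rational[OF I b] in auto)
  then show ?thesis by (rule that)
qed

text \<open>
The numerator of a Chebyshev polynomial up to sign. The points may run in either direction, since affine maps and
the parametrization by the cosine reverse it; the first value is normalized to be positive.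
\<close>
definition equioscillates ::
    "real set \<Rightarrow> nat \<Rightarrow> nat \<Rightarrow> (nat \<Rightarrow> real) \<Rightarrow> real poly \<Rightarrow> (nat \<Rightarrow> real) \<Rightarrow> bool" where
  "equioscillates I m k b N X \<longleftrightarrow>
     degree N < m \<and> (\<forall>t\<in>I. \<bar>poly N t\<bar> \<le> poly (denom_poly {..<k} b) t) \<and>
     (strict_mono_on {..<m} X \<or> strict_antimono_on {..<m} X) \<and>
     (\<forall>i<m. X i \<in> I \<and> poly N (X i) = (-1) ^ i * poly (denom_poly {..<k} b) (X i))"

text \<open>
Listing the points in increasing order reverses a decreasing sequence, which multiplies the sign pattern
by a power of \<open>-1\<close>; the factor \<open>\<sigma>\<close> restores the convention that the first value is \<open>-1\<close>.
\<close>
lemma equioscillates_increasing: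
  assumes eq: "equioscillates I m k b N X"
  obtains \<sigma> x where "\<sigma> \<in> {1, -1 :: real}" "increasing_points I m x"
    "\<And>i. i < m \<Longrightarrow> poly (Polynomial.smult \<sigma> N) (x $ i) = (-1) ^ Suc i * poly (denom_poly {..<k} b) (x $ i)"
proof -
  have X: "\<And>i. i < m \<Longrightarrow> X i \<in> I"
    and alt: "\<And>i. i < m \<Longrightarrow> poly N (X i) = (-1) ^ i * poly (denom_poly {..<k} b) (X i)"
    using eq by (auto simp: equioscillates_def)
  consider (inc) "strict_mono_on {..<m} X" | (dec) "strict_antimono_on {..<m} X"
    using eq by (auto simp: equioscillates_def)
  then show ?thesis
  proof cases
    case inc
    then have "increasing_points I m (vec m X)"
      using X by (auto simp: increasing_points_def strict_mono_on_def)
    then show ?thesis using alt by (intro that[of "-1" "vec m X"]) auto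
  next
    case dec
    let ?x = "vec m (\<lambda>i. X (m - Suc i))"
    have "X (m - Suc i) < X (m - Suc j)" if "i < j" "j < m" for i j
      using dec that by (auto simp: monotone_on_def)
    then have x: "increasing_points I m ?x" using X by (auto simp: increasing_points_def)
    have sg: "(-1) ^ m * (-1) ^ (m - Suc i) = (-1 :: real) ^ Suc i" if "i < m" for i
    proof -
      have "m + (m - Suc i) = Suc i + 2 * (m - Suc i)" using that by linarith
      then show ?thesis by (metis power_add power_mult power_minus1_even power_one mult.right_neutral)
    qed
    show ?thesis
    proof (rule that[of "(-1) ^ m" ?x])
      show "(-1) ^ m \<in> {1, -1 :: real}" by (cases "even m") auto
      show "poly (Polynomial.smult ((-1) ^ m) N) (?x $ i) =
          (-1) ^ Suc i * poly (denom_poly {..<k} b) (?x $ i)" if i: "i < m" for i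
        using i alt[of "m - Suc i"] by (simp only: sg[OF i, symmetric]) simp
    qed (rule x)
  qed
qed

lemma chebyshev_points_of_equioscillation:
  assumes I: "convex I" and b: "b \<in> param_space I k"
    and eq: "equioscillates I (s + 2 * k) k (($) b) N X"
  obtains c x where "chebyshev_polynomial_points I (s + 2 * k) (rational_regression s k b) c x"
proof -
  obtain \<sigma> x where x: "\<sigma> \<in> {1, -1 :: real}" "increasing_points I (s + 2 * k) x"
    "\<And>i. i < s + 2 * k \<Longrightarrow> poly (Polynomial.smult \<sigma> N) (x $ i) = (-1) ^ Suc i * poly (denom_poly {..<k} (($) b)) (x $ i)"
    by (rule equioscillates_increasing[OF eq]) blast
  have a1: "degree (Polynomial.smult \<sigma> N) < s + 2 * k"
    using eq x(1) by (auto simp: equioscillates_def)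
  have a2: "\<bar>poly (Polynomial.smult \<sigma> N) t\<bar> \<le> poly (denom_poly {..<k} (($) b)) t" if "t \<in> I" for t
    using eq x(1) that by (auto simp: equioscillates_def)
  obtain c where "chebyshev_polynomial_points I (s + 2 * k) (rational_regression s k b) c x"
    by (rule chebyshev_points_of_numerator[OF I b a1 a2 x(2,3)])
  then show ?thesis by (rule that)
qed

lemma poly_denom_poly_affine:
  assumes "\<mu> \<noteq> 0"
  shows "poly (denom_poly {..<k} (\<lambda>r. u + \<mu> * b r)) (u + \<mu> * t) = \<mu> ^ (2 * k) * poly (denom_poly {..<k} b) t"
proof -
  have "poly (denom_poly {..<k} (\<lambda>r. u + \<mu> * b r)) (u + \<mu> * t) = (\<Prod>r<k. \<mu> ^ 2 * (t - b r) ^ 2)"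
    unfolding poly_denom_poly by (intro prod.cong refl) (simp add: algebra_simps flip: power_mult_distrib)
  then show ?thesis by (simp add: prod.distrib poly_denom_poly power_mult)
qed

text \<open>
The factor \<open>\<mu> ^ (2 * k)\<close> by which the denominator changes is absorbed by the numerator.
\<close>
lemma equioscillates_affine:
  assumes eq: "equioscillates I m k b N X" and mu: "\<mu> \<noteq> 0"
  obtains N' where "equioscillates ((\<lambda>t. u + \<mu> * t) ` I) m k (\<lambda>r. u + \<mu> * b r) N' (\<lambda>i. u + \<mu> * X i)"
proof -
  define N' where "N' = Polynomial.smult (\<mu> ^ (2 * k)) (pcompose N [:- u / \<mu>, 1 / \<mu>:])"
  have P: "poly N' (u + \<mu> * t) = \<mu> ^ (2 * k) * poly N t" for t
    using mu by (simp add: N'_def poly_pcompose field_simps)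
  \<comment> \<open>A negative factor exchanges the two orders.\<close>
  have mono: "strict_mono_on {..<m} (\<lambda>i. u + \<mu> * X i) \<or> strict_antimono_on {..<m} (\<lambda>i. u + \<mu> * X i)"
    using eq mu by (cases "\<mu> > 0") (auto simp: equioscillates_def monotone_on_def not_less)
  have "degree N' = degree N" using mu by (simp add: N'_def degree_pcompose)
  moreover have "\<bar>\<mu> ^ (2 * k) * poly N t\<bar> \<le> \<mu> ^ (2 * k) * poly (denom_poly {..<k} b) t" if "t \<in> I" for t
    using eq that by (auto simp: equioscillates_def abs_mult power_mult intro!: mult_left_mono)
  ultimately have "equioscillates ((\<lambda>t. u + \<mu> * t) ` I) m k (\<lambda>r. u + \<mu> * b r) N' (\<lambda>i. u + \<mu> * X i)"
    unfolding equioscillates_def using eq mono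
    by (auto simp: equioscillates_def P poly_denom_poly_affine[OF mu])
  then show ?thesis by (rule that)
qed

section \<open>Blaschke products on the unit circle\<close>

definition complex_eval :: "real poly \<Rightarrow> complex \<Rightarrow> complex" where
  "complex_eval p z = poly (map_poly of_real p) z"

lemma complex_eval_pCons: "complex_eval (pCons a p) z = of_real a + z * complex_eval p z"
  by (cases "p = 0 \<and> a = 0") (auto simp: complex_eval_def map_poly_pCons)

lemma complex_eval_0: "complex_eval 0 z = 0"
  by (simp add: complex_eval_def)

lemma complex_eval_add: "complex_eval (p + q) z = complex_eval p z + complex_eval q z"
  by (induction p q rule: poly_induct2) (simp_all add: complex_eval_pCons complex_eval_0 algebra_simps)

lemma complex_eval_smult: "complex_eval (Polynomial.smult c p) z = of_real c * complex_eval p z"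
  by (induction p) (simp_all add: complex_eval_pCons complex_eval_0 algebra_simps)

lemma complex_eval_mult: "complex_eval (p * q) z = complex_eval p z * complex_eval q z"
  by (induction p) (simp_all add: complex_eval_pCons complex_eval_0 complex_eval_add complex_eval_smult algebra_simps)

lemma complex_eval_1: "complex_eval 1 z = 1"
  by (simp add: one_pCons complex_eval_pCons complex_eval_0)

lemma complex_eval_power: "complex_eval (p ^ n) z = complex_eval p z ^ n"
  by (induction n) (simp_all add: complex_eval_1 complex_eval_mult)

lemma complex_eval_prod: "complex_eval (\<Prod>r\<in>R. p r) z = (\<Prod>r\<in>R. complex_eval (p r) z)"
  by (induction R rule: infinite_finite_induct) (simp_all add: complex_eval_1 complex_eval_mult)

lemma complex_eval_altdef:
  assumes "degree p \<le> d"
  shows "complex_eval p z = (\<Sum>i\<le>d. of_real (poly.coeff p i) * z ^ i)"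
proof -
  have "complex_eval p z = (\<Sum>i\<le>degree p. of_real (poly.coeff p i) * z ^ i)"
    by (simp add: complex_eval_def poly_altdef coeff_map_poly degree_map_poly)
  also have "\<dots> = (\<Sum>i\<le>d. of_real (poly.coeff p i) * z ^ i)"
    using assms by (intro sum.mono_neutral_left) (auto simp: coeff_eq_0)
  finally show ?thesis .
qed

lemma degree_tau_poly: "degree (tau_poly k \<tau>) = 4 * k"
  unfolding tau_poly_def by (subst degree_prod_sum_eq) (auto simp: degree_power_eq)

lemma complex_eval_tau_poly:
  "complex_eval (tau_poly k \<tau>) z = (\<Prod>r<k. (z - of_real (\<tau> $ r)) ^ 4)"
  by (simp add: tau_poly_def complex_eval_prod complex_eval_power complex_eval_pCons complex_eval_0)

text \<open>
The polynomials are the Chebyshev polynomials of the first kind.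
\<close>
lemma cos_multiple_poly: "\<exists>p. degree p \<le> n \<and> (\<forall>\<theta>. poly p (cos \<theta>) = cos (real n * \<theta>))"
proof (induction n rule: less_induct)
  case (less n)
  consider "n = 0" | "n = 1" | m where "n = Suc (Suc m)" by (metis One_nat_def not0_implies_Suc)
  then show ?case
  proof cases
    case 1 then show ?thesis by (intro exI[of _ 1]) simp
  next
    case 2 then show ?thesis by (intro exI[of _ "[:0, 1:]"]) simp
  next
    case 3
    obtain p q where p: "degree p \<le> Suc m" "\<And>\<theta>. poly p (cos \<theta>) = cos (real (Suc m) * \<theta>)"
      and q: "degree q \<le> m" "\<And>\<theta>. poly q (cos \<theta>) = cos (real m * \<theta>)"
      using less.IH[of "Suc m"] less.IH[of m] 3 by auto
    have "degree ([:0, 2:] * p - q) \<le> n"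
    proof (rule degree_diff_le)
      show "degree ([:0, 2:] * p) \<le> n" using degree_mult_le[of "[:0, 2:]" p] p(1) 3 by simp
    qed (use q 3 in simp)
    moreover have "poly ([:0, 2:] * p - q) (cos \<theta>) = cos (real n * \<theta>)" for \<theta>
    proof -
      have "real n * \<theta> = real (Suc m) * \<theta> + \<theta>" "real m * \<theta> = real (Suc m) * \<theta> - \<theta>"
        using 3 by (simp_all add: algebra_simps)
      then show ?thesis using p(2)[of \<theta>] q(2)[of \<theta>] by (simp add: cos_add cos_diff)
    qed
    ultimately show ?thesis by blast
  qed
qed

lemma chebyshev_U_nat_sin: "sin \<theta> * poly (chebyshev_U_nat n) (cos \<theta>) = sin (real (Suc n) * \<theta>)"
proof (induction n rule: chebyshev_U_nat.induct)
  case 2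
  have "sin (2 * \<theta>) = 2 * sin \<theta> * cos \<theta>" by (rule sin_double)
  then show ?case by simp
next
  case (3 n)
  have "real (Suc (Suc (Suc n))) * \<theta> = real (Suc (Suc n)) * \<theta> + \<theta>"
    "real (Suc n) * \<theta> = real (Suc (Suc n)) * \<theta> - \<theta>" by (simp_all add: algebra_simps)
  then have "sin (real (Suc (Suc (Suc n))) * \<theta>) = 2 * cos \<theta> * sin (real (Suc (Suc n)) * \<theta>) - sin (real (Suc n) * \<theta>)"
    by (simp add: sin_add sin_diff)
  then show ?case using 3 by (simp add: algebra_simps)
qed simp

text \<open>
The conventions for negative indices are exactly those that keep the trigonometric formula valid: both
sides are odd in \<open>j + 1\<close>.
\<close>
lemma chebyshev_U_sin: "sin \<theta> * poly (chebyshev_U j) (cos \<theta>) = sin (of_int (j + 1) * \<theta>)"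
proof -
  consider "j \<ge> 0" | "j = -1" | "j < -1" by linarith
  then show ?thesis
  proof cases
    case 1
    then show ?thesis using chebyshev_U_nat_sin[of \<theta> "nat j"] by (simp add: chebyshev_U_def add.commute)
  next
    case 3
    then have "of_int (j + 1) * \<theta> = - (real (Suc (nat (- j - 2))) * \<theta>)" by (simp add: algebra_simps)
    then have "sin (of_int (j + 1) * \<theta>) = - (sin \<theta> * poly (chebyshev_U_nat (nat (- j - 2))) (cos \<theta>))"
      unfolding chebyshev_U_nat_sin by (simp only: sin_minus)
    then show ?thesis using 3 by (simp add: chebyshev_U_def)
  qed (simp add: chebyshev_U_def)
qed

lemma degree_chebyshev_U_nat: "degree (chebyshev_U_nat n) \<le> n"
proof (induction n rule: chebyshev_U_nat.induct)
  case (3 n)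
  have "degree ([:0, 2:] * chebyshev_U_nat (Suc n)) \<le> Suc (Suc n)"
    using degree_mult_le[of "[:0, 2:]" "chebyshev_U_nat (Suc n)"] 3 by simp
  then show ?case using 3 by (auto intro: degree_diff_le)
qed auto

lemma degree_chebyshev_U: "degree (chebyshev_U j) \<le> nat (max j (- j - 2))"
  using degree_chebyshev_U_nat[of "nat j"] degree_chebyshev_U_nat[of "nat (- j - 2)"]
  by (auto simp: chebyshev_U_def)

text \<open>
A continuous argument of \<open>z\<^sup>n \<Prod>\<^sub>r ((z - \<tau>\<^sub>r) / (1 - \<tau>\<^sub>r z))\<^sup>2\<close> at \<open>z = cis \<theta>\<close>. On the unit circle
\<open>z - \<tau> = z (1 - \<tau> cnj z)\<close> and \<open>1 - \<tau> z\<close> is the conjugate of \<open>1 - \<tau> cnj z\<close>, which lies in the right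
half-plane, so that its principal argument is continuous.
\<close>
definition blaschke_phase :: "nat \<Rightarrow> nat \<Rightarrow> real vec \<Rightarrow> real \<Rightarrow> real" where
  "blaschke_phase n k \<tau> \<theta> =
     real n * \<theta> + 2 * (\<Sum>r<k. \<theta> + 2 * Arg (1 - of_real (\<tau> $ r) * cis (- \<theta>)))"

text \<open>
The polynomial in \<open>cos \<theta>\<close> with value \<open>\<Prod>\<^sub>r \<bar>cis \<theta> - \<tau>\<^sub>r\<bar> ^ 4\<close>; it is a constant multiple of the common
denominator when \<open>2 b\<^sub>r = \<tau>\<^sub>r + 1 / \<tau>\<^sub>r\<close>.
\<close>
definition distance_poly :: "nat \<Rightarrow> real vec \<Rightarrow> real poly" where
  "distance_poly k \<tau> = (\<Prod>r<k. [:1 + (\<tau> $ r)\<^sup>2, - 2 * \<tau> $ r:] ^ 2)"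

lemma poly_distance_poly: "poly (distance_poly k \<tau>) y = (\<Prod>r<k. (1 - 2 * \<tau> $ r * y + (\<tau> $ r)\<^sup>2) ^ 2)"
  by (simp add: distance_poly_def poly_prod algebra_simps)

lemma blaschke_denominator_nonzero:
  assumes "\<bar>t\<bar> < 1" shows "1 - of_real t * cis \<theta> \<noteq> 0" "1 - of_real t * cis \<theta> \<notin> \<real>\<^sub>\<le>\<^sub>0"
proof -
  have "t * cos \<theta> \<le> \<bar>t\<bar> * 1"
    unfolding abs_mult[of t "cos \<theta>", symmetric] by (rule order.trans[OF abs_ge_self]) (auto simp: abs_mult intro!: mult_left_le)
  then have "Re (1 - of_real t * cis \<theta>) > 0" using assms by simp
  moreover have "Re z > 0 \<Longrightarrow> z \<noteq> 0 \<and> z \<notin> \<real>\<^sub>\<le>\<^sub>0" for z by (auto simp: complex_nonpos_Reals_iff)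
  ultimately show "1 - of_real t * cis \<theta> \<noteq> 0" "1 - of_real t * cis \<theta> \<notin> \<real>\<^sub>\<le>\<^sub>0"
    by blast+
qed

lemma cis_blaschke:
  assumes t: "\<bar>t\<bar> < 1"
  shows "cis (\<theta> + 2 * Arg (1 - of_real t * cis (- \<theta>))) * (1 - of_real t * cis \<theta>) = cis \<theta> - of_real t"
proof -
  define w where "w = 1 - of_real t * cis (- \<theta>)"
  have w: "w = of_real (cmod w) * cis (Arg w)" using rcis_cmod_Arg[of w] by (simp add: rcis_def)
  have "1 - of_real t * cis \<theta> = cnj w" by (simp add: w_def cis_cnj)
  also have "\<dots> = of_real (cmod w) * cis (- Arg w)" by (subst w) (simp add: cis_cnj)
  finally have "cis (\<theta> + 2 * Arg w) * (1 - of_real t * cis \<theta>) = of_real (cmod w) * (cis (\<theta> + 2 * Arg w) * cis (- Arg w))"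
    by simp
  also have "cis (\<theta> + 2 * Arg w) * cis (- Arg w) = cis \<theta> * cis (Arg w)" by (simp add: cis_mult add.commute)
  also have "of_real (cmod w) * (cis \<theta> * cis (Arg w)) = cis \<theta> * (of_real (cmod w) * cis (Arg w))"
    by (simp add: mult_ac)
  also have "\<dots> = cis \<theta> * w" using w by simp
  also have "\<dots> = cis \<theta> - of_real t" by (simp add: w_def algebra_simps cis_mult)
  finally show ?thesis by (simp add: w_def)
qed

text \<open>
Multiplication by \<open>\<bar>z - \<tau>\<bar> ^ 4\<close> turns the squared Blaschke factor into \<open>(z - \<tau>) ^ 4 / z\<^sup>2\<close>. This is where the
fourth powers in \<open>tau_poly\<close> and the shift of the indices by \<open>2 k\<close> come from.
\<close>
lemma cis_blaschke_phase:
  assumes "\<forall>r<k. \<bar>\<tau> $ r\<bar> < 1"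
  shows "cis (blaschke_phase n k \<tau> \<theta>) * of_real (poly (distance_poly k \<tau>) (cos \<theta>)) =
     cis ((real n - 2 * real k) * \<theta>) * complex_eval (tau_poly k \<tau>) (cis \<theta>)"
proof -
  let ?A = "\<lambda>r. \<theta> + 2 * Arg (1 - of_real (\<tau> $ r) * cis (- \<theta>))"
  have fac: "cis (2 * ?A r) * of_real ((1 - 2 * \<tau> $ r * cos \<theta> + (\<tau> $ r)\<^sup>2) ^ 2) =
      cis (- 2 * \<theta>) * (cis \<theta> - of_real (\<tau> $ r)) ^ 4" if "r < k" for r
  proof -
    let ?t = "complex_of_real (\<tau> $ r)"
    define a where "a = ?A r"
    have "cis (2 * a) = cis (a) ^ 2" by (simp add: Complex.DeMoivre)
    moreover have "of_real (1 - 2 * \<tau> $ r * cos \<theta> + (\<tau> $ r)\<^sup>2) = (1 - ?t * cis \<theta>) * (1 - ?t * cis (- \<theta>))"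
    proof -
      have "of_real (1 - 2 * \<tau> $ r * cos \<theta> + (\<tau> $ r)\<^sup>2) = 1 - ?t * (cis \<theta> + cis (- \<theta>)) + ?t\<^sup>2 * (cis \<theta> * cis (- \<theta>))"
        by (simp add: cis_mult complex_eq_iff power2_eq_square)
      then show ?thesis by (simp add: algebra_simps power2_eq_square)
    qed
    ultimately have "cis (2 * a) * of_real ((1 - 2 * \<tau> $ r * cos \<theta> + (\<tau> $ r)\<^sup>2) ^ 2) =
        (cis (a) * (1 - ?t * cis \<theta>)) ^ 2 * (1 - ?t * cis (- \<theta>)) ^ 2"
      by (simp add: power_mult_distrib)
    also have "cis (a) * (1 - ?t * cis \<theta>) = cis \<theta> - ?t"
      using assms that unfolding a_def by (intro cis_blaschke) auto
    also have "1 - ?t * cis (- \<theta>) = cis (- \<theta>) * (cis \<theta> - ?t)"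
      by (simp add: algebra_simps cis_mult)
    also have "(cis \<theta> - ?t) ^ 2 * (cis (- \<theta>) * (cis \<theta> - ?t)) ^ 2 = cis (- \<theta>) ^ 2 * (cis \<theta> - ?t) ^ 4"
      by (simp add: power_mult_distrib eval_nat_numeral)
    also have "cis (- \<theta>) ^ 2 = cis (- 2 * \<theta>)" by (simp add: Complex.DeMoivre)
    finally show ?thesis by (simp only: a_def)
  qed
  have sum_cis: "cis (\<Sum>r\<in>R. g r) = (\<Prod>r\<in>R. cis (g r))" for g :: "nat \<Rightarrow> real" and R
    by (induction R rule: infinite_finite_induct) (simp_all flip: cis_mult)
  have "cis (blaschke_phase n k \<tau> \<theta>) * of_real (poly (distance_poly k \<tau>) (cos \<theta>)) =
    cis (real n * \<theta>) * ((\<Prod>r<k. cis (2 * ?A r)) * (\<Prod>r<k. of_real ((1 - 2 * \<tau> $ r * cos \<theta> + (\<tau> $ r)\<^sup>2) ^ 2)))"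
    unfolding blaschke_phase_def poly_distance_poly sum_distrib_left sum_cis[symmetric]
    by (simp add: mult.assoc flip: cis_mult)
  also have "\<dots> = cis (real n * \<theta>) * (\<Prod>r<k. cis (- 2 * \<theta>) * (cis \<theta> - of_real (\<tau> $ r)) ^ 4)"
    unfolding prod.distrib[symmetric] using fac by simp
  also have "\<dots> = cis (real n * \<theta>) * cis (- 2 * \<theta>) ^ k * complex_eval (tau_poly k \<tau>) (cis \<theta>)"
    by (simp add: prod.distrib complex_eval_tau_poly)
  also have "cis (real n * \<theta>) * cis (- 2 * \<theta>) ^ k = cis ((real n - 2 * real k) * \<theta>)"
    by (simp add: Complex.DeMoivre cis_mult algebra_simps)
  finally show ?thesis .
qed

lemma rotated_tau_poly:
  "cis ((real n - 2 * real k) * \<theta>) * complex_eval (tau_poly k \<tau>) (cis \<theta>) =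
     (\<Sum>i\<le>4 * k. of_real (poly.coeff (tau_poly k \<tau>) i) * cis (of_int (int n - 2 * int k + int i) * \<theta>))"
  unfolding complex_eval_altdef[OF eq_refl[OF degree_tau_poly]] sum_distrib_left
  by (intro sum.cong refl) (simp add: Complex.DeMoivre cis_mult algebra_simps)

text \<open>
The Laurent polynomial of \<open>rotated_tau_poly\<close> has exponents between \<open>n - 2 k\<close> and \<open>n + 2 k\<close>, and the real part
of \<open>cis (j * \<theta>)\<close> is a polynomial of degree at most \<open>\<bar>j\<bar>\<close> in \<open>cos \<theta>\<close>.
\<close>
lemma cos_blaschke_phase_poly:
  assumes "\<forall>r<k. \<bar>\<tau> $ r\<bar> < 1"
  obtains N where "degree N \<le> n + 2 * k"
    "\<And>\<theta>. poly N (cos \<theta>) = cos (blaschke_phase n k \<tau> \<theta>) * poly (distance_poly k \<tau>) (cos \<theta>)"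
proof -
  have "\<exists>p :: real poly. degree p \<le> n + 2 * k \<and> (\<forall>\<theta>. poly p (cos \<theta>) = cos (of_int (int n - 2 * int k + int i) * \<theta>))"
    if "i \<le> 4 * k" for i
  proof -
    let ?j = "int n - 2 * int k + int i"
    obtain p where p: "degree p \<le> nat \<bar>?j\<bar>" "\<And>\<theta>. poly p (cos \<theta>) = cos (real (nat \<bar>?j\<bar>) * \<theta>)"
      using cos_multiple_poly[of "nat \<bar>?j\<bar>"] by blast
    have "nat \<bar>?j\<bar> \<le> n + 2 * k" using that by linarith
    moreover have "cos (real (nat \<bar>?j\<bar>) * \<theta>) = cos (of_int ?j * \<theta>)" for \<theta>
    proof (cases "?j \<ge> 0")
      case False
      then have "real (nat \<bar>?j\<bar>) * \<theta> = - (of_int ?j * \<theta>)" by (simp add: algebra_simps)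
      then show ?thesis by (metis cos_minus)
    qed simp
    ultimately show ?thesis using p by (intro exI[of _ p]) auto
  qed
  then have "\<forall>i\<in>{..4 * k}. \<exists>p :: real poly. degree p \<le> n + 2 * k \<and>
      (\<forall>\<theta>. poly p (cos \<theta>) = cos (of_int (int n - 2 * int k + int i) * \<theta>))" by blast
  from bchoice[OF this] obtain p :: "nat \<Rightarrow> real poly" where p: "\<And>i. i \<le> 4 * k \<Longrightarrow> degree (p i) \<le> n + 2 * k"
    "\<And>i \<theta>. i \<le> 4 * k \<Longrightarrow> poly (p i) (cos \<theta>) = cos (of_int (int n - 2 * int k + int i) * \<theta>)"
    by auto
  let ?N = "\<Sum>i\<le>4 * k. Polynomial.smult (poly.coeff (tau_poly k \<tau>) i) (p i)"
  show ?thesis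
  proof (rule that)
    show "degree ?N \<le> n + 2 * k"
      using p(1) by (intro degree_sum_le) (auto intro: order.trans[OF degree_smult_le])
    fix \<theta>
    have "cos (blaschke_phase n k \<tau> \<theta>) * poly (distance_poly k \<tau>) (cos \<theta>) =
       Re (cis (blaschke_phase n k \<tau> \<theta>) * of_real (poly (distance_poly k \<tau>) (cos \<theta>)))" by simp
    also have "\<dots> = (\<Sum>i\<le>4 * k. poly.coeff (tau_poly k \<tau>) i * cos (of_int (int n - 2 * int k + int i) * \<theta>))"
      unfolding cis_blaschke_phase[OF assms] rotated_tau_poly by (simp add: Re_sum)
    finally show "poly ?N (cos \<theta>) = cos (blaschke_phase n k \<tau> \<theta>) * poly (distance_poly k \<tau>) (cos \<theta>)"
      by (simp add: poly_sum p(2))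
  qed
qed

text \<open>
The imaginary part of the same Laurent polynomial, where \<open>sin (j * \<theta>)\<close> contributes a Chebyshev polynomial of
the second kind and a factor \<open>sin \<theta>\<close>.
\<close>
lemma chebyshev_points_poly_cos:
  assumes "s \<ge> 1"
  shows "poly (chebyshev_points_poly s k \<tau>) (cos \<theta>) =
    sin \<theta> * Im (cis ((real (s - 1) - 2 * real k) * \<theta>) * complex_eval (tau_poly k \<tau>) (cis \<theta>))"
proof -
  have "Im (cis ((real (s - 1) - 2 * real k) * \<theta>) * complex_eval (tau_poly k \<tau>) (cis \<theta>)) =
    (\<Sum>i\<le>4 * k. poly.coeff (tau_poly k \<tau>) i * sin (of_int ((- 2 * int k + int s + int i - 2) + 1) * \<theta>))"
    unfolding rotated_tau_poly Im_sum
    using assms by (intro sum.cong refl) (simp add: of_nat_diff algebra_simps)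
  also have "\<dots> = sin \<theta> * (\<Sum>i\<le>4 * k. poly.coeff (tau_poly k \<tau>) i * poly (chebyshev_U (- 2 * int k + int s + int i - 2)) (cos \<theta>))"
    unfolding chebyshev_U_sin[symmetric] sum_distrib_left by (intro sum.cong refl) (simp add: mult_ac)
  finally have "sin \<theta> * Im (cis ((real (s - 1) - 2 * real k) * \<theta>) * complex_eval (tau_poly k \<tau>) (cis \<theta>)) =
    (sin \<theta> * sin \<theta>) * (\<Sum>i\<le>4 * k. poly.coeff (tau_poly k \<tau>) i * poly (chebyshev_U (- 2 * int k + int s + int i - 2)) (cos \<theta>))"
    by simp
  also have "sin \<theta> * sin \<theta> = poly [:1, 0, -1:] (cos \<theta>)"
    using sin_cos_squared_add[of \<theta>] by (simp add: power2_eq_square algebra_simps)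
  finally show ?thesis
    by (simp only: chebyshev_points_poly_def poly_mult poly_sum poly_smult)
qed

lemma degree_chebyshev_points_poly:
  assumes "k \<ge> 1" "s \<ge> 1"
  shows "degree (chebyshev_points_poly s k \<tau>) \<le> s + 2 * k"
proof -
  have "degree (\<Sum>i\<le>4 * k. Polynomial.smult (poly.coeff (tau_poly k \<tau>) i) (chebyshev_U (- 2 * int k + int s + int i - 2)))
    \<le> s + 2 * k - 2"
    using assms
    by (intro degree_sum_le order.trans[OF degree_smult_le] order.trans[OF degree_chebyshev_U]) auto
  moreover have "degree [:1, 0, -1 :: real:] \<le> 2" by simp
  ultimately show ?thesis
    unfolding chebyshev_points_poly_def using assms by (intro order.trans[OF degree_mult_le]) linarith
qed

lemma continuous_on_blaschke_phase:
  assumes "\<forall>r<k. \<bar>\<tau> $ r\<bar> < 1"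
  shows "continuous_on A (blaschke_phase n k \<tau>)"
  unfolding blaschke_phase_def
proof (intro continuous_intros)
  show "1 - complex_of_real (\<tau> $ r) * cis (- z) \<notin> \<real>\<^sub>\<le>\<^sub>0" if "r \<in> {..<k}" for r z
    using assms that blaschke_denominator_nonzero(2) by auto
qed

lemma blaschke_phase_0:
  assumes "\<forall>r<k. \<bar>\<tau> $ r\<bar> < 1" shows "blaschke_phase n k \<tau> 0 = 0"
proof -
  have "Arg (1 - of_real (\<tau> $ r) * cis (- 0)) = 0" if "r < k" for r
    using assms that Arg_of_real[of "1 - \<tau> $ r"] by (auto simp: abs_less_iff)
  then show ?thesis by (simp add: blaschke_phase_def)
qed

lemma blaschke_phase_pi:
  assumes "\<forall>r<k. \<bar>\<tau> $ r\<bar> < 1" shows "blaschke_phase n k \<tau> pi = real (n + 2 * k) * pi"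
proof -
  have "Arg (1 - of_real (\<tau> $ r) * cis (- pi)) = 0" if "r < k" for r
  proof -
    have "1 - of_real (\<tau> $ r) * cis (- pi) = of_real (1 + \<tau> $ r)" by (simp add: complex_eq_iff)
    moreover have "1 + \<tau> $ r > 0" using assms that by (auto simp: abs_less_iff)
    ultimately show ?thesis by (simp only: Arg_of_real) simp
  qed
  then show ?thesis by (simp add: blaschke_phase_def algebra_simps)
qed

text \<open>
At \<open>z = \<i>\<close> the argument of \<open>1 - \<tau> cnj z = 1 + \<i> \<tau>\<close> is \<open>arctan \<tau>\<close>. This point corresponds to infinity in the
parametrization of the half-line below.
\<close>
lemma blaschke_phase_half_pi:
  assumes "\<And>r. r < k \<Longrightarrow> \<tau> $ r = tan (\<alpha> r)" "\<And>r. r < k \<Longrightarrow> \<bar>\<alpha> r\<bar> < pi / 2"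
  shows "blaschke_phase n k \<tau> (pi / 2) = real n * pi / 2 + real k * pi + 4 * (\<Sum>r<k. \<alpha> r)"
proof -
  have "Arg (1 - of_real (\<tau> $ r) * cis (- (pi / 2))) = \<alpha> r" if r: "r < k" for r
  proof -
    have c: "cos (\<alpha> r) > 0" using assms(2)[OF r] by (intro cos_gt_zero_pi) (auto simp: abs_less_iff)
    have "1 - of_real (\<tau> $ r) * cis (- (pi / 2)) = cis (\<alpha> r) / of_real (cos (\<alpha> r))"
      using c assms(1)[OF r] by (simp add: complex_eq_iff tan_def)
    then have "Arg (1 - of_real (\<tau> $ r) * cis (- (pi / 2))) = Arg (cis (\<alpha> r))" using c by simp
    also have "\<dots> = \<alpha> r"
      using assms(2)[OF r] by (intro cis_Arg_unique) (auto simp: abs_less_iff)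
    finally show ?thesis .
  qed
  then have "(\<Sum>r<k. pi / 2 + 2 * Arg (1 - of_real (\<tau> $ r) * cis (- (pi / 2)))) = (\<Sum>r<k. pi / 2 + 2 * \<alpha> r)"
    by (intro sum.cong) auto
  also have "\<dots> = real k * (pi / 2) + 2 * (\<Sum>r<k. \<alpha> r)" by (simp add: sum.distrib sum_distrib_left)
  finally show ?thesis by (simp add: blaschke_phase_def)
qed

text \<open>
Each point is found by the intermediate value theorem to the right of the preceding one.
\<close>
lemma increasing_multiples_of_pi:
  fixes f :: "real \<Rightarrow> real"
  assumes "continuous_on {a..b} f" "f a = 0" "a \<le> b" "real M * pi \<le> f b"
  obtains \<theta> :: "nat \<Rightarrow> real" where
    "\<And>j. j \<le> M \<Longrightarrow> \<theta> j \<in> {a..b}" "\<And>j. j \<le> M \<Longrightarrow> f (\<theta> j) = real j * pi" "strict_mono_on {..M} \<theta>"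
proof -
  have "\<exists>\<theta>. (\<forall>j\<le>M. \<theta> j \<in> {a..b} \<and> f (\<theta> j) = real j * pi) \<and> strict_mono_on {..M} \<theta>"
    using assms(4)
  proof (induction M)
    case 0
    show ?case using assms(2,3) by (intro exI[of _ "\<lambda>_. a"]) (auto simp: strict_mono_on_def)
  next
    case (Suc M)
    have le: "real M * pi \<le> f b" using Suc.prems by (simp add: algebra_simps) (use pi_gt_zero in linarith)
    obtain \<theta> where t: "\<And>j. j \<le> M \<Longrightarrow> \<theta> j \<in> {a..b}" "\<And>j. j \<le> M \<Longrightarrow> f (\<theta> j) = real j * pi"
      and mono: "strict_mono_on {..M} \<theta>" using Suc.IH[OF le] by blast
    have "\<exists>t. \<theta> M \<le> t \<and> t \<le> b \<and> f t = real (Suc M) * pi"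
    proof (rule IVT')
      show "f (\<theta> M) \<le> real (Suc M) * pi" using t(2)[of M] by (simp add: algebra_simps)
      show "continuous_on {\<theta> M..b} f" using t(1)[of M] by (intro continuous_on_subset[OF assms(1)]) auto
    qed (use t(1)[of M] Suc.prems in auto)
    then obtain t' where t': "\<theta> M \<le> t'" "t' \<le> b" "f t' = real (Suc M) * pi" by blast
    have "\<theta> M \<noteq> t'" using t' t(2)[of M] by (auto simp: algebra_simps)
    have "\<theta> j < t'" if "j \<le> M" for j
    proof (cases "j = M")
      case True
      then show ?thesis using t'(1) \<open>\<theta> M \<noteq> t'\<close> by simp
    next
      case False
      then have "\<theta> j < \<theta> M" using mono that by (auto simp: strict_mono_on_def)
      then show ?thesis using t'(1) by simp
    qed
    then have "strict_mono_on {..Suc M} (\<theta>(Suc M := t'))"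
      using mono by (auto simp: strict_mono_on_def le_Suc_eq)
    moreover have "a \<le> t'" using t(1)[of M] t'(1) by auto
    then have "(\<theta>(Suc M := t')) j \<in> {a..b} \<and> f ((\<theta>(Suc M := t')) j) = real j * pi" if "j \<le> Suc M" for j
      using t t' that by (cases "j = Suc M") auto
    ultimately show ?case by blast
  qed
  then show ?thesis using that by blast
qed

section \<open>Explicit equioscillating functions\<close>

lemma poly_distance_poly_poles:
  assumes "\<And>r. r < k \<Longrightarrow> \<tau> $ r \<noteq> 0" "\<And>r. r < k \<Longrightarrow> 2 * b r = \<tau> $ r + 1 / \<tau> $ r"
  shows "poly (distance_poly k \<tau>) y = (\<Prod>r<k. (2 * \<tau> $ r) ^ 2) * poly (denom_poly {..<k} b) y"
proof -
  have "1 - 2 * \<tau> $ r * y + (\<tau> $ r)\<^sup>2 = - (2 * \<tau> $ r) * (y - b r)" if "r < k" for r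
  proof -
    have "2 * b r * \<tau> $ r = (\<tau> $ r)\<^sup>2 + 1"
      using assms(1)[OF that] unfolding assms(2)[OF that] by (simp add: field_simps power2_eq_square)
    then show ?thesis by (simp add: algebra_simps)
  qed
  then show ?thesis
    unfolding poly_distance_poly poly_denom_poly prod.distrib[symmetric]
    by (intro prod.cong refl) (auto simp: power_mult_distrib)
qed

lemma cos_multiple_pi: "cos (real j * pi) = (-1) ^ j"
  by (induction j) (simp_all add: distrib_right cos_add)

text \<open>
The alternation points are the points where the phase is a multiple of \<open>\<pi>\<close>. The formula for the numerator in
terms of the phase is kept in the conclusion, because it identifies these points later.
\<close>
lemma equioscillates_interval_tau:
  assumes s: "s \<ge> 1" and t1: "\<forall>r<k. \<bar>\<tau> $ r\<bar> < 1"
    and t0: "\<And>r. r < k \<Longrightarrow> \<tau> $ r \<noteq> 0" and tb: "\<And>r. r < k \<Longrightarrow> 2 * b r = \<tau> $ r + 1 / \<tau> $ r"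
  obtains N X where "equioscillates {-1..1} (s + 2 * k) k b N X"
    "\<And>\<theta>. poly N (cos \<theta>) = cos (blaschke_phase (s - 1) k \<tau> \<theta>) * poly (denom_poly {..<k} b) (cos \<theta>)"
proof -
  let ?phi = "blaschke_phase (s - 1) k \<tau>" let ?D = "poly (denom_poly {..<k} b)"
  define C where "C = (\<Prod>r<k. (2 * \<tau> $ r) ^ 2)"
  have C: "C \<noteq> 0" using t0 by (auto simp: C_def)
  have dist: "poly (distance_poly k \<tau>) y = C * ?D y" for y
    unfolding C_def by (rule poly_distance_poly_poles) (use t0 tb in auto)
  obtain N0 where N0: "degree N0 \<le> s - 1 + 2 * k"
    "\<And>\<theta>. poly N0 (cos \<theta>) = cos (?phi \<theta>) * poly (distance_poly k \<tau>) (cos \<theta>)"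
    using cos_blaschke_phase_poly[OF t1, of "s - 1"] by blast
  define N where "N = Polynomial.smult (1 / C) N0"
  have Ncos: "poly N (cos \<theta>) = cos (?phi \<theta>) * ?D (cos \<theta>)" for \<theta>
    using C by (simp add: N_def N0(2) dist)
  have Dpos: "?D t \<ge> 0" for t by (simp add: poly_denom_poly prod_nonneg)
  obtain \<theta> where th: "\<And>j. j \<le> s - 1 + 2 * k \<Longrightarrow> \<theta> j \<in> {0..pi}"
    "\<And>j. j \<le> s - 1 + 2 * k \<Longrightarrow> ?phi (\<theta> j) = real j * pi" "strict_mono_on {..s - 1 + 2 * k} \<theta>"
    using increasing_multiples_of_pi[OF continuous_on_blaschke_phase[OF t1] blaschke_phase_0[OF t1], of pi "s - 1 + 2 * k" "s - 1"]
      blaschke_phase_pi[OF t1, of "s - 1"] by auto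
  have "equioscillates {-1..1} (s + 2 * k) k b N (\<lambda>j. cos (\<theta> j))"
    unfolding equioscillates_def
  proof (intro conjI ballI allI impI)
    show "degree N < s + 2 * k" using N0(1) s C by (simp add: N_def)
    show "\<bar>poly N t\<bar> \<le> ?D t" if "t \<in> {-1..1}" for t
      using Ncos[of "arccos t"] that Dpos[of t] by (simp add: abs_mult mult_left_le_one_le)
    have "cos (\<theta> j) < cos (\<theta> i)" if "i < j" "j < s + 2 * k" for i j
    proof -
      have "i \<le> s - 1 + 2 * k" "j \<le> s - 1 + 2 * k" using that s by auto
      then show ?thesis
        using th(1)[of i] th(1)[of j] th(3) that by (intro cos_monotone_0_pi) (auto simp: strict_mono_on_def)
    qed
    then show "strict_mono_on {..<s + 2 * k} (\<lambda>j. cos (\<theta> j)) \<or> strict_antimono_on {..<s + 2 * k} (\<lambda>j. cos (\<theta> j))"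
      by (auto simp: monotone_on_def)
    show "cos (\<theta> i) \<in> {-1..1}" for i by simp
    show "poly N (cos (\<theta> i)) = (-1) ^ i * ?D (cos (\<theta> i))" if "i < s + 2 * k" for i
      using th(2)[of i] that s by (simp add: Ncos cos_multiple_pi)
  qed
  then show ?thesis using Ncos by (rule that)
qed

text \<open>
The two solutions are reciprocal to each other, and the one with the larger modulus exceeds \<open>\<bar>b\<bar>\<close>.
\<close>
lemma tau_exists:
  fixes b :: real
  assumes "b \<notin> {-1..1}"
  obtains t where "\<bar>t\<bar> < 1" "t \<noteq> 0" "2 * b = t + 1 / t"
proof -
  define q where "q = sqrt (b\<^sup>2 - 1)"
  have b1: "\<bar>b\<bar> > 1" using assms by (auto simp: abs_if)
  then have "b\<^sup>2 > 1" by (simp add: abs_square_less_1 flip: not_le abs_square_le_1)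
  then have q: "q > 0" "q\<^sup>2 = b\<^sup>2 - 1" by (auto simp: q_def)
  define t where "t = b - sgn b * q"
  define t' where "t' = b + sgn b * q"
  have sg: "sgn b * sgn b = 1" using b1 by (auto simp: sgn_if)
  have "t * t' = b\<^sup>2 - (sgn b * sgn b) * q\<^sup>2" by (simp add: t_def t'_def algebra_simps power2_eq_square)
  then have tt: "t * t' = 1" using q(2) sg by simp
  have "\<bar>t'\<bar> = \<bar>b\<bar> + q" using q(1) b1 by (auto simp: t'_def sgn_if abs_if)
  then have t'1: "\<bar>t'\<bar> > 1" using b1 q(1) by linarith
  have t0: "t \<noteq> 0" using tt by auto
  have t'eq: "t' = 1 / t" using tt t0 by (simp add: field_simps)
  show ?thesis
  proof (rule that)
    show "\<bar>t\<bar> < 1" using t'1 t0 unfolding t'eq by (simp add: abs_divide divide_less_eq less_divide_eq)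
    show "2 * b = t + 1 / t" unfolding t'eq[symmetric] by (simp add: t_def t'_def)
  qed (rule t0)
qed

lemma equioscillates_unit_interval:
  assumes s: "s \<ge> 1" and b: "\<And>r. r < k \<Longrightarrow> b r \<notin> {-1..1}"
  obtains N X where "equioscillates {-1..1} (s + 2 * k) k b N X"
proof -
  have "\<forall>r\<in>{..<k}. \<exists>t. \<bar>t\<bar> < 1 \<and> t \<noteq> 0 \<and> 2 * b r = t + 1 / t" 
  proof
    fix r assume "r \<in> {..<k}"
    then have "b r \<notin> {-1..1}" using b by simp
    from tau_exists[OF this] show "\<exists>t. \<bar>t\<bar> < 1 \<and> t \<noteq> 0 \<and> 2 * b r = t + 1 / t" by metis
  qed
  from bchoice[OF this] obtain t where t: "\<forall>r\<in>{..<k}. \<bar>t r\<bar> < 1 \<and> t r \<noteq> 0 \<and> 2 * b r = t r + 1 / t r" by blast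
  have ts: "\<forall>r<k. \<bar>vec k t $ r\<bar> < 1" "\<And>r. r < k \<Longrightarrow> vec k t $ r \<noteq> 0"
    "\<And>r. r < k \<Longrightarrow> 2 * b r = vec k t $ r + 1 / vec k t $ r"
    using t by auto
  obtain N X where "equioscillates {-1..1} (s + 2 * k) k b N X"
    by (rule equioscillates_interval_tau[OF s ts])
  then show ?thesis by (rule that)
qed

lemma equioscillates_compact_interval:
  assumes s: "s \<ge> 1" and uv: "u < v" and b: "\<And>r. r < k \<Longrightarrow> b r \<notin> {u..v}"
  obtains N X where "equioscillates {u..v} (s + 2 * k) k b N X"
proof -
  define \<mu> where "\<mu> = (v - u) / 2"
  define u0 where "u0 = (u + v) / 2"
  have mu: "\<mu> > 0" using uv by (simp add: \<mu>_def)
  have b': "(b r - u0) / \<mu> \<notin> {-1..1}" if "r < k" for r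
  proof
    assume "(b r - u0) / \<mu> \<in> {-1..1}"
    then have "- \<mu> \<le> b r - u0" "b r - u0 \<le> \<mu>" using mu by (auto simp: divide_le_eq le_divide_eq)
    then show False using b[OF that] by (auto simp: \<mu>_def u0_def field_simps)
  qed
  obtain N X where NX: "equioscillates {-1..1} (s + 2 * k) k (\<lambda>r. (b r - u0) / \<mu>) N X"
    by (rule equioscillates_unit_interval[where b = "\<lambda>r. (b r - u0) / \<mu>", OF s b'])
  obtain N' where N': "equioscillates ((\<lambda>t. u0 + \<mu> * t) ` {-1..1}) (s + 2 * k) k (\<lambda>r. u0 + \<mu> * ((b r - u0) / \<mu>)) N' (\<lambda>i. u0 + \<mu> * X i)"
    by (rule equioscillates_affine[OF NX, of \<mu> u0]) (use mu in simp)
  have I: "(\<lambda>t. u0 + \<mu> * t) ` {-1..1} = {u..v}"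
    using image_affinity_atLeastAtMost[of \<mu> u0 "-1" 1] mu by (simp add: \<mu>_def u0_def field_simps add.commute)
  have B: "(\<lambda>r. u0 + \<mu> * ((b r - u0) / \<mu>)) = b" using mu by auto
  show ?thesis using N' unfolding I B by (rule that)
qed

text \<open>
The numerator on \<open>[0, \<infinity>)\<close> without a constant among the regression functions. Under
\<open>cos \<theta> = 1 / (1 + 2 h t)\<close> the half-line corresponds to \<open>0 \<le> \<theta> < \<pi> / 2\<close>, and a pole \<open>b < 0\<close> corresponds to
\<open>\<tau> = tan \<alpha>\<close> with \<open>sin (2 \<alpha>) = 1 + 2 b h\<close>. By \<open>blaschke_phase_half_pi\<close> the phase tends to
\<open>k \<pi> + 4 \<Sum> \<alpha>\<close> at infinity. The requirement that this equals \<open>(2 k - 1/2) \<pi>\<close> determines \<open>h\<close>; it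
makes the function vanish at infinity, which lowers the degree of the numerator to \<open>2 k - 1\<close>, and leaves
room for exactly \<open>2 k\<close> multiples of \<open>\<pi>\<close>.
\<close>
lemma equioscillates_half_line:
  assumes k: "k \<ge> 1" and b: "\<And>r. r < k \<Longrightarrow> b r < 0"
  obtains N X where "equioscillates {0..} (2 * k) k b N X"
proof -
  let ?g = "\<lambda>h. \<Sum>r<k. arcsin (1 + 2 * b r * h)"
  let ?T = "real k * (pi / 2) - pi / 4"
  define B where "B = Max ((\<lambda>r. - b r) ` {..<k})"
  have "B \<in> (\<lambda>r. - b r) ` {..<k}" unfolding B_def using k by (intro Max_in) (auto simp: lessThan_empty_iff)
  then obtain q where q: "q < k" "B = - b q" by auto
  have B: "- b r \<le> B" if "r < k" for r unfolding B_def using that by (intro Max_ge) auto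
  have B0: "B > 0" using q b by simp
  have rng: "1 + 2 * b r * h \<in> {-1..1}" if "r < k" "h \<in> {0..1 / B}" for r h
  proof -
    have "- b r * h \<le> B * (1 / B)" using B[OF that(1)] b[OF that(1)] that(2) by (intro mult_mono) auto
    moreover have "b r * h \<le> 0" using b[OF that(1)] that(2) by (simp add: mult_nonpos_nonneg)
    ultimately show ?thesis using B0 by (simp add: mult.commute)
  qed
  \<comment> \<open>At \<open>h = 1 / B\<close> the most distant pole contributes the least possible value \<open>- \<pi> / 2\<close>.\<close>
  have gB: "?g (1 / B) \<le> real k * (pi / 2) - pi"
  proof -
    have "?g (1 / B) = arcsin (1 + 2 * b q * (1 / B)) + (\<Sum>r\<in>{..<k} - {q}. arcsin (1 + 2 * b r * (1 / B)))"
      using q by (subst sum.remove[of _ q]) auto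
    also have "1 + 2 * b q * (1 / B) = -1" using q B0 by simp
    also have "(\<Sum>r\<in>{..<k} - {q}. arcsin (1 + 2 * b r * (1 / B))) \<le> (\<Sum>r\<in>{..<k} - {q}. pi / 2)"
    proof (intro sum_mono)
      fix r assume "r \<in> {..<k} - {q}"
      then have "1 + 2 * b r * (1 / B) \<in> {-1..1}" using B0 by (intro rng) auto
      then show "arcsin (1 + 2 * b r * (1 / B)) \<le> pi / 2" using arcsin_bounded by auto
    qed
    also have "(\<Sum>r\<in>{..<k} - {q}. pi / 2) = (real k - 1) * (pi / 2)" using q k by (simp add: of_nat_diff)
    finally show ?thesis by (simp add: algebra_simps)
  qed
  have gT: "?g (1 / B) \<le> ?T" using gB pi_gt_zero by linarith
  have "\<exists>h. 0 \<le> h \<and> h \<le> 1 / B \<and> ?g h = ?T"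
  proof (rule IVT2')
    show "continuous_on {0..1 / B} ?g" using rng by (intro continuous_intros) auto
  qed (use gT B0 in auto)
  then obtain h where h: "0 \<le> h" "h \<le> 1 / B" "?g h = ?T" by blast
  have "h \<noteq> 0" using h(3) by (intro notI) simp
  then have h0: "h > 0" using h(1) by simp
  have "h \<noteq> 1 / B" using h(3) gB pi_gt_zero by (intro notI) simp
  then have "h < 1 / B" using h(2) by simp
  then have h1: "h * B < 1" using B0 by (simp add: less_divide_eq)
  define \<alpha> where "\<alpha> r = arcsin (1 + 2 * b r * h) / 2" for r
  have rs: "-1 < 1 + 2 * b r * h" "1 + 2 * b r * h < 1" if "r < k" for r
  proof -
    have "- b r * h \<le> B * h" using B[OF that] h0 by (intro mult_right_mono) auto
    then show "-1 < 1 + 2 * b r * h" using h1 by (simp add: mult.commute)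
    show "1 + 2 * b r * h < 1" using b[OF that] h0 by (simp add: mult_neg_pos)
  qed
  have al: "- (pi / 4) < \<alpha> r" "\<alpha> r < pi / 4" if "r < k" for r
    using arcsin_lt_bounded[OF rs[OF that]] by (auto simp: \<alpha>_def)
  have al2: "\<bar>\<alpha> r\<bar> < pi / 2" if "r < k" for r using al[OF that] by (auto simp: abs_less_iff)
  define \<tau> where "\<tau> = vec k (\<lambda>r. tan (\<alpha> r))"
  have tau: "\<tau> $ r = tan (\<alpha> r)" if "r < k" for r using that by (simp add: \<tau>_def)
  \<comment> \<open>The parameters stay inside the unit disc because \<open>h\<close> lies strictly between \<open>0\<close> and \<open>1 / B\<close>.\<close>
  have t1: "\<forall>r<k. \<bar>\<tau> $ r\<bar> < 1"
  proof (intro allI impI)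
    fix r assume r: "r < k"
    have "tan (\<alpha> r) < tan (pi / 4)" "tan (- (pi / 4)) < tan (\<alpha> r)"
      using al[OF r] pi_gt_zero by (intro tan_monotone; linarith)+
    then show "\<bar>\<tau> $ r\<bar> < 1" using tau[OF r] by (simp add: tan_45 abs_less_iff)
  qed
  have t2: "2 * \<tau> $ r = (1 + (\<tau> $ r)\<^sup>2) * (1 + 2 * b r * h)" if r: "r < k" for r
  proof -
    have c: "cos (\<alpha> r) > 0" using al2[OF r] by (intro cos_gt_zero_pi) (auto simp: abs_less_iff)
    have "1 + 2 * b r * h = sin (2 * \<alpha> r)"
      using rs[OF r] by (simp add: \<alpha>_def)
    also have "\<dots> = 2 * sin (\<alpha> r) * cos (\<alpha> r)" by (rule sin_double)
    finally have "(1 + (tan (\<alpha> r))\<^sup>2) * (1 + 2 * b r * h) = 2 * tan (\<alpha> r)"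
      using c by (simp add: tan_sec tan_def field_simps power2_eq_square)
    then show ?thesis using tau[OF r] by simp
  qed
  let ?phi = "blaschke_phase 0 k \<tau>" let ?D = "poly (denom_poly {..<k} b)"
  have half: "?phi (pi / 2) = 2 * real k * pi - pi / 2"
  proof -
    have "(\<Sum>r<k. \<alpha> r) = ?T / 2" using h(3) by (simp add: \<alpha>_def flip: sum_divide_distrib)
    then show ?thesis using blaschke_phase_half_pi[OF tau al2, where n = 0] by (simp add: algebra_simps)
  qed
  obtain N0 where N0: "degree N0 \<le> 2 * k"
    "\<And>\<theta>. poly N0 (cos \<theta>) = cos (?phi \<theta>) * poly (distance_poly k \<tau>) (cos \<theta>)"
    using cos_blaschke_phase_poly[OF t1, of 0] by auto
  have "cos (2 * real k * pi - pi / 2) = 0"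
    using cos_multiple_pi[of "2 * k"] by (simp add: cos_diff sin_npi flip: mult.assoc)
  then have "poly N0 0 = 0" using N0(2)[of "pi / 2"] half by simp
  then have c0: "poly.coeff N0 0 = 0" by (simp add: poly_0_coeff_0)
  define C where "C = (\<Prod>r<k. ((1 + (\<tau> $ r)\<^sup>2) * (2 * h)) ^ 2)"
  have "(1 + (\<tau> $ r)\<^sup>2) * (2 * h) > 0" for r using h0 by (intro mult_pos_pos add_pos_nonneg) auto
  then have C: "C > 0" unfolding C_def by (intro prod_pos zero_less_power) auto
  \<comment> \<open>In \<open>Y = 1 + 2 h t\<close> this is \<open>Y ^ (2 k) N0(1 / Y)\<close>; the missing index \<open>i = 0\<close> is the loss of one degree.\<close>
  define N where "N = Polynomial.smult (1 / C) (\<Sum>i\<in>{1..2 * k}. Polynomial.smult (poly.coeff N0 i) ([:1, 2 * h:] ^ (2 * k - i)))"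
  have degN: "degree N < 2 * k"
  proof -
    have "degree (\<Sum>i\<in>{1..2 * k}. Polynomial.smult (poly.coeff N0 i) ([:1, 2 * h:] ^ (2 * k - i))) \<le> 2 * k - 1"
    proof (intro degree_sum_le order.trans[OF degree_smult_le])
      fix i assume "i \<in> {1..2 * k}"
      then show "degree ([:1, 2 * h:] ^ (2 * k - i)) \<le> 2 * k - 1"
        using degree_power_le[of "[:1, 2 * h:]" "2 * k - i"] h0 by auto
    qed simp
    then have "degree N \<le> 2 * k - 1" unfolding N_def by (rule order.trans[OF degree_smult_le])
    then show ?thesis using k by linarith
  qed
  have Ncos: "poly N t = cos (?phi \<theta>) * ?D t" if t: "t \<ge> 0" and th: "cos \<theta> = 1 / (1 + 2 * h * t)" for t \<theta>
  proof -
    let ?Y = "1 + 2 * h * t"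
    have Y: "?Y > 0" using h0 t by (simp add: add_pos_nonneg)
    have "C * poly N t = (\<Sum>i\<in>{1..2 * k}. poly.coeff N0 i * ?Y ^ (2 * k - i))"
      using C by (simp add: N_def poly_sum poly_power mult.commute[of t])
    also have "\<dots> = (\<Sum>i\<in>{1..2 * k}. ?Y ^ (2 * k) * (poly.coeff N0 i * (1 / ?Y) ^ i))"
      using Y by (intro sum.cong refl) (simp add: power_diff power_divide)
    also have "\<dots> = (\<Sum>i\<le>2 * k. ?Y ^ (2 * k) * (poly.coeff N0 i * (1 / ?Y) ^ i))"
      using c0 by (intro sum.mono_neutral_left) (auto simp: not_le)
    also have "\<dots> = ?Y ^ (2 * k) * poly N0 (1 / ?Y)"
    proof -
      have "poly N0 (1 / ?Y) = (\<Sum>i\<le>degree N0. poly.coeff N0 i * (1 / ?Y) ^ i)" by (rule poly_altdef)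
      also have "\<dots> = (\<Sum>i\<le>2 * k. poly.coeff N0 i * (1 / ?Y) ^ i)"
        using N0(1) by (intro sum.mono_neutral_left) (auto simp: coeff_eq_0)
      finally show ?thesis by (simp add: sum_distrib_left)
    qed
    also have "\<dots> = cos (?phi \<theta>) * (?Y ^ (2 * k) * poly (distance_poly k \<tau>) (1 / ?Y))"
      using N0(2)[of \<theta>] th by simp
    also have "?Y ^ (2 * k) * poly (distance_poly k \<tau>) (1 / ?Y) =
        (\<Prod>r<k. (?Y * (1 - 2 * \<tau> $ r * (1 / ?Y) + (\<tau> $ r)\<^sup>2)) ^ 2)"
      by (simp add: poly_distance_poly power_mult_distrib prod.distrib power_mult)
    also have "\<dots> = (\<Prod>r<k. ((1 + (\<tau> $ r)\<^sup>2) * (2 * h)) ^ 2 * (t - b r) ^ 2)"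
    proof (intro prod.cong refl)
      fix r assume "r \<in> {..<k}"
      then have r: "r < k" by simp
      have "?Y * (1 - 2 * \<tau> $ r * (1 / ?Y) + (\<tau> $ r)\<^sup>2) = ?Y * (1 + (\<tau> $ r)\<^sup>2) - 2 * \<tau> $ r"
        using Y by (simp add: field_simps)
      also have "\<dots> = (1 + (\<tau> $ r)\<^sup>2) * (2 * h) * (t - b r)"
        unfolding t2[OF r] by (simp add: algebra_simps)
      finally show "(?Y * (1 - 2 * \<tau> $ r * (1 / ?Y) + (\<tau> $ r)\<^sup>2)) ^ 2 = ((1 + (\<tau> $ r)\<^sup>2) * (2 * h)) ^ 2 * (t - b r) ^ 2"
        by (simp only: power_mult_distrib)
    qed
    also have "\<dots> = C * ?D t" by (simp add: prod.distrib C_def poly_denom_poly)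
    finally have "C * poly N t = C * (cos (?phi \<theta>) * ?D t)" by simp
    then show ?thesis using C by simp
  qed
  have Dpos: "?D t \<ge> 0" for t by (simp add: poly_denom_poly prod_nonneg)
  have kk: "real (2 * k - 1) = 2 * real k - 1" using k by (simp add: of_nat_diff)
  obtain \<theta> where th: "\<And>j. j \<le> 2 * k - 1 \<Longrightarrow> \<theta> j \<in> {0..pi / 2}"
    "\<And>j. j \<le> 2 * k - 1 \<Longrightarrow> ?phi (\<theta> j) = real j * pi" "strict_mono_on {..2 * k - 1} \<theta>"
    using increasing_multiples_of_pi[OF continuous_on_blaschke_phase[OF t1] blaschke_phase_0[OF t1], of "pi / 2" "2 * k - 1" 0]
      half kk by (auto simp: algebra_simps)
  have le: "j \<le> 2 * k - 1" if "j < 2 * k" for j using that by linarith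
  have thI: "0 \<le> \<theta> j \<and> \<theta> j \<le> pi / 2" and thv: "?phi (\<theta> j) = real j * pi" if "j < 2 * k" for j
    using th(1,2)[OF le[OF that]] by auto
  have thmono: "strict_mono_on {..<2 * k} \<theta>" using th(3) le by (auto simp: strict_mono_on_def)
  have thp: "\<theta> j < pi / 2" if "j < 2 * k" for j
  proof -
    have "real j \<le> 2 * real k - 1" using that by linarith
    then have "real j * pi \<le> (2 * real k - 1) * pi" by (intro mult_right_mono) auto
    also have "\<dots> < ?phi (pi / 2)" unfolding half using pi_gt_zero by (simp add: left_diff_distrib)
    finally have "?phi (\<theta> j) \<noteq> ?phi (pi / 2)" using thv[of j] that by simp
    then have "\<theta> j \<noteq> pi / 2" by metis
    then show ?thesis using thI[of j] that by auto
  qed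
  have cpos: "cos (\<theta> j) > 0" if "j < 2 * k" for j
    using thp[OF that] thI[of j] that by (intro cos_gt_zero_pi) auto
  define X where "X j = (1 / cos (\<theta> j) - 1) / (2 * h)" for j
  have X0: "X j \<ge> 0" if "j < 2 * k" for j
    using cpos[OF that] h0 by (simp add: X_def le_divide_eq)
  have Xc: "cos (\<theta> j) = 1 / (1 + 2 * h * X j)" if "j < 2 * k" for j
    using cpos[OF that] h0 by (simp add: X_def)
  have "equioscillates {0..} (2 * k) k b N X"
    unfolding equioscillates_def
  proof (intro conjI ballI allI impI)
    show "\<bar>poly N t\<bar> \<le> ?D t" if "t \<in> {0..}" for t
    proof -
      have "0 < 1 / (1 + 2 * h * t)" "1 / (1 + 2 * h * t) \<le> 1" using that h0 by (simp_all add: add_pos_nonneg)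
      then have "cos (arccos (1 / (1 + 2 * h * t))) = 1 / (1 + 2 * h * t)" by (intro cos_arccos) linarith+
      from Ncos[OF _ this] that show ?thesis
        using Dpos[of t] by (simp add: abs_mult mult_left_le_one_le)
    qed
    have "X i < X j" if "i < j" "j < 2 * k" for i j
    proof -
      have "cos (\<theta> j) < cos (\<theta> i)"
        using thI[of i] thI[of j] thmono that pi_gt_zero by (intro cos_monotone_0_pi) (auto simp: strict_mono_on_def)
      then have "1 / cos (\<theta> i) < 1 / cos (\<theta> j)" using cpos[of i] cpos[of j] that by (intro divide_strict_left_mono) auto
      then show ?thesis using h0 by (simp add: X_def divide_strict_right_mono)
    qed
    then show "strict_mono_on {..<2 * k} X \<or> strict_antimono_on {..<2 * k} X"
      by (auto simp: monotone_on_def)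
    show "X i \<in> {0..}" if "i < 2 * k" for i using X0[OF that] by simp
    show "poly N (X i) = (-1) ^ i * ?D (X i)" if "i < 2 * k" for i
      using Ncos[OF X0[OF that] Xc[OF that]] thv[of i] that by (simp add: cos_multiple_pi)
  qed (rule degN)
  then show ?thesis by (rule that)
qed

section \<open>Uniqueness and the Chebyshev points on a symmetric interval\<close>

definition node_poly :: "(nat \<Rightarrow> real) \<Rightarrow> nat set \<Rightarrow> real poly" where
  "node_poly x J = (\<Prod>j\<in>J. [:- x j, 1:])"

lemma poly_node_poly: "poly (node_poly x J) t = (\<Prod>j\<in>J. t - x j)"
  by (simp add: node_poly_def poly_prod)

lemma degree_node_poly: "degree (node_poly x J) = card J"
proof (cases "finite J")
  case True
  then show ?thesis unfolding node_poly_def by (subst degree_prod_sum_eq) auto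
qed (simp add: node_poly_def)

lemma lead_coeff_node_poly: "poly.coeff (node_poly x J) (card J) = 1"
  using lead_coeff_prod[of "\<lambda>j. [:- x j, 1:]" J] by (simp add: degree_node_poly flip: node_poly_def)

text \<open>
Comparison of the leading coefficients in Lagrange's interpolation formula.
\<close>
lemma coeff_lagrange:
  fixes N :: "real poly"
  assumes N: "degree N < m" and inj: "inj_on x {..<m}"
  shows "poly.coeff N (m - 1) = (\<Sum>i<m. poly N (x i) / (\<Prod>j\<in>{..<m} - {i}. x i - x j))"
proof -
  let ?w = "\<lambda>i. \<Prod>j\<in>{..<m} - {i}. x i - x j"
  let ?L = "\<Sum>i<m. Polynomial.smult (poly N (x i) / ?w i) (node_poly x ({..<m} - {i}))"
  have w: "?w i \<noteq> 0" if "i < m" for i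
    using inj that by (auto simp: inj_on_def)
  have "N - ?L = 0"
  proof (rule poly_eq_0_if_many_zeros[OF _ inj])
    have "degree ?L \<le> m - 1"
      by (intro degree_sum_le order.trans[OF degree_smult_le]) (auto simp: degree_node_poly)
    then show "degree (N - ?L) < m" using N by (intro degree_diff_less) auto
    fix l assume l: "l < m"
    have "poly ?L (x l) = (\<Sum>i<m. if i = l then poly N (x l) else 0)"
      unfolding poly_sum
    proof (intro sum.cong refl)
      fix i assume "i \<in> {..<m}"
      then show "poly (Polynomial.smult (poly N (x i) / ?w i) (node_poly x ({..<m} - {i}))) (x l) =
        (if i = l then poly N (x l) else 0)"
        using w[of i] l by (auto simp: poly_node_poly)
    qed
    then show "poly (N - ?L) (x l) = 0" using l by simp
  qed
  then have "poly.coeff N (m - 1) = poly.coeff ?L (m - 1)" by simp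
  also have "\<dots> = (\<Sum>i<m. poly N (x i) / ?w i * poly.coeff (node_poly x ({..<m} - {i})) (m - 1))"
    by (simp add: coeff_sum)
  also have "\<dots> = (\<Sum>i<m. poly N (x i) / ?w i)"
  proof (intro sum.cong refl)
    fix i assume "i \<in> {..<m}"
    then have "card ({..<m} - {i}) = m - 1" by simp
    then show "poly N (x i) / ?w i * poly.coeff (node_poly x ({..<m} - {i})) (m - 1) = poly N (x i) / ?w i"
      using lead_coeff_node_poly[of x "{..<m} - {i}"] by simp
  qed
  finally show ?thesis .
qed

lemma node_product_sign:
  fixes x :: "nat \<Rightarrow> real"
  assumes x: "strict_mono_on {..<m} x" and i: "i < m"
  shows "(-1) ^ (m - 1 - i) * (\<Prod>j\<in>{..<m} - {i}. x i - x j) > 0"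
proof -
  have eq: "{..<m} - {i} = {..<i} \<union> {i<..<m}" using i by auto
  have "(\<Prod>j\<in>{..<m} - {i}. x i - x j) = (\<Prod>j\<in>{..<i}. x i - x j) * (\<Prod>j\<in>{i<..<m}. x i - x j)"
    unfolding eq by (rule prod.union_disjoint) auto
  also have "(\<Prod>j\<in>{i<..<m}. x i - x j) = (\<Prod>j\<in>{i<..<m}. (-1) * (x j - x i))" by (intro prod.cong) auto
  also have "\<dots> = (-1) ^ (m - 1 - i) * (\<Prod>j\<in>{i<..<m}. x j - x i)"
    unfolding prod.distrib by simp
  finally have "(-1) ^ (m - 1 - i) * (\<Prod>j\<in>{..<m} - {i}. x i - x j) =
    (\<Prod>j\<in>{..<i}. x i - x j) * (\<Prod>j\<in>{i<..<m}. x j - x i)"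
    by (simp add: mult.left_commute flip: power_mult_distrib)
  moreover have "(\<Prod>j\<in>{..<i}. x i - x j) > 0"
    using x i by (intro prod_pos) (auto simp: strict_mono_on_def)
  moreover have "(\<Prod>j\<in>{i<..<m}. x j - x i) > 0"
    using x i by (intro prod_pos) (auto simp: strict_mono_on_def)
  ultimately show ?thesis by simp
qed

text \<open>
By \<open>node_product_sign\<close> all summands of Lagrange's formula for the leading coefficient have the same sign when
the values alternate, so that they vanish together with their sum.
\<close>
lemma weak_alternation_leading_coeff:
  fixes R :: "real poly" and x :: "nat \<Rightarrow> real"
  assumes R: "degree R < m" and x: "strict_mono_on {..<m} x"
    and alt: "\<And>i. i < m \<Longrightarrow> (-1) ^ i * poly R (x i) \<ge> 0"
  shows "(-1) ^ (m - 1) * poly.coeff R (m - 1) \<ge> 0"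
    and "poly.coeff R (m - 1) = 0 \<Longrightarrow> R = 0"
proof -
  let ?w = "\<lambda>i. \<Prod>j\<in>{..<m} - {i}. x i - x j"
  have inj: "inj_on x {..<m}" using x by (rule strict_mono_on_imp_inj_on)
  have t: "(-1) ^ (m - 1) * (poly R (x i) / ?w i) \<ge> 0" if i: "i < m" for i
  proof -
    have "m - 1 = i + (m - 1 - i)" using i by simp
    then have "(-1) ^ (m - 1) = ((-1) ^ i * (-1) ^ (m - 1 - i) :: real)" by (metis power_add)
    have "(-1) ^ (m - 1 - i) / ?w i \<ge> 0"
      using node_product_sign[OF x i] by (simp add: zero_less_mult_iff zero_le_divide_iff) force
    from mult_nonneg_nonneg[OF alt[OF i] this]
    have "0 \<le> ((-1) ^ i * poly R (x i)) * ((-1) ^ (m - 1 - i) / ?w i)" .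
    then show ?thesis using \<open>(-1) ^ (m - 1) = (-1) ^ i * (-1) ^ (m - 1 - i)\<close> by (simp add: mult_ac)
  qed
  have c: "(-1) ^ (m - 1) * poly.coeff R (m - 1) = (\<Sum>i<m. (-1) ^ (m - 1) * (poly R (x i) / ?w i))"
    unfolding coeff_lagrange[OF R inj] sum_distrib_left ..
  show "(-1) ^ (m - 1) * poly.coeff R (m - 1) \<ge> 0"
    unfolding c by (intro sum_nonneg) (use t in auto)
  assume "poly.coeff R (m - 1) = 0"
  then have "(\<Sum>i<m. (-1) ^ (m - 1) * (poly R (x i) / ?w i)) = 0" using c by simp
  then have "\<forall>i<m. (-1) ^ (m - 1) * (poly R (x i) / ?w i) = 0"
    using t by (subst (asm) sum_nonneg_eq_0_iff) auto
  moreover have "?w i \<noteq> 0" if "i < m" for i using inj that by (auto simp: inj_on_def)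
  ultimately have "poly R (x i) = 0" if "i < m" for i using that by auto
  then show "R = 0" by (intro poly_eq_0_if_many_zeros[OF R inj])
qed

text \<open>
At the alternation points of \<open>N\<close> the difference \<open>N' - N\<close> alternates weakly, and at those of \<open>N'\<close> so does
\<open>N - N'\<close>. The two bounds for the leading coefficient leave only zero.
\<close>
lemma alternating_numerator_unique:
  fixes N N' :: "real poly"
  assumes N: "degree N < m" "degree N' < m"
    and le: "\<And>t. t \<in> I \<Longrightarrow> \<bar>poly N t\<bar> \<le> D t" "\<And>t. t \<in> I \<Longrightarrow> \<bar>poly N' t\<bar> \<le> D t"
    and x: "increasing_points I m x" "increasing_points I m x'"
    and alt: "\<And>i. i < m \<Longrightarrow> poly N (x $ i) = (-1) ^ Suc i * D (x $ i)"
      "\<And>i. i < m \<Longrightarrow> poly N' (x' $ i) = (-1) ^ Suc i * D (x' $ i)"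
  shows "N = N'"
proof -
  have mono: "strict_mono_on {..<m} (\<lambda>i. x $ i)" if "increasing_points I m x" for x
    using that by (auto simp: increasing_points_def strict_mono_on_def)
  have weak: "(-1) ^ i * poly (N' - N) (x $ i) \<ge> 0" if i: "i < m" and x: "x $ i \<in> I"
    and le: "\<bar>poly N' (x $ i)\<bar> \<le> D (x $ i)" and alt: "poly N (x $ i) = (-1) ^ Suc i * D (x $ i)" for N N' i x
  proof -
    have "(-1) ^ i * poly (N' - N) (x $ i) = (-1) ^ i * poly N' (x $ i) + ((-1) ^ i * (-1) ^ i) * D (x $ i)"
      unfolding poly_diff alt by (simp add: algebra_simps)
    also have "(-1) ^ i * (-1) ^ i = (1 :: real)" by (simp flip: power_mult_distrib)
    finally show ?thesis using le by (cases "even i") auto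
  qed
  have xI: "x $ i \<in> I" "x' $ i \<in> I" if "i < m" for i using x that by (auto simp: increasing_points_def)
  have d: "degree (N' - N) < m" "degree (N - N') < m" using N by (auto intro: degree_diff_less)
  have w1: "(-1) ^ i * poly (N' - N) (x $ i) \<ge> 0" if "i < m" for i
    using weak[of i x N' N] that xI(1)[OF that] le(2)[OF xI(1)[OF that]] alt(1)[OF that] by blast
  have w2: "(-1) ^ i * poly (N - N') (x' $ i) \<ge> 0" if "i < m" for i
    using weak[of i x' N N'] that xI(2)[OF that] le(1)[OF xI(2)[OF that]] alt(2)[OF that] by blast
  have 1: "(-1) ^ (m - 1) * poly.coeff (N' - N) (m - 1) \<ge> 0"
    by (rule weak_alternation_leading_coeff(1)[OF d(1) mono[OF x(1)]]) (rule w1)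
  have 2: "(-1) ^ (m - 1) * poly.coeff (N - N') (m - 1) \<ge> 0"
    by (rule weak_alternation_leading_coeff(1)[OF d(2) mono[OF x(2)]]) (rule w2)
  have "poly.coeff (N' - N) (m - 1) = 0" using 1 2 by (cases "even (m - 1)") auto
  then have "N' - N = 0"
    by (rule weak_alternation_leading_coeff(2)[OF d(1) mono[OF x(1)], rotated]) (rule w1)
  then show ?thesis by simp
qed

text \<open>
On the unit circle \<open>z - \<tau> = - \<tau> z cnj (z - 1 / \<tau>)\<close>; reciprocal parameters therefore conjugate the Laurent
polynomial up to a positive constant, and the imaginary part only changes its sign and scale.
\<close>
lemma chebyshev_points_poly_reciprocal:
  assumes t: "\<And>r. r < k \<Longrightarrow> \<tau> $ r \<noteq> 0"
  shows "poly (chebyshev_points_poly 1 k \<tau>) (cos \<theta>) =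
    - (\<Prod>r<k. (\<tau> $ r) ^ 4) * poly (chebyshev_points_poly 1 k (vec k (\<lambda>r. 1 / \<tau> $ r))) (cos \<theta>)"
proof -
  let ?\<tau>' = "vec k (\<lambda>r. 1 / \<tau> $ r)"
  have fac: "cis (- 2 * \<theta>) * (cis \<theta> - of_real (\<tau> $ r)) ^ 4 =
      of_real ((\<tau> $ r) ^ 4) * cnj (cis (- 2 * \<theta>) * (cis \<theta> - of_real (1 / \<tau> $ r)) ^ 4)" if "r < k" for r
  proof -
    have "of_real (\<tau> $ r) * cnj (cis \<theta> - of_real (1 / \<tau> $ r)) = of_real (\<tau> $ r) * cis (- \<theta>) - 1"
      using t[OF that] by (simp add: algebra_simps cis_cnj)
    also have "\<dots> = - (cis (- \<theta>) * (cis \<theta> - of_real (\<tau> $ r)))"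
      by (simp add: algebra_simps cis_mult)
    finally have "(of_real (\<tau> $ r) * cnj (cis \<theta> - of_real (1 / \<tau> $ r))) ^ 4 =
        (- (cis (- \<theta>) * (cis \<theta> - of_real (\<tau> $ r)))) ^ 4" by simp
    also have "\<dots> = cis (- \<theta>) ^ 4 * (cis \<theta> - of_real (\<tau> $ r)) ^ 4"
      by (simp add: power_mult_distrib)
    also have "cis (- \<theta>) ^ 4 = cis (- 4 * \<theta>)" by (simp add: Complex.DeMoivre)
    finally have "of_real ((\<tau> $ r) ^ 4) * (cnj (cis \<theta> - of_real (1 / \<tau> $ r))) ^ 4 =
      cis (- 4 * \<theta>) * (cis \<theta> - of_real (\<tau> $ r)) ^ 4" by (simp only: power_mult_distrib of_real_power)
    then have "cis (2 * \<theta>) * (of_real ((\<tau> $ r) ^ 4) * (cnj (cis \<theta> - of_real (1 / \<tau> $ r))) ^ 4) =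
      (cis (2 * \<theta>) * cis (- 4 * \<theta>)) * (cis \<theta> - of_real (\<tau> $ r)) ^ 4" by (simp only: mult.assoc)
    moreover have "cis (2 * \<theta>) * cis (- 4 * \<theta>) = cis (- 2 * \<theta>)" by (simp add: cis_mult)
    moreover have "cnj (cis (- 2 * \<theta>)) = cis (2 * \<theta>)" by (simp add: cis_cnj)
    ultimately show ?thesis by (simp only: complex_cnj_mult complex_cnj_power) (simp add: mult_ac)
  qed
  have prod: "cis ((real (1 - 1) - 2 * real k) * \<theta>) * complex_eval (tau_poly k \<sigma>) (cis \<theta>) =
      (\<Prod>r<k. cis (- 2 * \<theta>) * (cis \<theta> - of_real (\<sigma> $ r)) ^ 4)" for \<sigma>
    by (simp add: complex_eval_tau_poly prod.distrib Complex.DeMoivre algebra_simps)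
  have "(\<Prod>r<k. cis (- 2 * \<theta>) * (cis \<theta> - of_real (\<tau> $ r)) ^ 4) =
      of_real (\<Prod>r<k. (\<tau> $ r) ^ 4) * cnj (\<Prod>r<k. cis (- 2 * \<theta>) * (cis \<theta> - of_real (?\<tau>' $ r)) ^ 4)"
    unfolding cnj_prod of_real_prod prod.distrib[symmetric] using fac by (intro prod.cong refl) auto
  moreover have "Z = of_real c * cnj W \<Longrightarrow> Im Z = - c * Im W" for Z W c by simp
  ultimately have "Im (\<Prod>r<k. cis (- 2 * \<theta>) * (cis \<theta> - of_real (\<tau> $ r)) ^ 4) =
      - (\<Prod>r<k. (\<tau> $ r) ^ 4) * Im (\<Prod>r<k. cis (- 2 * \<theta>) * (cis \<theta> - of_real (?\<tau>' $ r)) ^ 4)"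
    by blast
  then show ?thesis unfolding chebyshev_points_poly_cos[OF order_refl] prod by simp
qed

lemma chebyshev_points_poly_phase:
  assumes "s \<ge> 1" "\<forall>r<k. \<bar>\<tau> $ r\<bar> < 1"
  shows "poly (chebyshev_points_poly s k \<tau>) (cos \<theta>) =
    sin \<theta> * (sin (blaschke_phase (s - 1) k \<tau> \<theta>) * poly (distance_poly k \<tau>) (cos \<theta>))"
  unfolding chebyshev_points_poly_cos[OF assms(1)] cis_blaschke_phase[OF assms(2), symmetric] by simp

text \<open>
The phase takes the value \<open>\<pi> / 2\<close> at an interior point, where its sine is one.
\<close>
lemma chebyshev_points_poly_nonzero:
  assumes s: "s \<ge> 1" and k: "k \<ge> 1" and t1: "\<forall>r<k. \<bar>\<tau> $ r\<bar> < 1"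
  shows "\<exists>\<theta>. poly (chebyshev_points_poly s k \<tau>) (cos \<theta>) \<noteq> 0"
proof -
  let ?phi = "blaschke_phase (s - 1) k \<tau>"
  have "1 * pi \<le> real (s - 1 + 2 * k) * pi" using k by (intro mult_right_mono) auto
  then have "\<exists>\<theta>. 0 \<le> \<theta> \<and> \<theta> \<le> pi \<and> ?phi \<theta> = pi / 2"
    using blaschke_phase_pi[OF t1, of "s - 1"] blaschke_phase_0[OF t1, of "s - 1"] pi_gt_zero
    by (intro IVT' continuous_on_blaschke_phase[OF t1]) auto
  then obtain \<theta> where th: "0 \<le> \<theta>" "\<theta> \<le> pi" "?phi \<theta> = pi / 2" by blast
  have "\<theta> \<noteq> 0" using th(3) blaschke_phase_0[OF t1, of "s - 1"] by auto
  moreover have "\<theta> \<noteq> pi"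
  proof
    assume "\<theta> = pi"
    then have "pi / 2 = real (s - 1 + 2 * k) * pi"
      using th(3) by (simp only: blaschke_phase_pi[OF t1])
    then show False using \<open>1 * pi \<le> real (s - 1 + 2 * k) * pi\<close> pi_gt_zero by linarith
  qed
  ultimately have "sin \<theta> > 0" using th by (intro sin_gt_zero) auto
  moreover have "1 - 2 * \<tau> $ r * cos \<theta> + (\<tau> $ r)\<^sup>2 \<noteq> 0" if "r < k" for r
  proof
    assume 0: "1 - 2 * \<tau> $ r * cos \<theta> + (\<tau> $ r)\<^sup>2 = 0"
    have "(1 - t * c)\<^sup>2 + (t * d)\<^sup>2 = 1 - 2 * t * c + t\<^sup>2 * (d\<^sup>2 + c\<^sup>2)" for t c d :: real
      by (simp add: power2_eq_square algebra_simps)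
    from this[of "\<tau> $ r" "cos \<theta>" "sin \<theta>"]
    have "(1 - \<tau> $ r * cos \<theta>)\<^sup>2 + (\<tau> $ r * sin \<theta>)\<^sup>2 = 1 - 2 * \<tau> $ r * cos \<theta> + (\<tau> $ r)\<^sup>2" by simp
    then have "(1 - \<tau> $ r * cos \<theta>)\<^sup>2 + (\<tau> $ r * sin \<theta>)\<^sup>2 = 0" using 0 by simp
    then have "1 - \<tau> $ r * cos \<theta> = 0" "\<tau> $ r * sin \<theta> = 0" by (simp_all add: sum_power2_eq_zero_iff)
    then show False using \<open>sin \<theta> > 0\<close> by auto
  qed
  then have "poly (distance_poly k \<tau>) (cos \<theta>) \<noteq> 0" by (simp add: poly_distance_poly)
  moreover have "sin (?phi \<theta>) = 1" unfolding th(3) by simp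
  ultimately show ?thesis
    unfolding chebyshev_points_poly_phase[OF s t1] by (intro exI[of _ \<theta>]) simp
qed

text \<open>
By uniqueness the given Chebyshev polynomial is \<open>\<plusminus> cos\<close> of the phase; where its modulus is one, the sine of
the phase vanishes.
\<close>
lemma chebyshev_points_are_zeros:
  assumes k: "k \<ge> 1" and s: "s \<ge> 1" and b: "b \<in> param_space {-1..1} k"
    and cx: "chebyshev_polynomial_points {-1..1} (s + 2 * k) (rational_regression s k b) c x"
    and t1: "\<forall>r<k. \<bar>\<tau> $ r\<bar> < 1" and tb: "\<And>r. r < k \<Longrightarrow> 2 * b $ r = \<tau> $ r + 1 / \<tau> $ r"
    and i: "i < s + 2 * k"
  shows "poly (chebyshev_points_poly s k \<tau>) (x $ i) = 0"
proof -
  let ?m = "s + 2 * k" let ?D = "poly (denom_poly {..<k} (($) b))"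
  let ?phi = "blaschke_phase (s - 1) k \<tau>" let ?I = "{-1..1} :: real set"
  have t0: "\<tau> $ r \<noteq> 0" if "r < k" for r
  proof
    assume "\<tau> $ r = 0"
    then have "b $ r = 0" using tb[OF that] by simp
    then show False using param_spaceD(2)[OF b that, of 0] by simp
  qed
  obtain N X where eq: "equioscillates ?I ?m k (($) b) N X"
    and Ncos: "\<And>\<theta>. poly N (cos \<theta>) = cos (?phi \<theta>) * ?D (cos \<theta>)"
    by (rule equioscillates_interval_tau[where b = "\<lambda>r. b $ r", OF s t1 t0 tb]) blast+
  obtain \<sigma> x' where x': "\<sigma> \<in> {1, -1 :: real}" "increasing_points ?I ?m x'"
    "\<And>i. i < ?m \<Longrightarrow> poly (Polynomial.smult \<sigma> N) (x' $ i) = (-1) ^ Suc i * ?D (x' $ i)"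
    by (rule equioscillates_increasing[OF eq]) blast
  have D: "?D t > 0" if "t \<in> ?I" for t
    using param_spaceD(2)[OF b _ that] unfolding poly_denom_poly by (intro prod_pos) force
  have cf: "poly (pf_numerator s k (($) b) c) t = c \<bullet> rational_regression s k b t * ?D t" if "t \<in> ?I" for t
    using scalar_prod_rational_regression[of k t b c s] param_spaceD(2)[OF b _ that] D[OF that] by simp
  have xI: "x $ i \<in> ?I" if "i < ?m" for i
    using cx that by (auto simp: chebyshev_polynomial_points_def increasing_points_def)
  have "pf_numerator s k (($) b) c = Polynomial.smult \<sigma> N"
  proof (rule alternating_numerator_unique)
    show "degree (pf_numerator s k (($) b) c) < ?m" using s by (intro degree_pf_numerator) auto
    show "degree (Polynomial.smult \<sigma> N) < ?m" using eq x'(1) by (auto simp: equioscillates_def)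
    show "\<bar>poly (pf_numerator s k (($) b) c) t\<bar> \<le> ?D t" if "t \<in> ?I" for t
      unfolding cf[OF that] using cx D[OF that] that
      by (auto simp: chebyshev_polynomial_points_def abs_mult intro: mult_left_le_one_le)
    show "\<bar>poly (Polynomial.smult \<sigma> N) t\<bar> \<le> ?D t" if "t \<in> ?I" for t
      using eq x'(1) that by (auto simp: equioscillates_def)
    show "poly (pf_numerator s k (($) b) c) (x $ i) = (-1) ^ Suc i * ?D (x $ i)" if "i < ?m" for i
      unfolding cf[OF xI[OF that]] using cx that by (simp add: chebyshev_polynomial_points_def)
    show "increasing_points ?I ?m x" using cx by (simp add: chebyshev_polynomial_points_def)
  qed (use x' in auto)
  then have "\<bar>poly N (x $ i)\<bar> = \<bar>poly (pf_numerator s k (($) b) c) (x $ i)\<bar>" using x'(1) by auto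
  also have "\<dots> = ?D (x $ i)"
    unfolding cf[OF xI[OF i]] using cx i D[OF xI[OF i]]
    by (simp add: chebyshev_polynomial_points_def abs_mult power_abs)
  finally have a: "\<bar>poly N (x $ i)\<bar> = ?D (x $ i)" .
  define \<theta> where "\<theta> = arccos (x $ i)"
  have c: "cos \<theta> = x $ i" using xI[OF i] by (simp add: \<theta>_def)
  have "\<bar>cos (?phi \<theta>)\<bar> = 1" using a Ncos[of \<theta>] D[OF xI[OF i]] by (simp add: c abs_mult)
  then have "(cos (?phi \<theta>))\<^sup>2 = 1" by (simp add: abs_square_eq_1)
  then have "sin (?phi \<theta>) = 0" using sin_cos_squared_add[of "?phi \<theta>"] by simp
  then show ?thesis using chebyshev_points_poly_phase[OF s t1, of \<theta>] by (simp add: c)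
qed

text \<open>
The \<open>m\<close> Chebyshev points are zeros of a nonzero polynomial of degree at most \<open>m\<close>, hence all of its zeros.
Parameters outside the unit disc are reduced to their reciprocals.
\<close>
lemma chebyshev_points_eq_zeros:
  assumes k: "k \<ge> 1" and b: "b \<in> param_space {-1..1} k"
    and cx: "chebyshev_polynomial_points {-1..1} (1 + 2 * k) (rational_regression 1 k b) c x"
    and tau: "tau_of k b \<tau>"
  shows "(\<lambda>i. x $ i) ` {..<1 + 2 * k} = {t. poly (chebyshev_points_poly 1 k \<tau>) t = 0}"
proof -
  let ?m = "1 + 2 * k" let ?P = "chebyshev_points_poly 1 k \<tau>"
  have tb: "2 * b $ r = \<tau> $ r + 1 / \<tau> $ r" if "r < k" for r using tau that by (simp add: tau_of_def)
  have xI: "x $ i \<in> {-1..1}" if "i < ?m" for i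
    using cx that by (auto simp: chebyshev_polynomial_points_def increasing_points_def)
  have main: "(\<forall>i<?m. poly ?P (x $ i) = 0) \<and> ?P \<noteq> 0"
  proof (cases "\<forall>r<k. \<bar>\<tau> $ r\<bar> < 1")
    case True
    then show ?thesis
      using chebyshev_points_are_zeros[OF k order_refl b cx True tb] chebyshev_points_poly_nonzero[OF order_refl k True]
      by force
  next
    case False
    then have big: "\<forall>r<k. \<bar>\<tau> $ r\<bar> > 1" using tau by (auto simp: tau_of_def)
    then have t0: "\<tau> $ r \<noteq> 0" if "r < k" for r using that by force
    let ?\<tau>' = "vec k (\<lambda>r. 1 / \<tau> $ r)"
    have t1: "\<forall>r<k. \<bar>?\<tau>' $ r\<bar> < 1" using big by (auto simp: abs_divide)
    have tb': "2 * b $ r = ?\<tau>' $ r + 1 / ?\<tau>' $ r" if "r < k" for r using tb[OF that] that by simp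
    have recip: "poly ?P (cos \<theta>) = - (\<Prod>r<k. (\<tau> $ r) ^ 4) * poly (chebyshev_points_poly 1 k ?\<tau>') (cos \<theta>)" for \<theta>
      by (rule chebyshev_points_poly_reciprocal) (use t0 in auto)
    have "poly ?P (x $ i) = 0" if i: "i < ?m" for i
      using recip[of "arccos (x $ i)"] chebyshev_points_are_zeros[OF k order_refl b cx t1 tb' i] xI[OF i] by simp
    moreover have "?P \<noteq> 0"
    proof -
      obtain \<theta> where "poly (chebyshev_points_poly 1 k ?\<tau>') (cos \<theta>) \<noteq> 0"
        using chebyshev_points_poly_nonzero[OF order_refl k t1] by blast
      then have "poly ?P (cos \<theta>) \<noteq> 0" unfolding recip using t0 by simp
      then show ?thesis by auto
    qed
    ultimately show ?thesis by blast
  qed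
  have inc: "increasing_points {-1..1} ?m x" using cx by (simp add: chebyshev_polynomial_points_def)
  show ?thesis
  proof (rule card_seteq)
    show "finite {t. poly ?P t = 0}" using main by (intro poly_roots_finite) simp
    show "(\<lambda>i. x $ i) ` {..<?m} \<subseteq> {t. poly ?P t = 0}" using main by auto
    have "card {t. poly ?P t = 0} \<le> degree ?P" using main by (intro card_poly_roots_bound) simp
    also have "\<dots> \<le> ?m" by (rule degree_chebyshev_points_poly[OF k]) simp
    also have "?m = card ((\<lambda>i. x $ i) ` {..<?m})" using increasing_points_inj[OF inc] by (simp add: card_image)
    finally show "card {t. poly ?P t = 0} \<le> card ((\<lambda>i. x $ i) ` {..<?m})" .
  qed
qed

section \<open>E-optimality from a checkerboard Gram matrix\<close>

lemma quadratic_form_min_on_sphere: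
  fixes A :: "nat \<Rightarrow> nat \<Rightarrow> real"
  assumes "m > 0"
  obtains g where "(\<Sum>i<m. (g i)\<^sup>2) = 1"
    "\<And>h. (\<Sum>i<m. (h i)\<^sup>2) = 1 \<Longrightarrow> (\<Sum>i<m. \<Sum>j<m. A i j * g i * g j) \<le> (\<Sum>i<m. \<Sum>j<m. A i j * h i * h j)"
proof -
  let ?q = "\<lambda>g :: nat \<Rightarrow> real. \<Sum>i<m. \<Sum>j<m. A i j * g i * g j"
  let ?K = "\<lambda>i. if i < m then {-1..1} else {0 :: real}"
  let ?S = "{g. (\<Sum>i<m. (g i)\<^sup>2) = 1} \<inter> Pi\<^sub>E UNIV ?K"
  have "compactin (product_topology (\<lambda>i. euclidean) UNIV) (Pi\<^sub>E UNIV ?K)"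
    by (subst compactin_PiE) auto
  then have K: "compact (Pi\<^sub>E UNIV ?K)"
    by (simp add: euclidean_product_topology flip: compactin_euclidean_iff)
  have "closed {g :: nat \<Rightarrow> real. (\<Sum>i<m. (g i)\<^sup>2) = 1}"
    by (intro closed_Collect_eq continuous_intros continuous_on_product_coordinates)
  then have S: "compact ?S" using K by (rule closed_Int_compact)
  have "(\<Sum>i<m. (if i = 0 then 1 else 0 :: real)\<^sup>2) = (\<Sum>i<m. if i = 0 then 1 else 0)"
    by (intro sum.cong) auto
  then have "(\<lambda>i. if i = 0 then 1 else 0) \<in> ?S" using assms by (simp add: PiE_iff)
  then have ne: "?S \<noteq> {}" by (metis empty_iff)
  have "continuous_on UNIV ?q"
    by (intro continuous_intros continuous_on_product_coordinates)
  then have "continuous_on ?S ?q" by (rule continuous_on_subset) simp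
  from continuous_attains_inf[OF S ne this]
  obtain g where g: "g \<in> ?S" "\<And>h. h \<in> ?S \<Longrightarrow> ?q g \<le> ?q h" by (elim bexE) (rule that, auto)
  show ?thesis
  proof (rule that)
    show "(\<Sum>i<m. (g i)\<^sup>2) = 1" using g(1) by simp
    fix h :: "nat \<Rightarrow> real" assume h: "(\<Sum>i<m. (h i)\<^sup>2) = 1"
    have "\<bar>h i\<bar> \<le> 1" if "i < m" for i
    proof -
      have "(h i)\<^sup>2 \<le> 1" unfolding h[symmetric] by (rule member_le_sum) (use that in auto)
      then show ?thesis by (simp add: abs_square_le_1)
    qed
    then have "(\<lambda>i. if i < m then h i else 0) \<in> ?S"
      using h by (simp add: PiE_iff abs_le_iff minus_le_iff)
    from g(2)[OF this] show "?q g \<le> ?q h" by simp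
  qed
qed

lemma quadratic_form_sum:
  fixes A :: "real mat"
  assumes "A \<in> carrier_mat m m" "v \<in> carrier_vec m" "w \<in> carrier_vec m"
  shows "v \<bullet> (A *\<^sub>v w) = (\<Sum>i<m. \<Sum>j<m. A $$ (i, j) * v $ i * w $ j)"
  using assms
  by (simp add: scalar_prod_def atLeast0LessThan sum_distrib_left)
    (intro sum.cong refl, simp add: mult_ac)

text \<open>
The half of the variational characterization of the least eigenvalue that is needed here: a minimizer
\<open>v\<close> of the quadratic form on the unit sphere is an eigenvector. With \<open>u = A v - e v\<close>, the form minus
\<open>e\<close> times the squared norm is nonnegative along the line \<open>v + t u\<close> and vanishes at \<open>t = 0\<close>, so that the linear
term \<open>2 t (u \<bullet> u)\<close> is zero.
\<close>
lemma symmetric_eigenvalue_below_rayleigh: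
  fixes A :: "real mat"
  assumes A: "A \<in> carrier_mat m m" and m: "m > 0"
    and sym: "\<And>i j. i < m \<Longrightarrow> j < m \<Longrightarrow> A $$ (i, j) = A $$ (j, i)"
  obtains e where "e \<in> spectrum A" "\<And>v. v \<in> carrier_vec m \<Longrightarrow> e * (v \<bullet> v) \<le> v \<bullet> (A *\<^sub>v v)"
proof -
  obtain g where g1: "(\<Sum>i<m. (g i)\<^sup>2) = 1"
    and gmin: "\<And>h. (\<Sum>i<m. (h i)\<^sup>2) = 1 \<Longrightarrow>
      (\<Sum>i<m. \<Sum>j<m. A $$ (i, j) * g i * g j) \<le> (\<Sum>i<m. \<Sum>j<m. A $$ (i, j) * h i * h j)"
    using quadratic_form_min_on_sphere[OF m, of "\<lambda>i j. A $$ (i, j)"] by blast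
  define v where "v = vec m g"
  define e where "e = v \<bullet> (A *\<^sub>v v)"
  have v: "v \<in> carrier_vec m" by (simp add: v_def)
  have sq: "w \<bullet> w = (\<Sum>i<m. (w $ i)\<^sup>2)" if "w \<in> carrier_vec m" for w :: "real vec"
    using that by (simp add: scalar_prod_def atLeast0LessThan power2_eq_square)
  have vv: "v \<bullet> v = 1" using g1 v by (simp add: sq) (simp add: v_def)
  have ray: "e * (w \<bullet> w) \<le> w \<bullet> (A *\<^sub>v w)" if w: "w \<in> carrier_vec m" for w
  proof (cases "w \<bullet> w = 0")
    case True
    then have "w $ i = 0" if "i < m" for i
      using that unfolding sq[OF w] by (subst (asm) sum_nonneg_eq_0_iff) auto
    then show ?thesis using True by (simp add: quadratic_form_sum[OF A w w])
  next
    case False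
    let ?n = "w \<bullet> w"
    have n: "?n > 0" using False sum_nonneg[of "{..<m}" "\<lambda>i. (w $ i)\<^sup>2"] unfolding sq[OF w] by force
    have "(\<Sum>i<m. (w $ i / sqrt ?n)\<^sup>2) = ?n / ?n"
      using n by (simp add: sq[OF w] power_divide flip: sum_divide_distrib)
    then have "(\<Sum>i<m. (w $ i / sqrt ?n)\<^sup>2) = 1" using n by simp
    from gmin[OF this] have "e \<le> (\<Sum>i<m. \<Sum>j<m. A $$ (i, j) * (w $ i / sqrt ?n) * (w $ j / sqrt ?n))"
      unfolding e_def quadratic_form_sum[OF A v v] by (simp add: v_def)
    also have "\<dots> = (\<Sum>i<m. \<Sum>j<m. A $$ (i, j) * w $ i * w $ j / ?n)"
      using n by (intro sum.cong refl) simp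
    also have "\<dots> = w \<bullet> (A *\<^sub>v w) / ?n"
      unfolding quadratic_form_sum[OF A w w] sum_divide_distrib ..
    finally show ?thesis using n by (simp add: field_simps)
  qed
  define u where "u = A *\<^sub>v v - e \<cdot>\<^sub>v v"
  have Av: "A *\<^sub>v v \<in> carrier_vec m" using A v by simp
  have u: "u \<in> carrier_vec m" using A v by (simp add: u_def)
  have Au: "A *\<^sub>v u \<in> carrier_vec m" using A u by simp
  have symv: "v \<bullet> (A *\<^sub>v u) = u \<bullet> (A *\<^sub>v v)"
    unfolding quadratic_form_sum[OF A v u] quadratic_form_sum[OF A u v]
    by (subst sum.swap) (intro sum.cong refl, use sym in auto)
  have uu: "u \<bullet> (A *\<^sub>v v) - e * (u \<bullet> v) = u \<bullet> u"
  proof -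
    have "u \<bullet> u = u \<bullet> (A *\<^sub>v v - e \<cdot>\<^sub>v v)" by (simp add: u_def)
    also have "\<dots> = u \<bullet> (A *\<^sub>v v) - u \<bullet> (e \<cdot>\<^sub>v v)"
      using u Av v by (intro scalar_prod_minus_distrib) auto
    finally show ?thesis using u v by simp
  qed
  define \<beta> where "\<beta> = u \<bullet> (A *\<^sub>v u) - e * (u \<bullet> u)"
  have quad: "0 \<le> 2 * t * (u \<bullet> u) + t\<^sup>2 * \<beta>" for t
  proof -
    let ?w = "v + t \<cdot>\<^sub>v u"
    have w: "?w \<in> carrier_vec m" using u v by simp
    have "e * (?w \<bullet> ?w) \<le> ?w \<bullet> (A *\<^sub>v ?w)" by (rule ray[OF w])
    also have "A *\<^sub>v ?w = A *\<^sub>v v + t \<cdot>\<^sub>v (A *\<^sub>v u)"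
      using A u v by (simp add: mult_add_distrib_mat_vec[of _ m m] mult_mat_vec[of _ m m])
    finally have "e * (v \<bullet> v + 2 * t * (u \<bullet> v) + t\<^sup>2 * (u \<bullet> u)) \<le>
        v \<bullet> (A *\<^sub>v v) + t * (v \<bullet> (A *\<^sub>v u)) + t * (u \<bullet> (A *\<^sub>v v)) + t\<^sup>2 * (u \<bullet> (A *\<^sub>v u))"
      using u v Av Au
      by (simp add: add_scalar_prod_distrib[of _ m] scalar_prod_add_distrib[of _ m]
          comm_scalar_prod[of v m u] algebra_simps power2_eq_square)
    then show ?thesis
      unfolding symv \<beta>_def uu[symmetric] e_def[symmetric] vv by (simp add: algebra_simps)
  qed
  have "u \<bullet> u \<ge> 0" unfolding sq[OF u] by (intro sum_nonneg) auto
  moreover have "\<not> u \<bullet> u > 0"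
  proof
    assume p: "u \<bullet> u > 0"
    \<comment> \<open>A step in the direction of descent that is short enough for the linear term to prevail.\<close>
    let ?t = "- (u \<bullet> u) / (\<bar>\<beta>\<bar> + 1)"
    have "?t\<^sup>2 * \<beta> \<le> ?t\<^sup>2 * (\<bar>\<beta>\<bar> + 1)" by (intro mult_left_mono) auto
    also have "\<dots> = - ?t * (u \<bullet> u)"
    proof -
      have L: "(- n / d)\<^sup>2 * d = - (- n / d) * n" if "d > 0" for n d :: real
        using that by (simp add: power2_eq_square field_simps)
      show ?thesis by (rule L) linarith
    qed
    finally have "0 \<le> ?t * (u \<bullet> u)" using quad[of ?t] by linarith
    moreover have "?t < 0" using p by (intro divide_neg_pos) auto
    ultimately show False using p mult_neg_pos[of ?t "u \<bullet> u"] by linarith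
  qed
  ultimately have "u \<bullet> u = 0" by simp
  then have u0: "u $ i = 0" if "i < m" for i
    using that unfolding sq[OF u] by (subst (asm) sum_nonneg_eq_0_iff) auto
  have "A *\<^sub>v v = e \<cdot>\<^sub>v v"
  proof (rule eq_vecI)
    fix i assume "i < dim_vec (e \<cdot>\<^sub>v v)"
    then have "i < m" using v by simp
    then show "(A *\<^sub>v v) $ i = (e \<cdot>\<^sub>v v) $ i" using u0[of i] A v by (simp add: u_def)
  qed (use A v in simp)
  moreover have "v \<noteq> 0\<^sub>v m" using vv by auto
  ultimately have "e \<in> spectrum A" using A v unfolding spectrum_def eigenvalue_def eigenvector_def by auto
  then show ?thesis using ray by (rule that)
qed

lemma information_matrix_carrier: "information_matrix m f \<xi> \<in> carrier_mat m m"
  by (simp add: information_matrix_def)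

lemma information_matrix_index:
  assumes "finite A" "set_pmf \<xi> \<subseteq> A" "i < m" "j < m"
  shows "information_matrix m f \<xi> $$ (i, j) = (\<Sum>t\<in>A. pmf \<xi> t * (f t $ i * f t $ j))"
  using assms by (simp add: information_matrix_def) (subst integral_measure_pmf[of A], auto)

lemma information_matrix_quadratic_form:
  assumes "finite A" "set_pmf \<xi> \<subseteq> A" and f: "\<And>t. f t \<in> carrier_vec m" and v: "v \<in> carrier_vec m"
  shows "v \<bullet> (information_matrix m f \<xi> *\<^sub>v v) = (\<Sum>t\<in>A. pmf \<xi> t * (v \<bullet> f t)\<^sup>2)"
proof -
  have "v \<bullet> (information_matrix m f \<xi> *\<^sub>v v) =
      (\<Sum>i<m. \<Sum>j<m. \<Sum>t\<in>A. pmf \<xi> t * (f t $ i * f t $ j) * v $ i * v $ j)"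
    unfolding quadratic_form_sum[OF information_matrix_carrier v v]
    by (intro sum.cong refl) (simp add: information_matrix_index[OF assms(1,2)] sum_distrib_right)
  also have "\<dots> = (\<Sum>t\<in>A. \<Sum>i<m. \<Sum>j<m. pmf \<xi> t * (f t $ i * f t $ j) * v $ i * v $ j)"
    by (subst sum.swap[of _ "{..<m}" A], intro sum.cong refl sum.swap)
  also have "\<dots> = (\<Sum>t\<in>A. pmf \<xi> t * (v \<bullet> f t)\<^sup>2)"
  proof (intro sum.cong refl)
    fix t
    have "(v \<bullet> f t)\<^sup>2 = (\<Sum>i<m. v $ i * f t $ i) * (\<Sum>j<m. v $ j * f t $ j)"
      using f[of t] by (simp add: scalar_prod_def atLeast0LessThan power2_eq_square)
    then show "(\<Sum>i<m. \<Sum>j<m. pmf \<xi> t * (f t $ i * f t $ j) * v $ i * v $ j) = pmf \<xi> t * (v \<bullet> f t)\<^sup>2"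
      by (simp add: sum_product sum_distrib_left mult_ac)
  qed
  finally show ?thesis .
qed

text \<open>
The upper bound valid for all designs: the Rayleigh quotient of the information matrix at \<open>c\<close> is an average of
\<open>(c \<bullet> f t)\<^sup>2 \<le> 1\<close>.
\<close>
lemma min_eigenvalue_information_matrix_le:
  assumes m: "m > 0" and f: "\<And>t. f t \<in> carrier_vec m" and c: "c \<in> carrier_vec m" "c \<bullet> c > 0"
    and le: "\<And>t. t \<in> I \<Longrightarrow> \<bar>c \<bullet> f t\<bar> \<le> 1" and d: "is_design I \<eta>"
  shows "min_eigenvalue (information_matrix m f \<eta>) \<le> 1 / (c \<bullet> c)"
proof -
  let ?M = "information_matrix m f \<eta>"
  have fin: "finite (set_pmf \<eta>)" and sub: "set_pmf \<eta> \<subseteq> I" using d by (auto simp: is_design_def)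
  obtain e where e: "e \<in> spectrum ?M" "\<And>v. v \<in> carrier_vec m \<Longrightarrow> e * (v \<bullet> v) \<le> v \<bullet> (?M *\<^sub>v v)"
    by (rule symmetric_eigenvalue_below_rayleigh[OF information_matrix_carrier m, of f \<eta>])
       (auto simp: information_matrix_def mult.commute)
  have "e * (c \<bullet> c) \<le> (\<Sum>t\<in>set_pmf \<eta>. pmf \<eta> t * (c \<bullet> f t)\<^sup>2)"
    using e(2)[OF c(1)] information_matrix_quadratic_form[where f = f, OF fin subset_refl f c(1)] by simp
  also have "\<dots> \<le> (\<Sum>t\<in>set_pmf \<eta>. pmf \<eta> t * 1)"
  proof (intro sum_mono mult_left_mono)
    fix t assume "t \<in> set_pmf \<eta>"
    then have "\<bar>c \<bullet> f t\<bar> \<le> 1" using le sub by auto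
    then show "(c \<bullet> f t)\<^sup>2 \<le> 1" by (simp add: abs_square_le_1)
  qed auto
  also have "\<dots> = 1" using sum_pmf_eq_1[OF fin subset_refl] by simp
  finally have "e \<le> 1 / (c \<bullet> c)" using c(2) by (simp add: field_simps)
  moreover have "min_eigenvalue ?M \<le> e"
    unfolding min_eigenvalue_def
    using card_finite_spectrum(1)[OF information_matrix_carrier] e(1) by (intro Min_le)
  ultimately show ?thesis by simp
qed

text \<open>
The weights are allowed to vanish, so the support may be smaller than the set of points.
\<close>
lemma finite_support_pmf:
  fixes x :: "nat \<Rightarrow> 'a" and w :: "nat \<Rightarrow> real"
  assumes inj: "inj_on x {..<m}" and w: "\<And>i. i < m \<Longrightarrow> w i \<ge> 0" "(\<Sum>i<m. w i) = 1"
  obtains \<xi> where "set_pmf \<xi> \<subseteq> x ` {..<m}" "\<And>i. i < m \<Longrightarrow> pmf \<xi> (x i) = w i"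
proof -
  define h where "h t = (if t \<in> x ` {..<m} then w (the_inv_into {..<m} x t) else 0)" for t
  have hx: "h (x i) = w i" if "i < m" for i
    using that by (simp add: h_def the_inv_into_f_f[OF inj])
  have h0: "h t \<ge> 0" for t
  proof (cases "t \<in> x ` {..<m}")
    case True then show ?thesis using hx w(1) by auto
  qed (simp add: h_def)
  have "(\<integral>\<^sup>+ t. ennreal (h t) \<partial>count_space UNIV) = (\<Sum>t\<in>x ` {..<m}. ennreal (h t))"
    by (intro nn_integral_count_space') (auto simp: h_def)
  also have "\<dots> = (\<Sum>i<m. ennreal (w i))"
    using inj by (simp add: sum.reindex hx)
  also have "\<dots> = 1" using w by (subst sum_ennreal) auto
  finally have p: "pmf (embed_pmf h) t = h t" for t using h0 by (intro pmf_embed_pmf) auto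
  show ?thesis
  proof (rule that[of "embed_pmf h"])
    show "set_pmf (embed_pmf h) \<subseteq> x ` {..<m}"
      by (auto simp: set_pmf_eq p h_def split: if_splits)
  qed (simp add: p hx)
qed


text \<open>
The vectors \<open>u\<close> and \<open>v\<close> in the hypothesis are the rows \<open>i\<close> and \<open>l\<close> of the inverse of the value matrix, described
by their biorthogonality. Let \<open>K i l\<close> be the signed Gram matrix of these rows. Then \<open>(c \<bullet> c) * w $ i\<close> is its
\<open>i\<close>th row sum, and with the signed values \<open>z i\<close> of \<open>v \<bullet> f\<close> at the points
\<open>(c \<bullet> c) * (v \<bullet> M v) - v \<bullet> v = \<Sum>\<^sub>i\<^sub>l K i l (z i - z l)\<^sup>2 / 2\<close>, which is nonnegative if \<open>K\<close> is.
\<close>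
theorem E_optimal_chebyshev_design:
  fixes f :: "real \<Rightarrow> real vec"
  assumes cheb: "chebyshev_polynomial_points I m f c x" and m: "m > 0" and f: "\<And>t. f t \<in> carrier_vec m"
    and gram: "\<And>i l u v. i < m \<Longrightarrow> l < m \<Longrightarrow> u \<in> carrier_vec m \<Longrightarrow> v \<in> carrier_vec m \<Longrightarrow>
      (\<And>j. j < m \<Longrightarrow> u \<bullet> f (x $ j) = (if i = j then 1 else 0)) \<Longrightarrow>
      (\<And>j. j < m \<Longrightarrow> v \<bullet> f (x $ j) = (if l = j then 1 else 0)) \<Longrightarrow>
      (-1) ^ Suc i * (-1) ^ Suc l * (u \<bullet> v) \<ge> 0"
  obtains \<xi> where "has_masses_at \<xi> m (chebyshev_weights m f c x) x" "E_optimal I m f \<xi>"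
proof -
  have c: "c \<in> carrier_vec m" and x: "increasing_points I m x"
    and le: "\<And>t. t \<in> I \<Longrightarrow> \<bar>c \<bullet> f t\<bar> \<le> 1" and alt: "\<And>i. i < m \<Longrightarrow> c \<bullet> f (x $ i) = (-1) ^ Suc i"
    using cheb by (auto simp: chebyshev_polynomial_points_def)
  have inj: "inj_on (\<lambda>i. x $ i) {..<m}" by (rule increasing_points_inj[OF x])
  let ?F = "value_matrix m f x"
  have F: "?F \<in> carrier_mat m m" by (simp add: value_matrix_def)
  have "det ?F \<noteq> 0" using cheb x by (force simp: chebyshev_polynomial_points_def chebyshev_system_def)
  then have unit: "?F \<in> Units (ring_mat TYPE(real) m ())" by (rule det_non_zero_imp_unit[OF F])
  then obtain G where Gsome: "mat_inverse ?F = Some G"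
    using mat_inverse(1)[OF F, of "()"] by (cases "mat_inverse ?F") auto
  have G: "G \<in> carrier_mat m m" "?F * G = 1\<^sub>m m" "G * ?F = 1\<^sub>m m"
    using mat_inverse(2)[OF F Gsome] by auto
  define e :: "nat \<Rightarrow> real" where "e i = (-1) ^ Suc i" for i
  have ee: "e i * e i = 1" for i by (simp add: e_def flip: power_add power_mult_distrib)
  define K where "K i l = e i * e l * (row G i \<bullet> row G l)" for i l
  have delta: "row G i \<bullet> f (x $ j) = (if i = j then 1 else 0)" if "i < m" "j < m" for i j
  proof -
    have "col ?F j = f (x $ j)" using that f[of "x $ j"] by (intro eq_vecI) (auto simp: value_matrix_def)
    moreover have "(G * ?F) $$ (i, j) = row G i \<bullet> col ?F j" using that G(1) F by simp
    ultimately show ?thesis using that unfolding G(3) by simp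
  qed
  have rowG: "row G i \<in> carrier_vec m" for i using G(1) by (auto simp: row_def)
  have Kpos: "K i l \<ge> 0" if "i < m" "l < m" for i l
    unfolding K_def e_def using gram[OF that rowG rowG delta[OF that(1)] delta[OF that(2)]] by simp
  have Ksym: "K i l = K l i" for i l
    unfolding K_def by (simp add: comm_scalar_prod[OF rowG rowG, of l i])
  have expand: "v $ a = (\<Sum>i<m. (v \<bullet> f (x $ i)) * row G i $ a)" if v: "v \<in> carrier_vec m" and a: "a < m" for v a
  proof -
    have FG: "(\<Sum>i<m. f (x $ i) $ j * G $$ (i, a)) = (if j = a then 1 else 0)" if "j < m" for j
      using that a G(1) F arg_cong[OF G(2), of "\<lambda>M. M $$ (j, a)"]
      by (simp add: scalar_prod_def atLeast0LessThan value_matrix_def)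
    have "(\<Sum>i<m. (v \<bullet> f (x $ i)) * row G i $ a) = (\<Sum>i<m. \<Sum>j<m. v $ j * (f (x $ i) $ j * G $$ (i, a)))"
      using carrier_vecD[OF f] G(1) a by (intro sum.cong refl) (auto simp: scalar_prod_def atLeast0LessThan sum_distrib_right mult.assoc)
    also have "\<dots> = (\<Sum>j<m. v $ j * (\<Sum>i<m. f (x $ i) $ j * G $$ (i, a)))"
      by (subst sum.swap) (simp add: sum_distrib_left)
    also have "\<dots> = v $ a" using a by (simp add: FG if_distrib cong: if_cong)
    finally show ?thesis ..
  qed
  have prod_expand: "v \<bullet> w = (\<Sum>i<m. (v \<bullet> f (x $ i)) * (row G i \<bullet> w))"
    if v: "v \<in> carrier_vec m" and w: "w \<in> carrier_vec m" for v w
  proof -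
    have "v \<bullet> w = (\<Sum>a<m. (\<Sum>i<m. (v \<bullet> f (x $ i)) * row G i $ a) * w $ a)"
      using w by (simp add: scalar_prod_def[of v w] atLeast0LessThan flip: expand[OF v])
    also have "\<dots> = (\<Sum>i<m. \<Sum>a<m. (v \<bullet> f (x $ i)) * row G i $ a * w $ a)"
      unfolding sum_distrib_right by (rule sum.swap)
    also have "\<dots> = (\<Sum>i<m. (v \<bullet> f (x $ i)) * (row G i \<bullet> w))"
      using w by (intro sum.cong refl)
        (simp add: scalar_prod_def[of "row G _"] atLeast0LessThan sum_distrib_left mult.assoc)
    finally show ?thesis .
  qed
  have Gv: "row G i \<bullet> v = (\<Sum>l<m. (v \<bullet> f (x $ l)) * (row G i \<bullet> row G l))" if "v \<in> carrier_vec m" for v i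
    using prod_expand[OF that rowG[of i]] comm_scalar_prod[OF rowG[of i] that] comm_scalar_prod[OF rowG rowG] by simp
  define w where "w = chebyshev_weights m f c x"
  have w: "(c \<bullet> c) * w $ i = (\<Sum>l<m. K i l)" if i: "i < m" and cc: "c \<bullet> c \<noteq> 0" for i
  proof -
    have "w $ i = (1 / (c \<bullet> c)) * (\<Sum>j<m. (if i = j then e i else 0) * (row G j \<bullet> c))"
      using i G(1) c by (simp add: w_def chebyshev_weights_def Gsome sign_matrix_def scalar_prod_def[of "vec m _"]
          atLeast0LessThan e_def cong: if_cong)
    also have "(\<Sum>j<m. (if i = j then e i else 0) * (row G j \<bullet> c)) = e i * (row G i \<bullet> c)"
      using i by (simp add: if_distrib[of "\<lambda>z. z * _"] cong: if_cong)
    also have "\<dots> = (\<Sum>l<m. K i l)"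
      unfolding Gv[OF c] sum_distrib_left K_def by (intro sum.cong refl) (simp add: alt e_def)
    finally show ?thesis using cc by simp
  qed
  have c0: "c \<bullet> f (x $ 0) = -1" using alt[OF m] by simp
  have cc: "c \<bullet> c > 0"
  proof -
    have "c \<bullet> c = (\<Sum>i<m. (c $ i)\<^sup>2)" using c by (simp add: scalar_prod_def atLeast0LessThan power2_eq_square)
    moreover have "\<not> (\<forall>i<m. c $ i = 0)"
    proof
      assume "\<forall>i<m. c $ i = 0"
      then have "c \<bullet> f (x $ 0) = 0" using f[of "x $ 0"] by (simp add: scalar_prod_def)
      then show False using c0 by simp
    qed
    ultimately show ?thesis by (metis (no_types, lifting) finite_lessThan lessThan_iff sum_pos2 zero_le_power2 zero_less_power2)
  qed
  have ccK: "c \<bullet> c = (\<Sum>i<m. \<Sum>l<m. K i l)"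
  proof -
    have "c \<bullet> c = (\<Sum>i<m. e i * (\<Sum>l<m. e l * (row G i \<bullet> row G l)))"
      unfolding prod_expand[OF c c] Gv[OF c] by (intro sum.cong refl) (simp add: alt e_def)
    then show ?thesis by (simp add: K_def sum_distrib_left mult.assoc)
  qed
  have wpos: "w $ i \<ge> 0" if "i < m" for i
  proof -
    have "(\<Sum>l<m. K i l) \<ge> 0" using Kpos[OF that] by (intro sum_nonneg) auto
    then have "(c \<bullet> c) * w $ i \<ge> 0" using w[OF that] cc by simp
    then show ?thesis using cc by (simp add: zero_le_mult_iff)
  qed
  have "(c \<bullet> c) * (\<Sum>i<m. w $ i) = c \<bullet> c"
    unfolding sum_distrib_left using w cc ccK by simp
  then have wsum: "(\<Sum>i<m. w $ i) = 1" using cc by simp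
  obtain \<xi> where \<xi>: "set_pmf \<xi> \<subseteq> (\<lambda>i. x $ i) ` {..<m}" "\<And>i. i < m \<Longrightarrow> pmf \<xi> (x $ i) = w $ i"
    using finite_support_pmf[OF inj, of "\<lambda>i. w $ i"] wpos wsum by blast
  let ?M = "information_matrix m f \<xi>"
  have Mv: "v \<bullet> (?M *\<^sub>v v) = (\<Sum>i<m. w $ i * (v \<bullet> f (x $ i))\<^sup>2)" if "v \<in> carrier_vec m" for v
    using information_matrix_quadratic_form[where f = f, OF _ \<xi>(1) f that] inj \<xi>(2) by (simp add: sum.reindex)
  have low: "v \<bullet> v \<le> (c \<bullet> c) * (v \<bullet> (?M *\<^sub>v v))" if v: "v \<in> carrier_vec m" for v
  proof -
    define z where "z i = e i * (v \<bullet> f (x $ i))" for i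
    have ez: "v \<bullet> f (x $ i) = e i * z i" for i by (simp add: z_def ee flip: mult.assoc)
    have "v \<bullet> v = (\<Sum>i<m. \<Sum>l<m. K i l * (z i * z l))"
      unfolding prod_expand[OF v v] Gv[OF v] ez K_def sum_distrib_left
      by (intro sum.cong refl) simp
    \<comment> \<open>The defect in the inequality of the arithmetic and geometric means is the Laplacian form.\<close>
    also have "\<dots> \<le> (\<Sum>i<m. \<Sum>l<m. K i l * (((z i)\<^sup>2 + (z l)\<^sup>2) / 2))"
    proof (intro sum_mono mult_left_mono)
      show "z i * z l \<le> ((z i)\<^sup>2 + (z l)\<^sup>2) / 2" for i l
        using zero_le_power2[of "z i - z l"] by (simp add: power2_diff)
    qed (use Kpos in auto)
    also have "\<dots> = ((\<Sum>i<m. \<Sum>l<m. K i l * (z i)\<^sup>2) + (\<Sum>i<m. \<Sum>l<m. K i l * (z l)\<^sup>2)) / 2"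
      by (simp add: sum.distrib sum_divide_distrib add_divide_distrib distrib_left)
    also have "(\<Sum>i<m. \<Sum>l<m. K i l * (z l)\<^sup>2) = (\<Sum>i<m. \<Sum>l<m. K i l * (z i)\<^sup>2)"
      by (subst sum.swap) (simp add: Ksym)
    also have "((\<Sum>i<m. \<Sum>l<m. K i l * (z i)\<^sup>2) + (\<Sum>i<m. \<Sum>l<m. K i l * (z i)\<^sup>2)) / 2 =
        (\<Sum>i<m. (\<Sum>l<m. K i l) * (z i)\<^sup>2)"
      by (simp add: sum_distrib_right)
    also have "\<dots> = (c \<bullet> c) * (v \<bullet> (?M *\<^sub>v v))"
    proof -
      have "(z i)\<^sup>2 = (v \<bullet> f (x $ i))\<^sup>2" for i
        by (simp add: z_def power_mult_distrib power2_eq_square[of "e i"] ee)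
      then show ?thesis
        unfolding Mv[OF v] sum_distrib_left using w cc by (simp flip: mult.assoc)
    qed
    finally show ?thesis .
  qed
  have ge: "1 / (c \<bullet> c) \<le> lam" if lam: "lam \<in> spectrum ?M" for lam
  proof -
    obtain v where v: "v \<in> carrier_vec m" "v \<noteq> 0\<^sub>v m" "?M *\<^sub>v v = lam \<cdot>\<^sub>v v"
      using lam by (auto simp: spectrum_def eigenvalue_def eigenvector_def information_matrix_def)
    have "v \<bullet> v = (\<Sum>i<m. (v $ i)\<^sup>2)" using v by (simp add: scalar_prod_def atLeast0LessThan power2_eq_square)
    moreover have "\<not> (\<forall>i<m. v $ i = 0)" using v(1,2) by (auto intro: eq_vecI)
    ultimately have vv: "v \<bullet> v > 0"
      by (metis (no_types, lifting) finite_lessThan lessThan_iff sum_pos2 zero_le_power2 zero_less_power2)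
    have "v \<bullet> v \<le> (c \<bullet> c) * (lam * (v \<bullet> v))" using low[OF v(1)] v by simp
    then show ?thesis using vv cc by (simp add: field_simps)
  qed
  obtain e0 where "e0 \<in> spectrum ?M"
    by (rule symmetric_eigenvalue_below_rayleigh[OF information_matrix_carrier m, of f \<xi>])
       (auto simp: information_matrix_def mult.commute)
  then have "1 / (c \<bullet> c) \<le> min_eigenvalue ?M"
    unfolding min_eigenvalue_def using card_finite_spectrum(1)[OF information_matrix_carrier] ge
    by (subst Min_ge_iff) auto
  moreover have "min_eigenvalue (information_matrix m f \<eta>) \<le> 1 / (c \<bullet> c)" if "is_design I \<eta>" for \<eta>
    by (rule min_eigenvalue_information_matrix_le[OF m f c cc le that])
  moreover have "is_design I \<xi>"
    using \<xi>(1) x finite_subset[OF \<xi>(1)] by (auto simp: is_design_def increasing_points_def)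
  ultimately have "E_optimal I m f \<xi>"
    unfolding E_optimal_def is_arg_max_def by (meson leD le_less_trans less_le_trans)
  moreover have "has_masses_at \<xi> m w x" using \<xi> by (simp add: has_masses_at_def)
  ultimately show ?thesis using that by (simp add: w_def)
qed

section \<open>Partial fractions of node polynomials at clustered poles\<close>

lemma poly_pderiv_node_poly:
  assumes "finite J" "\<And>j. j \<in> J \<Longrightarrow> t \<noteq> x j"
  shows "poly (pderiv (node_poly x J)) t = poly (node_poly x J) t * (\<Sum>j\<in>J. 1 / (t - x j))"
  using assms
proof (induction J)
  case empty
  then show ?case by (simp add: node_poly_def)
next
  case (insert j J)
  then have 0: "t - x j \<noteq> 0" by auto
  let ?p = "node_poly x J"
  have ins: "node_poly x (insert j J) = [:- x j, 1:] * ?p" using insert.hyps by (simp add: node_poly_def)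
  have "poly (pderiv (node_poly x (insert j J))) t = (t - x j) * poly (pderiv ?p) t + poly ?p t"
    unfolding ins pderiv_mult poly_add poly_mult by (simp add: pderiv_pCons)
  also have "\<dots> = (t - x j) * poly ?p t * (1 / (t - x j) + (\<Sum>j\<in>J. 1 / (t - x j)))"
    using insert 0 by (simp add: distrib_left)
  finally have "poly (pderiv (node_poly x (insert j J))) t =
    (t - x j) * poly ?p t * (1 / (t - x j) + (\<Sum>j\<in>J. 1 / (t - x j)))" .
  moreover have "poly (node_poly x (insert j J)) t = (t - x j) * poly ?p t"
    unfolding ins by (simp add: algebra_simps)
  ultimately show ?case using insert.hyps by simp
qed

lemma denom_poly_eq_node_poly: "denom_poly R b = node_poly b R * node_poly b R"
  unfolding denom_poly_def node_poly_def power2_eq_square by (rule prod.distrib)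

lemma poly_pderiv_denom_poly:
  assumes "finite R" "\<And>q. q \<in> R \<Longrightarrow> t \<noteq> b q"
  shows "poly (pderiv (denom_poly R b)) t = poly (denom_poly R b) t * (2 * (\<Sum>q\<in>R. 1 / (t - b q)))"
  by (simp add: denom_poly_eq_node_poly pderiv_mult poly_pderiv_node_poly[OF assms])

text \<open>
The second coefficient is the logarithmic derivative of the numerator divided by the remaining factors of the
denominator, times the first one.
\<close>
lemma pole_coefficients_of_node_poly:
  assumes b: "inj_on b {..<k}" and r: "r < k" and J: "finite J" "\<And>j. j \<in> J \<Longrightarrow> b r \<noteq> x j"
    and a: "pf_numerator s k b a = node_poly x J"
  shows "a $ (s + 2 * r + 1) = (\<Prod>j\<in>J. b r - x j) / (\<Prod>q\<in>{..<k} - {r}. (b r - b q) ^ 2)"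
    and "a $ (s + 2 * r) = a $ (s + 2 * r + 1) * ((\<Sum>j\<in>J. 1 / (b r - x j)) - 2 * (\<Sum>q\<in>{..<k} - {r}. 1 / (b r - b q)))"
proof -
  let ?E = "denom_poly ({..<k} - {r}) b"
  have ne: "b r \<noteq> b q" if "q \<in> {..<k} - {r}" for q using b r that by (auto simp: inj_on_def)
  have E: "poly ?E (b r) \<noteq> 0" using ne by (auto simp: poly_denom_poly)
  have N: "poly (node_poly x J) (b r) = a $ (s + 2 * r + 1) * poly ?E (b r)"
    using poly_pf_numerator_at_pole[OF r, of s b a] a by simp
  then show "a $ (s + 2 * r + 1) = (\<Prod>j\<in>J. b r - x j) / (\<Prod>q\<in>{..<k} - {r}. (b r - b q) ^ 2)"
    using E by (simp add: poly_node_poly poly_denom_poly)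
  have "poly (pderiv (node_poly x J)) (b r) = a $ (s + 2 * r) * poly ?E (b r) + a $ (s + 2 * r + 1) * poly (pderiv ?E) (b r)"
    using pderiv_pf_numerator_at_pole[OF r, of s b a] a by simp
  moreover have "poly (pderiv (node_poly x J)) (b r) = poly (node_poly x J) (b r) * (\<Sum>j\<in>J. 1 / (b r - x j))"
    by (rule poly_pderiv_node_poly[OF J])
  moreover have "poly (pderiv ?E) (b r) = poly ?E (b r) * (2 * (\<Sum>q\<in>{..<k} - {r}. 1 / (b r - b q)))"
    by (rule poly_pderiv_denom_poly) (use ne in auto)
  ultimately have "poly ?E (b r) * (a $ (s + 2 * r)) = poly ?E (b r) *
     (a $ (s + 2 * r + 1) * ((\<Sum>j\<in>J. 1 / (b r - x j)) - 2 * (\<Sum>q\<in>{..<k} - {r}. 1 / (b r - b q))))"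
    unfolding N by (simp only: algebra_simps)
  then show "a $ (s + 2 * r) = a $ (s + 2 * r + 1) * ((\<Sum>j\<in>J. 1 / (b r - x j)) - 2 * (\<Sum>q\<in>{..<k} - {r}. 1 / (b r - b q)))"
    using E by simp
qed

text \<open>
Scaled distances of the poles from the boundary of the design space. They lie in
\<open>[1, 2]\<close>, and the gaps grow by the factor four, so that the nearest smaller neighbour of a pole outweighs
all larger ones. The denominator makes even the largest gap so small that this interaction dominates the
contribution of up to \<open>m\<close> design points.
\<close>
definition pole_cluster :: "nat \<Rightarrow> nat \<Rightarrow> nat \<Rightarrow> real" where
  "pole_cluster m k r = 1 + 4 ^ r / (real m * 4 ^ k)"

lemma pole_cluster_bounds:
  assumes "m \<ge> 1" "r < k"
  shows "pole_cluster m k r \<ge> 1" "pole_cluster m k r \<le> 2"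
proof -
  have "(4 :: real) ^ r \<le> 1 * 4 ^ k" using assms(2) by (simp add: power_increasing)
  also have "\<dots> \<le> real m * 4 ^ k" using assms(1) by (intro mult_right_mono) auto
  finally show "pole_cluster m k r \<ge> 1" "pole_cluster m k r \<le> 2"
    using assms(1) by (simp_all add: pole_cluster_def divide_le_eq)
qed

lemma pole_cluster_less:
  assumes "m \<ge> 1" "r < q"
  shows "pole_cluster m k r < pole_cluster m k q"
proof -
  have "(4 :: real) ^ r < 4 ^ q" using assms(2) by simp
  then show ?thesis using assms(1) by (simp add: pole_cluster_def divide_strict_right_mono)
qed

lemma sum_geometric_tail: "r < k \<Longrightarrow> (\<Sum>q\<in>{r<..<k}. (1 / 4 :: real) ^ q) \<le> (1 / 3) * (1 / 4) ^ r - (1 / 3) * (1 / 4) ^ (k - 1)"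
proof (induction k)
  case (Suc k)
  show ?case
  proof (cases "r = k")
    case True
    then have "{r<..<Suc k} = {}" by auto
    then show ?thesis using True by simp
  next
    case False
    then have r: "r < k" using Suc.prems by simp
    then have "{r<..<Suc k} = insert k {r<..<k}" by auto
    then have "(\<Sum>q\<in>{r<..<Suc k}. (1 / 4 :: real) ^ q) = (1 / 4) ^ k + (\<Sum>q\<in>{r<..<k}. (1 / 4) ^ q)" by simp
    moreover have "(1 / 4 :: real) ^ (k - 1) = 4 * (1 / 4) ^ k" using r by (cases k) auto
    ultimately show ?thesis using Suc.IH[OF r] by simp
  qed
qed simp

text \<open>
The term of the neighbour \<open>r - 1\<close> is \<open>4/3\<close> in units of \<open>(1/4)\<^sup>r\<close> times the inverse of the scale; the poles
beyond \<open>r\<close> subtract at most \<open>4/9\<close> of the same unit by the geometric series.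
\<close>
lemma pole_cluster_repulsion:
  assumes m: "m \<ge> 1" and r: "r < k" "r \<ge> 1"
  shows "real m \<le> 2 * (\<Sum>q\<in>{..<k} - {r}. 1 / (pole_cluster m k r - pole_cluster m k q))"
proof -
  let ?g = "pole_cluster m k"
  define e where "e = 1 / (real m * 4 ^ k)"
  have e: "e > 0" using m by (simp add: e_def)
  have g: "?g r = 1 + e * 4 ^ r" for r by (simp add: pole_cluster_def e_def)
  have "{..<k} - {r} = insert (r - 1) ({..<r - 1} \<union> {r<..<k})" using r by auto
  moreover have "r - 1 \<notin> {..<r - 1} \<union> {r<..<k}" "{..<r - 1} \<inter> {r<..<k} = {}" using r by auto
  ultimately have S: "(\<Sum>q\<in>{..<k} - {r}. 1 / (?g r - ?g q)) =
     1 / (?g r - ?g (r - 1)) + ((\<Sum>q\<in>{..<r - 1}. 1 / (?g r - ?g q)) + (\<Sum>q\<in>{r<..<k}. 1 / (?g r - ?g q)))"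
    by (simp add: sum.union_disjoint)
  have 1: "1 / (?g r - ?g (r - 1)) = (4 / 3) * ((1 / 4) ^ r / e)"
    using r e by (cases r) (simp_all add: g power_divide field_simps)
  have 2: "(\<Sum>q\<in>{..<r - 1}. 1 / (?g r - ?g q)) \<ge> 0"
    using pole_cluster_less[OF m, of _ r k] r by (intro sum_nonneg) (simp add: less_imp_le)
  have 3: "(\<Sum>q\<in>{r<..<k}. 1 / (?g r - ?g q)) \<ge> - ((4 / 9) * ((1 / 4) ^ r / e))"
  proof -
    have "- ((4 / 3) * ((1 / 4) ^ q / e)) \<le> 1 / (?g r - ?g q)" if q: "q \<in> {r<..<k}" for q
    proof -
      have "(4 :: real) ^ r < 4 ^ q" using q by simp
      have "(4 :: real) ^ Suc r \<le> 4 ^ q" using q by (intro power_increasing) auto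
      then have "e * ((3 / 4) * 4 ^ q) \<le> e * (4 ^ q - 4 ^ r)" using e by (intro mult_left_mono) auto
      then have "1 / (e * (4 ^ q - 4 ^ r)) \<le> 1 / (e * ((3 / 4) * 4 ^ q))"
        using e \<open>(4 :: real) ^ r < 4 ^ q\<close> by (intro divide_left_mono mult_pos_pos) auto
      also have "\<dots> = (4 / 3) * ((1 / 4) ^ q / e)" using e by (simp add: power_divide field_simps)
      finally have "- ((4 / 3) * ((1 / 4) ^ q / e)) \<le> - (1 / (e * (4 ^ q - 4 ^ r)))" by simp
      also have "\<dots> = 1 / (?g r - ?g q)"
        by (simp add: g algebra_simps flip: divide_minus_right)
      finally show ?thesis .
    qed
    then have "(\<Sum>q\<in>{r<..<k}. - ((4 / 3) * ((1 / 4) ^ q / e))) \<le> (\<Sum>q\<in>{r<..<k}. 1 / (?g r - ?g q))"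
      by (rule sum_mono)
    moreover have "(\<Sum>q\<in>{r<..<k}. - ((4 / 3) * ((1 / 4) ^ q / e))) = - ((4 / 3) / e * (\<Sum>q\<in>{r<..<k}. (1 / 4) ^ q))"
      by (simp add: sum_negf sum_distrib_left field_simps)
    moreover have "(4 / 3) / e * (\<Sum>q\<in>{r<..<k}. (1 / 4) ^ q) \<le> (4 / 3) / e * ((1 / 3) * (1 / 4) ^ r)"
    proof (intro mult_left_mono)
      show "(\<Sum>q\<in>{r<..<k}. (1 / 4 :: real) ^ q) \<le> (1 / 3) * (1 / 4) ^ r"
        using sum_geometric_tail[OF r(1)] zero_le_power[of "1 / 4 :: real" "k - 1"] by linarith
    qed (use e in simp)
    moreover have "(4 / 3) / e * ((1 / 3) * (1 / 4) ^ r) = (4 / 9) * ((1 / 4) ^ r / e)" by simp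
    ultimately show ?thesis by linarith
  qed
  have "(4 :: real) ^ r \<le> 4 ^ k" using r by (intro power_increasing) auto
  then have "real m \<le> (1 / 4) ^ r / e" using m by (simp add: e_def power_divide field_simps)
  then show ?thesis using S 1 2 3 by linarith
qed

text \<open>
At the pole nearest to the design space both sums contribute with the same sign; at all other poles the sum over the
cluster wins. So the sign does not depend on the design points.
\<close>
lemma pole_cluster_bracket_sign:
  assumes m: "m \<ge> 1" and r: "r < k" and J: "finite J" "card J \<le> m" "\<And>j. j \<in> J \<Longrightarrow> y j \<ge> 0"
  defines "A \<equiv> 2 * (\<Sum>q\<in>{..<k} - {r}. 1 / (pole_cluster m k r - pole_cluster m k q)) -
     (\<Sum>j\<in>J. 1 / (pole_cluster m k r + y j))"
  shows "r = 0 \<Longrightarrow> A \<le> 0" "r \<ge> 1 \<Longrightarrow> A \<ge> 0"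
proof -
  let ?g = "pole_cluster m k"
  have pos: "?g r + y j \<ge> 1" if "j \<in> J" for j using pole_cluster_bounds(1)[OF m r] J(3)[OF that] by simp
  have lo: "(\<Sum>j\<in>J. 1 / (?g r + y j)) \<ge> 0" using pos by (intro sum_nonneg) force
  have "(\<Sum>j\<in>J. 1 / (?g r + y j)) \<le> (\<Sum>j\<in>J. 1)" using pos by (intro sum_mono) (simp add: divide_le_eq)
  then have hi: "(\<Sum>j\<in>J. 1 / (?g r + y j)) \<le> real m" using J(2) by simp
  show "A \<ge> 0" if "r \<ge> 1" using pole_cluster_repulsion[OF m r that] hi by (simp add: A_def)
  show "A \<le> 0" if "r = 0"
  proof -
    have "(\<Sum>q\<in>{..<k} - {r}. 1 / (?g r - ?g q)) \<le> 0"
      using pole_cluster_less[OF m, of r _ k] that by (intro sum_nonpos) (auto simp: divide_le_0_iff less_imp_le)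
    then show ?thesis using lo by (simp add: A_def)
  qed
qed

text \<open>
Two node polynomials with the same number of nodes on the same side of the poles have pole coefficients of equal
signs, whatever the nodes are. The lower bound at the first pole measures the growth when the configuration is
scaled by \<open>\<mu>\<close>.
\<close>
lemma pole_coefficient_products:
  fixes u \<mu> :: real and x x' :: "nat \<Rightarrow> real" and m k :: nat
  defines "b \<equiv> \<lambda>r. u - \<mu> * pole_cluster m k r"
  assumes m: "m \<ge> 1" and mu: "\<mu> \<noteq> 0" and r: "r < k"
    and J: "finite J" "card J = m - 1" "\<And>j. j \<in> J \<Longrightarrow> (x j - u) / \<mu> \<ge> 0"
    and J': "finite J'" "card J' = m - 1" "\<And>j. j \<in> J' \<Longrightarrow> (x' j - u) / \<mu> \<ge> 0"
    and a: "pf_numerator s k b a = node_poly x J" and a': "pf_numerator s k b a' = node_poly x' J'"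
  shows "a $ (s + 2 * r) * a' $ (s + 2 * r) \<ge> 0"
    and "a $ (s + 2 * r + 1) * a' $ (s + 2 * r + 1) \<ge> 0"
    and "r = 0 \<Longrightarrow> a $ (s + 2 * r + 1) * a' $ (s + 2 * r + 1) \<ge> \<mu> ^ (2 * (m - 1)) / \<mu> ^ (4 * (k - 1))"
proof -
  let ?g = "pole_cluster m k"
  have g1: "?g r \<ge> 1" by (rule pole_cluster_bounds(1)[OF m r])
  have gne: "?g p \<noteq> ?g q" if "p \<noteq> q" for p q
    using that pole_cluster_less[OF m, of p q k] pole_cluster_less[OF m, of q p k] by (metis less_irrefl linorder_neqE_nat)
  have inj: "inj_on b {..<k}"
    using gne mu by (auto simp: inj_on_def b_def)
  have diff: "b r - x j = - \<mu> * (?g r + (x j - u) / \<mu>)" for x :: "nat \<Rightarrow> real" and j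
    using mu by (simp add: b_def field_simps)
  have pos: "?g r + (x j - u) / \<mu> \<ge> 1" if "(x j - u) / \<mu> \<ge> 0" for x :: "nat \<Rightarrow> real" and j
    using g1 that by simp
  have ne: "b r \<noteq> x j" if "(x j - u) / \<mu> \<ge> 0" for x :: "nat \<Rightarrow> real" and j
    using diff[of x j] pos[of x j] that mu by auto
  have nex: "b r \<noteq> x j" if "j \<in> J" for j using ne[of x j] J(3)[OF that] .
  have nex': "b r \<noteq> x' j" if "j \<in> J'" for j using ne[of x' j] J'(3)[OF that] .
  define E where "E = (\<Prod>q\<in>{..<k} - {r}. (b r - b q) ^ 2)"
  define B where "B x J = (\<Sum>j\<in>J. 1 / (b r - x j)) - 2 * (\<Sum>q\<in>{..<k} - {r}. 1 / (b r - b q))" for x :: "nat \<Rightarrow> real" and J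
  have P: "(\<Prod>j\<in>J. b r - x j) = (- \<mu>) ^ (m - 1) * (\<Prod>j\<in>J. ?g r + (x j - u) / \<mu>)"
    if "card J = m - 1" for x :: "nat \<Rightarrow> real" and J
    unfolding diff prod.distrib using that by simp
  have P1: "(\<Prod>j\<in>J. ?g r + (x j - u) / \<mu>) \<ge> 1" if "\<And>j. j \<in> J \<Longrightarrow> (x j - u) / \<mu> \<ge> 0" for x :: "nat \<Rightarrow> real" and J
  proof (rule prod_ge_1)
    show "?g r + (x j - u) / \<mu> \<ge> 1" if "j \<in> J" for j using pos[of x j] \<open>\<And>j. j \<in> J \<Longrightarrow> (x j - u) / \<mu> \<ge> 0\<close>[OF that] .
  qed
  have E0: "E > 0" unfolding E_def
    using gne mu by (intro prod_pos) (auto simp: b_def)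
  have odd: "a $ (s + 2 * r + 1) = (- \<mu>) ^ (m - 1) * (\<Prod>j\<in>J. ?g r + (x j - u) / \<mu>) / E"
    using pole_coefficients_of_node_poly(1)[OF inj r J(1) nex a] unfolding P[OF J(2)] E_def by simp
  have odd': "a' $ (s + 2 * r + 1) = (- \<mu>) ^ (m - 1) * (\<Prod>j\<in>J'. ?g r + (x' j - u) / \<mu>) / E"
    using pole_coefficients_of_node_poly(1)[OF inj r J'(1) nex' a'] unfolding P[OF J'(2)] E_def by simp
  have sq: "(- \<mu>) ^ (m - 1) * (- \<mu>) ^ (m - 1) = \<mu> ^ (2 * (m - 1))"
    by (simp add: power_mult power2_eq_square flip: power_mult_distrib)
  let ?p = "\<Prod>j\<in>J. ?g r + (x j - u) / \<mu>" let ?p' = "\<Prod>j\<in>J'. ?g r + (x' j - u) / \<mu>"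
  have prod: "a $ (s + 2 * r + 1) * a' $ (s + 2 * r + 1) = \<mu> ^ (2 * (m - 1)) * (?p * ?p') / (E * E)"
    unfolding odd odd' sq[symmetric] by simp
  have "?p \<ge> 1" by (rule P1) (rule J(3))
  moreover have "?p' \<ge> 1" by (rule P1) (rule J'(3))
  ultimately have pp: "?p * ?p' \<ge> 1 * 1" by (intro mult_mono) auto
  have mu2: "\<mu> ^ (2 * (m - 1)) \<ge> 0" by (simp add: power_mult)
  show oo: "a $ (s + 2 * r + 1) * a' $ (s + 2 * r + 1) \<ge> 0"
  proof -
    have "?p * ?p' \<ge> 0" using pp by linarith
    then show ?thesis unfolding prod using E0 by (intro divide_nonneg_pos mult_nonneg_nonneg[OF mu2]) auto
  qed
  have br: "B x J = (1 / \<mu>) * (2 * (\<Sum>q\<in>{..<k} - {r}. 1 / (?g r - ?g q)) - (\<Sum>j\<in>J. 1 / (?g r + (x j - u) / \<mu>)))"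
    for x :: "nat \<Rightarrow> real" and J
  proof -
    have 1: "(\<Sum>j\<in>J. 1 / (b r - x j)) = (\<Sum>j\<in>J. - (1 / \<mu>) * (1 / (?g r + (x j - u) / \<mu>)))"
      unfolding diff by (intro sum.cong refl) (simp add: divide_minus_left)
    have 2: "(\<Sum>q\<in>{..<k} - {r}. 1 / (b r - b q)) = (\<Sum>q\<in>{..<k} - {r}. - (1 / \<mu>) * (1 / (?g r - ?g q)))"
    proof (intro sum.cong refl)
      fix q
      have "b r - b q = - (\<mu> * (?g r - ?g q))" by (simp add: b_def algebra_simps)
      then show "1 / (b r - b q) = - (1 / \<mu>) * (1 / (?g r - ?g q))" by (simp add: divide_minus_right)
    qed
    show ?thesis unfolding B_def 1 2 sum_distrib_left[symmetric] by (simp add: algebra_simps)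
  qed
  have BB: "B x J * B x' J' \<ge> 0"
  proof -
    let ?A = "\<lambda>x J. 2 * (\<Sum>q\<in>{..<k} - {r}. 1 / (?g r - ?g q)) - (\<Sum>j\<in>J. 1 / (?g r + (x j - u) / \<mu>))"
    have "?A x J * ?A x' J' \<ge> 0"
    proof (cases "r = 0")
      case True
      have "?A x J \<le> 0" "?A x' J' \<le> 0"
        using pole_cluster_bracket_sign(1)[OF m r J(1), of "\<lambda>j. (x j - u) / \<mu>"]
          pole_cluster_bracket_sign(1)[OF m r J'(1), of "\<lambda>j. (x' j - u) / \<mu>"] J J' True by auto
      then show ?thesis by (rule mult_nonpos_nonpos)
    next
      case False
      have "?A x J \<ge> 0" "?A x' J' \<ge> 0"
        using pole_cluster_bracket_sign(2)[OF m r J(1), of "\<lambda>j. (x j - u) / \<mu>"]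
          pole_cluster_bracket_sign(2)[OF m r J'(1), of "\<lambda>j. (x' j - u) / \<mu>"] J J' False by auto
      then show ?thesis by (rule mult_nonneg_nonneg)
    qed
    moreover have "B x J * B x' J' = (1 / \<mu>)\<^sup>2 * (?A x J * ?A x' J')"
      unfolding br by (simp add: power2_eq_square)
    ultimately show ?thesis by simp
  qed
  have "a $ (s + 2 * r) = a $ (s + 2 * r + 1) * B x J"
    unfolding B_def by (rule pole_coefficients_of_node_poly(2)[OF inj r J(1) nex a])
  moreover have "a' $ (s + 2 * r) = a' $ (s + 2 * r + 1) * B x' J'"
    unfolding B_def by (rule pole_coefficients_of_node_poly(2)[OF inj r J'(1) nex' a'])
  ultimately have "a $ (s + 2 * r) * a' $ (s + 2 * r) = (a $ (s + 2 * r + 1) * a' $ (s + 2 * r + 1)) * (B x J * B x' J')"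
    by simp
  then show "a $ (s + 2 * r) * a' $ (s + 2 * r) \<ge> 0" using oo BB by simp
  assume r0: "r = 0"
  have "E \<le> (\<Prod>q\<in>{..<k} - {r}. \<mu> ^ 2)" unfolding E_def
  proof (intro prod_mono conjI)
    fix q assume q: "q \<in> {..<k} - {r}"
    have "\<bar>?g q - ?g r\<bar> \<le> 1"
      using pole_cluster_bounds[OF m, of q k] pole_cluster_bounds[OF m r] q by auto
    then have "(?g q - ?g r)\<^sup>2 \<le> 1" by (simp add: abs_square_le_1)
    then have "\<mu> ^ 2 * (?g q - ?g r)\<^sup>2 \<le> \<mu> ^ 2 * 1" by (intro mult_left_mono) auto
    moreover have "(b r - b q)\<^sup>2 = \<mu> ^ 2 * (?g q - ?g r)\<^sup>2" by (simp add: b_def algebra_simps flip: power_mult_distrib)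
    ultimately show "(b r - b q)\<^sup>2 \<le> \<mu>\<^sup>2" by simp
  qed auto
  also have "\<dots> = \<mu> ^ (2 * (k - 1))" using r by (simp add: power_mult)
  finally have "E * E \<le> \<mu> ^ (2 * (k - 1)) * \<mu> ^ (2 * (k - 1))" using E0 by (intro mult_mono) auto
  also have "\<dots> = \<mu> ^ (4 * (k - 1))" by (simp flip: power_add)
  finally have EE: "E * E \<le> \<mu> ^ (4 * (k - 1))" .
  have "\<mu> ^ (4 * (k - 1)) > 0" using mu by (simp add: zero_less_power_eq)
  then have "\<mu> ^ (2 * (m - 1)) / \<mu> ^ (4 * (k - 1)) \<le> \<mu> ^ (2 * (m - 1)) / (E * E)"
    using EE E0 mu2 by (intro divide_left_mono mult_pos_pos) auto
  also have "\<dots> \<le> \<mu> ^ (2 * (m - 1)) * (?p * ?p') / (E * E)"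
  proof (rule divide_right_mono)
    show "\<mu> ^ (2 * (m - 1)) \<le> \<mu> ^ (2 * (m - 1)) * (?p * ?p')"
      using mult_left_mono[OF pp mu2] by simp
  qed (use E0 in simp)
  finally show "a $ (s + 2 * r + 1) * a' $ (s + 2 * r + 1) \<ge> \<mu> ^ (2 * (m - 1)) / \<mu> ^ (4 * (k - 1))"
    unfolding prod .
qed

section \<open>Dominance of the poles and nonemptiness\<close>

text \<open>
The value at \<open>R\<close> of the coefficientwise majorant; it bounds the polynomial on the disc of radius \<open>R\<close>, and the
weights \<open>R ^ i\<close> make it shrink by a factor \<open>R\<close>, up to the degree, when a root in this disc is divided out.
\<close>
definition weighted_norm :: "real \<Rightarrow> real poly \<Rightarrow> real" where
  "weighted_norm R p = poly (map_poly abs p) R"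

lemma weighted_norm_pCons: "weighted_norm R (pCons a p) = \<bar>a\<bar> + R * weighted_norm R p"
  by (cases "p = 0 \<and> a = 0") (auto simp: weighted_norm_def map_poly_pCons)

lemma weighted_norm_0: "weighted_norm R 0 = 0"
  by (simp add: weighted_norm_def)

lemma weighted_norm_nonneg: "R \<ge> 0 \<Longrightarrow> weighted_norm R p \<ge> 0"
  by (induction p) (auto simp: weighted_norm_0 weighted_norm_pCons)

lemma weighted_norm_add: "R \<ge> 0 \<Longrightarrow> weighted_norm R (p + q) \<le> weighted_norm R p + weighted_norm R q"
proof (induction p q rule: poly_induct2)
  case (pCons a p b q)
  then have "R * weighted_norm R (p + q) \<le> R * (weighted_norm R p + weighted_norm R q)"
    by (intro mult_left_mono) auto
  then show ?case
    using abs_triangle_ineq[of a b] by (simp add: weighted_norm_pCons distrib_left)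
qed (simp add: weighted_norm_0)

lemma weighted_norm_smult: "weighted_norm R (Polynomial.smult c p) = \<bar>c\<bar> * weighted_norm R p"
  by (induction p) (simp_all add: weighted_norm_0 weighted_norm_pCons abs_mult algebra_simps)

lemma weighted_norm_node_poly:
  assumes "finite J" "R \<ge> 0" "\<And>j. j \<in> J \<Longrightarrow> \<bar>x j\<bar> \<le> C"
  shows "weighted_norm R (node_poly x J) \<le> (R + C) ^ card J"
  using assms
proof (induction J)
  case empty
  then show ?case by (simp add: node_poly_def one_pCons weighted_norm_pCons weighted_norm_0)
next
  case (insert j J)
  let ?p = "node_poly x J"
  have C: "C \<ge> 0" using abs_ge_zero[of "x j"] insert.prems(2)[of j] by simp
  have "node_poly x (insert j J) = Polynomial.smult (- x j) ?p + pCons 0 ?p"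
    using insert by (simp add: node_poly_def)
  then have "weighted_norm R (node_poly x (insert j J)) \<le> \<bar>x j\<bar> * weighted_norm R ?p + R * weighted_norm R ?p"
    using weighted_norm_add[OF insert.prems(1), of "Polynomial.smult (- x j) ?p" "pCons 0 ?p"]
    by (simp add: weighted_norm_smult weighted_norm_pCons del: smult_minus_left)
  also have "\<dots> = (R + \<bar>x j\<bar>) * weighted_norm R ?p" by (simp add: algebra_simps)
  also have "\<dots> \<le> (R + C) * (R + C) ^ card J"
    using insert weighted_norm_nonneg[OF insert.prems(1), of ?p] insert.prems(2)[of j] C
    by (intro mult_mono) auto
  finally show ?case using insert by simp
qed

lemma abs_poly_le_weighted_norm:
  assumes "\<bar>c\<bar> \<le> R" shows "\<bar>poly p c\<bar> \<le> weighted_norm R p"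
proof (induction p)
  case (pCons a p)
  have "\<bar>c * poly p c\<bar> \<le> R * weighted_norm R p"
    unfolding abs_mult using pCons assms by (intro mult_mono) auto
  then show ?case using abs_triangle_ineq[of a "c * poly p c"] by (simp add: weighted_norm_pCons)
qed (simp add: weighted_norm_0)

text \<open>
Division by a monic linear factor whose root lies in the disc of radius \<open>R\<close> gains a factor \<open>R\<close> at the expense of
the degree. This is the reason for the weights: the bound is of the right order for distant roots.
\<close>
lemma weighted_norm_synthetic_div:
  assumes "\<bar>c\<bar> \<le> R"
  shows "R * weighted_norm R (synthetic_div p c) \<le> real (degree p) * weighted_norm R p"
proof (induction p)
  case (pCons a p)
  have R: "R \<ge> 0" using assms by linarith
  show ?case
  proof (cases "p = 0")
    case False
    have "weighted_norm R (synthetic_div (pCons a p) c) = \<bar>poly p c\<bar> + R * weighted_norm R (synthetic_div p c)"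
      by (simp add: weighted_norm_pCons)
    also have "\<dots> \<le> weighted_norm R p + real (degree p) * weighted_norm R p"
      using pCons abs_poly_le_weighted_norm[OF assms, of p] by simp
    also have "\<dots> = real (degree (pCons a p)) * weighted_norm R p"
      using False by (simp add: algebra_simps)
    finally have "R * weighted_norm R (synthetic_div (pCons a p) c) \<le> R * (real (degree (pCons a p)) * weighted_norm R p)"
      using R by (rule mult_left_mono)
    also have "\<dots> \<le> real (degree (pCons a p)) * weighted_norm R (pCons a p)"
      by (simp add: weighted_norm_pCons algebra_simps)
    finally show ?thesis .
  qed (simp add: weighted_norm_0 weighted_norm_pCons)
qed (simp add: weighted_norm_0)

lemma div_linear_eq_synthetic_div:
  fixes c :: "'a :: field"
  shows "p div [:- c, 1:] = synthetic_div p c"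
proof -
  have "p div [:- c, 1:] = ([:- c, 1:] * synthetic_div p c + [:poly p c:]) div [:- c, 1:]"
    by (simp only: synthetic_div_correct')
  also have "\<dots> = synthetic_div p c + [:poly p c:] div [:- c, 1:]"
    unfolding poly_div_add_left by (subst nonzero_mult_div_cancel_left) simp_all
  also have "[:poly p c:] div [:- c, 1:] = 0" by (intro div_poly_less) simp
  finally show ?thesis by simp
qed

lemma weighted_norm_div_node_poly:
  assumes R: "R > 0" and b: "\<And>r. r < k \<Longrightarrow> \<bar>b r\<bar> \<le> R" and n: "degree p \<le> n"
  shows "degree (p div node_poly b {..<k}) \<le> n \<and>
    R ^ k * weighted_norm R (p div node_poly b {..<k}) \<le> real n ^ k * weighted_norm R p"
  using b
proof (induction k)
  case 0
  then show ?case using n by (simp add: node_poly_def)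
next
  case (Suc k)
  let ?q = "p div node_poly b {..<k}"
  have IH: "degree ?q \<le> n" "R ^ k * weighted_norm R ?q \<le> real n ^ k * weighted_norm R p"
    using Suc by auto
  have q: "p div node_poly b {..<Suc k} = synthetic_div ?q (b k)"
    by (simp only: node_poly_def prod.lessThan_Suc poly_div_mult_right div_linear_eq_synthetic_div)
  have "R * weighted_norm R (synthetic_div ?q (b k)) \<le> real (degree ?q) * weighted_norm R ?q"
    using Suc.prems[of k] by (intro weighted_norm_synthetic_div) auto
  also have "\<dots> \<le> real n * weighted_norm R ?q"
    using IH(1) R by (intro mult_right_mono weighted_norm_nonneg) auto
  finally have "R ^ k * (R * weighted_norm R (synthetic_div ?q (b k))) \<le> R ^ k * (real n * weighted_norm R ?q)"
    using R by (intro mult_left_mono) auto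
  also have "\<dots> = real n * (R ^ k * weighted_norm R ?q)" by simp
  also have "\<dots> \<le> real n * (real n ^ k * weighted_norm R p)" using IH(2) by (intro mult_left_mono) auto
  finally show ?case
    unfolding q using IH(1) by (simp add: degree_synthetic_div mult_ac)
qed

lemma abs_coeff_le_weighted_norm:
  assumes "R \<ge> 1" shows "\<bar>poly.coeff p i\<bar> \<le> weighted_norm R p"
proof (induction p arbitrary: i)
  case (pCons a p)
  have nn: "weighted_norm R p \<ge> 0" using assms by (intro weighted_norm_nonneg) simp
  have le: "1 * weighted_norm R p \<le> R * weighted_norm R p" using assms nn by (rule mult_right_mono)
  have "\<bar>poly.coeff p j\<bar> \<le> \<bar>a\<bar> + R * weighted_norm R p" for j
    using pCons.IH[of j] le by linarith
  moreover have "\<bar>a\<bar> \<le> \<bar>a\<bar> + R * weighted_norm R p" using le nn by linarith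
  ultimately show ?case by (cases i) (simp_all add: weighted_norm_pCons)
qed (simp add: weighted_norm_0)

lemma pf_numerator_div_denom_poly:
  "pf_numerator s k b a div denom_poly {..<k} b = (\<Sum>i<s. Polynomial.monom (a $ i) i)"
proof -
  let ?D = "denom_poly {..<k} b"
  let ?T = "\<Sum>r<k. [:a $ (s + 2 * r + 1) - a $ (s + 2 * r) * b r, a $ (s + 2 * r):] * denom_poly ({..<k} - {r}) b"
  have "?T div ?D = 0"
  proof (cases "k = 0")
    case False
    have "degree ?T \<le> 2 * k - 1"
    proof (intro degree_sum_le)
      fix r assume "r \<in> {..<k}"
      then have "degree (denom_poly ({..<k} - {r}) b) = 2 * (k - 1)"
        by (simp add: degree_denom_poly)
      moreover have "degree [:a $ (s + 2 * r + 1) - a $ (s + 2 * r) * b r, a $ (s + 2 * r):] \<le> 1" by simp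
      ultimately show "degree ([:a $ (s + 2 * r + 1) - a $ (s + 2 * r) * b r, a $ (s + 2 * r):] *
          denom_poly ({..<k} - {r}) b) \<le> 2 * k - 1"
        using degree_mult_le[of "[:a $ (s + 2 * r + 1) - a $ (s + 2 * r) * b r, a $ (s + 2 * r):]"
            "denom_poly ({..<k} - {r}) b"] False by linarith
    qed simp
    then show ?thesis using False by (intro div_poly_less) (simp add: degree_denom_poly)
  qed simp
  then show ?thesis
    unfolding pf_numerator_def poly_div_add_left using denom_poly_nonzero[of "{..<k}" b] by simp
qed

text \<open>
The polynomial part of the partial fraction decomposition is the quotient by the denominator, hence the result
of \<open>2 k\<close> divisions by linear factors.
\<close>
lemma polynomial_coefficient_bound:
  assumes a: "pf_numerator s k b a = node_poly x J" and i: "i < s"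
    and J: "finite J" "card J \<le> n" "\<And>j. j \<in> J \<Longrightarrow> \<bar>x j\<bar> \<le> R"
    and R: "R \<ge> 1" and b: "\<And>r. r < k \<Longrightarrow> \<bar>b r\<bar> \<le> R"
  shows "R ^ (2 * k) * \<bar>a $ i\<bar> \<le> real n ^ (2 * k) * (2 * R) ^ card J"
proof -
  let ?S = "\<Sum>i<s. Polynomial.monom (a $ i) i" let ?P = "node_poly b {..<k}" let ?N = "node_poly x J"
  have c: "poly.coeff ?S i = a $ i" using i by (simp add: coeff_sum)
  have S: "?S = ?N div ?P div ?P"
    unfolding pf_numerator_div_denom_poly[of s k b a, symmetric] a denom_poly_eq_node_poly poly_div_mult_right ..
  have sq: "z ^ (2 * k) = z ^ k * z ^ k" for z :: real by (simp only: mult_2 power_add)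
  have R0: "R > 0" using R by simp
  have N: "degree ?N \<le> n" using J(2) by (simp add: degree_node_poly)
  have d1: "degree (?N div ?P) \<le> n" "R ^ k * weighted_norm R (?N div ?P) \<le> real n ^ k * weighted_norm R ?N"
    using weighted_norm_div_node_poly[where b = b and k = k, OF R0 b N] by auto
  have d2: "R ^ k * weighted_norm R (?N div ?P div ?P) \<le> real n ^ k * weighted_norm R (?N div ?P)"
    using weighted_norm_div_node_poly[where b = b and k = k, OF R0 b d1(1)] by auto
  have "R ^ (2 * k) * \<bar>a $ i\<bar> \<le> R ^ (2 * k) * weighted_norm R ?S"
    using abs_coeff_le_weighted_norm[OF R, of ?S i] R0 unfolding c by (intro mult_left_mono) auto
  also have "\<dots> = R ^ k * (R ^ k * weighted_norm R (?N div ?P div ?P))"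
    by (simp only: S sq mult.assoc)
  also have "\<dots> \<le> R ^ k * (real n ^ k * weighted_norm R (?N div ?P))"
    using d2 R0 by (intro mult_left_mono) auto
  also have "\<dots> = real n ^ k * (R ^ k * weighted_norm R (?N div ?P))" by simp
  also have "\<dots> \<le> real n ^ k * (real n ^ k * weighted_norm R ?N)"
    using d1(2) by (intro mult_left_mono) auto
  also have "\<dots> = real n ^ (2 * k) * weighted_norm R ?N" by (simp only: sq mult.assoc)
  also have "\<dots> \<le> real n ^ (2 * k) * (R + R) ^ card J"
    using J R0 by (intro mult_left_mono weighted_norm_node_poly) auto
  also have "R + R = 2 * R" by simp
  finally show ?thesis .
qed

text \<open>
For \<open>s = 0\<close> there is nothing but pole coefficients. In general the polynomial coefficients of node polynomials are
of order \<open>\<mu> ^ (s - 1)\<close>, whereas the one at the first pole has modulus at least \<open>\<mu> ^ (s + 1)\<close>; hence the inner product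
is dominated by the nonnegative contribution of the poles as soon as \<open>\<mu>\<close> exceeds a constant.
\<close>
lemma cluster_gram_nonneg:
  fixes u \<mu> :: real and x x' :: "nat \<Rightarrow> real" and s k m :: nat
  defines "b \<equiv> \<lambda>r. u - \<mu> * pole_cluster m k r" and "m \<equiv> s + 2 * k"
  assumes k: "k \<ge> 1" and mu: "\<mu> \<noteq> 0"
    and far: "s = 0 \<or> \<mu> \<ge> 1 \<and> real s * (real m ^ (2 * k) * 6 ^ m)\<^sup>2 \<le> \<mu> \<and> \<bar>u\<bar> \<le> \<mu> \<and>
        (\<forall>j\<in>J. \<bar>x j\<bar> \<le> \<mu>) \<and> (\<forall>j\<in>J'. \<bar>x' j\<bar> \<le> \<mu>)"
    and J: "finite J" "card J = m - 1" "\<And>j. j \<in> J \<Longrightarrow> (x j - u) / \<mu> \<ge> 0"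
    and J': "finite J'" "card J' = m - 1" "\<And>j. j \<in> J' \<Longrightarrow> (x' j - u) / \<mu> \<ge> 0"
    and a: "pf_numerator s k b a = node_poly x J" and a': "pf_numerator s k b a' = node_poly x' J'"
    and c': "a' \<in> carrier_vec m"
  shows "a \<bullet> a' \<ge> 0"
proof -
  have m1: "m \<ge> 1" using k by (simp add: m_def)
  note pole = pole_coefficient_products[OF m1 mu _ J J' a[unfolded b_def] a'[unfolded b_def]]
  let ?t = "\<lambda>r. a $ (s + 2 * r) * a' $ (s + 2 * r) + a $ (s + 2 * r + 1) * a' $ (s + 2 * r + 1)"
  have t: "?t r \<ge> 0" if "r < k" for r
    using pole(1)[OF that] pole(2)[OF that] by simp
  have split: "a \<bullet> a' = (\<Sum>i<s. a $ i * a' $ i) + (\<Sum>r<k. ?t r)"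
    unfolding scalar_prod_lessThan[OF c'] unfolding m_def by (rule sum_split_poles)
  show ?thesis
  proof (cases "s = 0")
    case True
    then have "(\<Sum>i<s. a $ i * a' $ i) = 0" by simp
    moreover have "(\<Sum>r<k. ?t r) \<ge> 0" by (intro sum_nonneg t) simp
    ultimately show ?thesis unfolding split by linarith
  next
    case False
    then have m_ge: "\<mu> \<ge> 1" and big: "real s * (real m ^ (2 * k) * 6 ^ m)\<^sup>2 \<le> \<mu>" and u: "\<bar>u\<bar> \<le> \<mu>"
      and x: "\<And>j. j \<in> J \<Longrightarrow> \<bar>x j\<bar> \<le> \<mu>" and x': "\<And>j. j \<in> J' \<Longrightarrow> \<bar>x' j\<bar> \<le> \<mu>"
      using far by auto
    \<comment> \<open>All poles and nodes lie within \<open>3 \<mu>\<close> of the origin; the norm of a node polynomial is then at most a power of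
      \<open>2 (3 \<mu>)\<close>, which accounts for the powers of six.\<close>
    let ?R = "3 * \<mu>" define K where "K = real m ^ (2 * k) * 6 ^ m"
    have R1: "?R \<ge> 1" using m_ge by simp
    have bR: "\<bar>b r\<bar> \<le> ?R" if "r < k" for r
    proof -
      have "\<mu> * 1 \<le> \<mu> * pole_cluster m k r" "\<mu> * pole_cluster m k r \<le> \<mu> * 2"
        using pole_cluster_bounds[OF m1 that] m_ge by (auto intro!: mult_left_mono)
      then show ?thesis unfolding b_def using u m_ge by linarith
    qed
    have bound: "\<bar>a $ i\<bar> \<le> K * \<mu> ^ (s - 1)"
      if "pf_numerator s k b a = node_poly x J" "finite J" "card J = m - 1" "\<And>j. j \<in> J \<Longrightarrow> \<bar>x j\<bar> \<le> \<mu>" "i < s"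
      for a x J i
    proof -
      have "?R ^ (2 * k) * \<bar>a $ i\<bar> \<le> real m ^ (2 * k) * (2 * ?R) ^ card J"
      proof (rule polynomial_coefficient_bound[OF that(1,5,2) _ _ R1 bR])
        show "card J \<le> m" using that(3) by simp
        show "\<bar>x j\<bar> \<le> ?R" if "j \<in> J" for j using \<open>\<And>j. j \<in> J \<Longrightarrow> \<bar>x j\<bar> \<le> \<mu>\<close>[OF that] m_ge by linarith
      qed
      also have "card J = (s - 1) + 2 * k" using that(3) False by (simp add: m_def)
      also have "(2 * ?R) ^ ((s - 1) + 2 * k) = ?R ^ (2 * k) * (2 ^ (2 * k) * 6 ^ (s - 1) * \<mu> ^ (s - 1))"
        by (simp add: power_add power_mult_distrib flip: mult.assoc) (simp add: power_mult_distrib[symmetric] mult_ac)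
      finally have "?R ^ (2 * k) * \<bar>a $ i\<bar> \<le> ?R ^ (2 * k) * (real m ^ (2 * k) * (2 ^ (2 * k) * 6 ^ (s - 1)) * \<mu> ^ (s - 1))"
        by (simp add: mult_ac)
      then have "\<bar>a $ i\<bar> \<le> real m ^ (2 * k) * (2 ^ (2 * k) * 6 ^ (s - 1)) * \<mu> ^ (s - 1)"
        using m_ge by (subst (asm) mult_le_cancel_left_pos) auto
      also have "\<dots> \<le> K * \<mu> ^ (s - 1)"
      proof -
        have "(2 :: real) ^ (2 * k) * 6 ^ (s - 1) \<le> 6 ^ (2 * k) * 6 ^ s"
          by (intro mult_mono power_mono power_increasing) auto
        also have "\<dots> = 6 ^ m" by (simp add: m_def add.commute flip: power_add)
        finally show ?thesis
          unfolding K_def using m_ge by (intro mult_right_mono mult_left_mono) auto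
      qed
      finally show ?thesis .
    qed
    have "- (\<mu> ^ (2 * s + 2)) \<le> (\<Sum>i<s. a $ i * a' $ i)"
    proof -
      have "\<bar>a $ i * a' $ i\<bar> \<le> K\<^sup>2 * \<mu> ^ (2 * (s - 1))" if "i < s" for i
      proof -
        have "\<bar>a $ i * a' $ i\<bar> \<le> (K * \<mu> ^ (s - 1)) * (K * \<mu> ^ (s - 1))"
          unfolding abs_mult
          using bound[OF a J(1,2) x that] bound[OF a' J'(1,2) x' that] m_ge
          by (intro mult_mono) (auto simp: K_def)
        also have "\<dots> = K\<^sup>2 * \<mu> ^ (2 * (s - 1))"
        proof -
          have "\<mu> ^ (2 * (s - 1)) = \<mu> ^ (s - 1) * \<mu> ^ (s - 1)" by (simp only: mult_2 power_add)
          then show ?thesis by (simp only: power2_eq_square mult_ac)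
        qed
        finally show ?thesis .
      qed
      then have "\<bar>\<Sum>i<s. a $ i * a' $ i\<bar> \<le> (\<Sum>i<s. K\<^sup>2 * \<mu> ^ (2 * (s - 1)))"
        by (intro order.trans[OF sum_abs] sum_mono) auto
      also have "\<dots> = (real s * K\<^sup>2) * \<mu> ^ (2 * (s - 1))" by simp
      also have "\<dots> \<le> \<mu> ^ 4 * \<mu> ^ (2 * (s - 1))"
      proof (intro mult_right_mono)
        have "real s * K\<^sup>2 \<le> \<mu> ^ 1" using big by (simp add: K_def)
        also have "\<dots> \<le> \<mu> ^ 4" using m_ge by (intro power_increasing) auto
        finally show "real s * K\<^sup>2 \<le> \<mu> ^ 4" .
      qed (use m_ge in simp)
      also have "\<dots> = \<mu> ^ (2 * s + 2)"
      proof -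
        have "4 + 2 * (s - 1) = 2 * s + 2" using False by simp
        then show ?thesis by (simp only: power_add[symmetric])
      qed
      finally show ?thesis by linarith
    qed
    moreover have "\<mu> ^ (2 * s + 2) \<le> (\<Sum>r<k. ?t r)"
    proof -
      have "2 * (m - 1) = (2 * s + 2) + 4 * (k - 1)" using k by (simp add: m_def)
      then have "\<mu> ^ (2 * s + 2) = \<mu> ^ (2 * (m - 1)) / \<mu> ^ (4 * (k - 1))"
        using mu by (simp add: power_add)
      also have "\<dots> \<le> a $ (s + 2 * 0 + 1) * a' $ (s + 2 * 0 + 1)" using k by (intro pole(3)) auto
      also have "\<dots> \<le> ?t 0" using pole(1)[of 0] k by simp
      also have "\<dots> \<le> (\<Sum>r<k. ?t r)" using k t by (intro member_le_sum) auto
      finally show ?thesis .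
    qed
    ultimately show ?thesis unfolding split by linarith
  qed
qed

text \<open>
The Lagrange function of the node \<open>x $ i\<close> has the node polynomial of the other nodes as its numerator, up to
a factor whose sign alternates with \<open>i\<close>.
\<close>
lemma lagrange_vector_scaled_node_vector:
  assumes b: "b \<in> param_space I k" and x: "increasing_points I (s + 2 * k) x" and i: "i < s + 2 * k"
    and v: "v \<in> carrier_vec (s + 2 * k)"
    and vd: "\<And>j. j < s + 2 * k \<Longrightarrow> v \<bullet> rational_regression s k b (x $ j) = (if i = j then 1 else 0)"
  obtains C a where "a \<in> carrier_vec (s + 2 * k)" "v = C \<cdot>\<^sub>v a" "(-1) ^ (s + 2 * k - 1 - i) * C \<ge> 0"
    "pf_numerator s k (($) b) a = node_poly (\<lambda>j. x $ j) ({..<s + 2 * k} - {i})"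
proof -
  let ?m = "s + 2 * k" let ?b = "\<lambda>r. b $ r" let ?x = "\<lambda>j. x $ j"
  let ?P = "node_poly ?x ({..<?m} - {i})" let ?D = "poly (denom_poly {..<k} ?b)"
  have binj: "inj_on ?b {..<k}" by (rule param_spaceD(1)[OF b])
  have degP: "degree ?P < ?m" using i by (simp add: degree_node_poly)
  obtain a where a: "a \<in> carrier_vec ?m" "pf_numerator s k ?b a = ?P" by (rule pf_numerator_surj[OF binj degP])
  define W where "W = (\<Prod>j\<in>{..<?m} - {i}. x $ i - x $ j)"
  define C where "C = ?D (x $ i) / W"
  have mono: "strict_mono_on {..<?m} ?x" using x by (auto simp: increasing_points_def strict_mono_on_def)
  have sg: "(-1) ^ (?m - 1 - i) * W > 0" unfolding W_def by (rule node_product_sign[OF mono i])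
  have D: "?D t > 0" if "t \<in> I" for t
    using param_spaceD(2)[OF b _ that] unfolding poly_denom_poly by (intro prod_pos) force
  have xI: "x $ j \<in> I" if "j < ?m" for j using x that by (auto simp: increasing_points_def)
  have vx: "poly (pf_numerator s k ?b v) (x $ j) = (if i = j then ?D (x $ i) else 0)" if j: "j < ?m" for j
    using scalar_prod_rational_regression[of k "x $ j" b v s] param_spaceD(2)[OF b _ xI[OF j]] D[OF xI[OF j]] vd[OF j]
    by (auto split: if_splits)
  have Px: "poly ?P (x $ j) = (if i = j then W else 0)" if j: "j < ?m" for j
    using j by (auto simp: poly_node_poly W_def)
  have "pf_numerator s k ?b v - pf_numerator s k ?b (C \<cdot>\<^sub>v a) = 0"
  proof (rule poly_eq_0_if_many_zeros)
    show "degree (pf_numerator s k ?b v - pf_numerator s k ?b (C \<cdot>\<^sub>v a)) < ?m"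
      using i by (intro degree_diff_less degree_pf_numerator) auto
    show "inj_on ?x {..<?m}" by (rule increasing_points_inj[OF x])
    show "poly (pf_numerator s k ?b v - pf_numerator s k ?b (C \<cdot>\<^sub>v a)) (x $ j) = 0" if "j < ?m" for j
      using vx[OF that] Px[OF that] sg by (auto simp: pf_numerator_smult[OF a(1)] a(2) C_def)
  qed
  moreover have "pf_numerator s k ?b (v - C \<cdot>\<^sub>v a) = pf_numerator s k ?b v - pf_numerator s k ?b (C \<cdot>\<^sub>v a)"
    by (rule pf_numerator_diff) (use v a(1) in auto)
  ultimately have "v - C \<cdot>\<^sub>v a = 0\<^sub>v ?m"
    using v a(1) by (intro pf_numerator_eq_0_imp[OF binj]) auto
  have "v = C \<cdot>\<^sub>v a"
  proof (rule eq_vecI)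
    fix j assume "j < dim_vec (C \<cdot>\<^sub>v a)"
    then have "j < ?m" using a(1) by simp
    then show "v $ j = (C \<cdot>\<^sub>v a) $ j"
      using arg_cong[OF \<open>v - C \<cdot>\<^sub>v a = 0\<^sub>v ?m\<close>, of "\<lambda>w. w $ j"] v a(1) by simp
  qed (use v a(1) in simp)
  moreover have "(-1) ^ (?m - 1 - i) * C \<ge> 0"
    using sg D[OF xI[OF i]] by (cases "even (?m - 1 - i)") (auto simp: C_def divide_le_0_iff zero_le_divide_iff)
  ultimately show ?thesis using a that by blast
qed

lemma Omega_E_if_gram:
  assumes k: "k \<ge> 1" and I: "convex I" and b: "b \<in> param_space I k"
    and eq: "equioscillates I (s + 2 * k) k (($) b) N X"
    and gram: "\<And>x J J' a a'. (\<And>j. j \<in> J \<union> J' \<Longrightarrow> x j \<in> I) \<Longrightarrow> finite J \<Longrightarrow> card J = s + 2 * k - 1 \<Longrightarrow>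
      finite J' \<Longrightarrow> card J' = s + 2 * k - 1 \<Longrightarrow> a \<in> carrier_vec (s + 2 * k) \<Longrightarrow> a' \<in> carrier_vec (s + 2 * k) \<Longrightarrow>
      pf_numerator s k (($) b) a = node_poly x J \<Longrightarrow> pf_numerator s k (($) b) a' = node_poly x J' \<Longrightarrow> a \<bullet> a' \<ge> 0"
  shows "b \<in> Omega_E I s k"
proof -
  let ?m = "s + 2 * k" let ?f = "rational_regression s k b"
  obtain c x where cx: "chebyshev_polynomial_points I ?m ?f c x"
    by (rule chebyshev_points_of_equioscillation[OF I b eq])
  have x: "increasing_points I ?m x" using cx by (simp add: chebyshev_polynomial_points_def)
  have m: "?m > 0" using k by simp
  have "\<exists>\<xi>. has_masses_at \<xi> ?m (chebyshev_weights ?m ?f c x) x \<and> E_optimal I ?m ?f \<xi>"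
  proof (rule E_optimal_chebyshev_design[OF cx m rational_regression_carrier])
    fix i l u v
    assume il: "i < ?m" "l < ?m" and uv: "u \<in> carrier_vec ?m" "v \<in> carrier_vec ?m"
      and ud: "\<And>j. j < ?m \<Longrightarrow> u \<bullet> ?f (x $ j) = (if i = j then 1 else 0)"
      and vd: "\<And>j. j < ?m \<Longrightarrow> v \<bullet> ?f (x $ j) = (if l = j then 1 else 0)"
    obtain C a where a: "a \<in> carrier_vec ?m" "u = C \<cdot>\<^sub>v a" "(-1) ^ (?m - 1 - i) * C \<ge> 0"
      "pf_numerator s k (($) b) a = node_poly (\<lambda>j. x $ j) ({..<?m} - {i})"
      by (rule lagrange_vector_scaled_node_vector[OF b x il(1) uv(1) ud])
    obtain C' a' where a': "a' \<in> carrier_vec ?m" "v = C' \<cdot>\<^sub>v a'" "(-1) ^ (?m - 1 - l) * C' \<ge> 0"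
      "pf_numerator s k (($) b) a' = node_poly (\<lambda>j. x $ j) ({..<?m} - {l})"
      by (rule lagrange_vector_scaled_node_vector[OF b x il(2) uv(2) vd])
    have g: "a \<bullet> a' \<ge> 0"
      by (rule gram[OF _ _ _ _ _ a(1) a'(1) a(4) a'(4)]) (use x il in \<open>auto simp: increasing_points_def\<close>)
    have par: "(-1) ^ (?m - 1 - j) = (-1) ^ ?m * (-1 :: real) ^ Suc j" if "j < ?m" for j
    proof -
      have e: "(?m - 1 - j) + Suc j = ?m" using that by simp
      have "(-1 :: real) ^ ?m = (-1) ^ (?m - 1 - j) * (-1) ^ Suc j"
        unfolding power_add[symmetric] e ..
      moreover have "(-1) ^ Suc j * (-1) ^ Suc j = (1 :: real)" by (simp flip: power_mult_distrib)
      ultimately show ?thesis by (simp only: mult.assoc mult_1_right)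
    qed
    have "0 \<le> ((-1) ^ (?m - 1 - i) * C) * ((-1) ^ (?m - 1 - l) * C') * (a \<bullet> a')"
      by (rule mult_nonneg_nonneg[OF mult_nonneg_nonneg[OF a(3) a'(3)] g])
    also have "\<dots> = ((-1) ^ ?m * (-1) ^ ?m) * ((-1) ^ Suc i * (-1) ^ Suc l * (C * C' * (a \<bullet> a')))"
      unfolding par[OF il(1)] par[OF il(2)] by (simp only: mult_ac)
    also have "(-1) ^ ?m * (-1) ^ ?m = (1 :: real)" by (simp flip: power_mult_distrib)
    also have "C * C' * (a \<bullet> a') = u \<bullet> v" unfolding a(2) a'(2) using a(1) a'(1) by simp
    finally show "0 \<le> (-1) ^ Suc i * (-1) ^ Suc l * (u \<bullet> v)" by simp
  qed blast
  then show ?thesis using b cx by (auto simp: Omega_E_def)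
qed

text \<open>
The sign of \<open>\<mu>\<close> decides on which side of the design space the cluster is placed.
\<close>
lemma Omega_E_nonempty_if_cluster:
  fixes u \<mu> :: real
  assumes k: "k \<ge> 1" and I: "convex I" and mu: "\<mu> \<noteq> 0" and side: "\<And>t. t \<in> I \<Longrightarrow> (t - u) / \<mu> \<ge> 0"
    and eq: "equioscillates I (s + 2 * k) k (\<lambda>r. u - \<mu> * pole_cluster (s + 2 * k) k r) N X"
    and far: "s = 0 \<or> \<mu> \<ge> 1 \<and> real s * (real (s + 2 * k) ^ (2 * k) * 6 ^ (s + 2 * k))\<^sup>2 \<le> \<mu> \<and> \<bar>u\<bar> \<le> \<mu> \<and> (\<forall>t\<in>I. \<bar>t\<bar> \<le> \<mu>)"
  shows "Omega_E I s k \<noteq> {}"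
proof -
  let ?g = "pole_cluster (s + 2 * k) k"
  let ?b = "vec k (\<lambda>r. u - \<mu> * ?g r)"
  have m1: "s + 2 * k \<ge> 1" using k by simp
  have D: "denom_poly {..<k} (\<lambda>r. ?b $ r) = denom_poly {..<k} (\<lambda>r. u - \<mu> * ?g r)"
    by (rule denom_poly_cong) simp
  have b: "?b \<in> param_space I k"
  proof -
    have "u - \<mu> * ?g r \<notin> I" if "r < k" for r
    proof
      assume "u - \<mu> * ?g r \<in> I"
      then have "- ?g r \<ge> 0" using side[of "u - \<mu> * ?g r"] mu by simp
      then show False using pole_cluster_bounds(1)[OF m1 that] by linarith
    qed
    moreover have "u - \<mu> * ?g p \<noteq> u - \<mu> * ?g q" if "p \<noteq> q" for p q
      using that mu pole_cluster_less[OF m1, of p q k] pole_cluster_less[OF m1, of q p k] by (cases p q rule: linorder_cases) auto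
    ultimately show ?thesis by (auto simp: param_space_def)
  qed
  have "?b \<in> Omega_E I s k"
  proof (rule Omega_E_if_gram[OF k I b])
    show "equioscillates I (s + 2 * k) k (\<lambda>r. ?b $ r) N X" using eq by (simp add: equioscillates_def D)
    fix x J J' a a'
    assume x: "\<And>j. j \<in> J \<union> J' \<Longrightarrow> x j \<in> I" and J: "finite J" "card J = s + 2 * k - 1"
      and J': "finite J'" "card J' = s + 2 * k - 1" and c: "a' \<in> carrier_vec (s + 2 * k)"
      and a: "pf_numerator s k (\<lambda>r. ?b $ r) a = node_poly x J" "pf_numerator s k (\<lambda>r. ?b $ r) a' = node_poly x J'"
    have n: "pf_numerator s k (\<lambda>r. u - \<mu> * ?g r) a = node_poly x J" "pf_numerator s k (\<lambda>r. u - \<mu> * ?g r) a' = node_poly x J'"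
      unfolding a[symmetric] by (rule pf_numerator_cong; simp)+
    show "a \<bullet> a' \<ge> 0"
      by (rule cluster_gram_nonneg[OF k mu _ J _ J' _ n c]) (use far x side in auto)
  qed
  then show ?thesis by auto
qed

lemma equioscillates_subset:
  assumes "equioscillates I m k b N X" "I' \<subseteq> I" "\<And>i. i < m \<Longrightarrow> X i \<in> I'"
  shows "equioscillates I' m k b N X"
  using assms by (auto simp: equioscillates_def)

text \<open>
One equioscillating numerator on \<open>[0, \<infinity>)\<close> serves all design spaces: it remains one on each subinterval
\<open>[0, V]\<close> that contains its points, and affine maps carry these intervals and the half-line to all the others. The admissible
scales for a given compact interval are bounded, which is why the sign condition for the cluster has to be
scale invariant.
\<close>
lemma Omega_E_nonempty_no_polynomial_part:
  assumes k: "k \<ge> 1" and I: "design_space 0 I"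
  shows "Omega_E I 0 k \<noteq> {}"
proof -
  let ?g = "pole_cluster (2 * k) k"
  have m1: "2 * k \<ge> 1" using k by simp
  have neg: "- ?g r < 0" if "r < k" for r using pole_cluster_bounds(1)[OF m1 that] by linarith
  obtain N X where NX: "equioscillates {0..} (2 * k) k (\<lambda>r. - ?g r) N X"
    by (rule equioscillates_half_line[where b = "\<lambda>r. - ?g r", OF k neg])
  have scaled: "Omega_E ((\<lambda>t. u + \<mu> * t) ` I0) 0 k \<noteq> {}"
    if I0: "I0 \<subseteq> {0..}" "convex I0" "\<And>i. i < 2 * k \<Longrightarrow> X i \<in> I0" and mu: "\<mu> \<noteq> 0" for I0 and u \<mu> :: real
  proof -
    have "equioscillates I0 (2 * k) k (\<lambda>r. - ?g r) N X" by (rule equioscillates_subset[OF NX I0(1,3)])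
    then obtain N' where N': "equioscillates ((\<lambda>t. u + \<mu> * t) ` I0) (2 * k) k (\<lambda>r. u + \<mu> * - ?g r) N' (\<lambda>i. u + \<mu> * X i)"
      by (rule equioscillates_affine[OF _ mu])
    show ?thesis
    proof (rule Omega_E_nonempty_if_cluster[OF k _ mu])
      show "convex ((\<lambda>t. u + \<mu> * t) ` I0)"
        using convex_affinity[OF I0(2), of u \<mu>] by simp
      show "equioscillates ((\<lambda>t. u + \<mu> * t) ` I0) (0 + 2 * k) k (\<lambda>r. u - \<mu> * pole_cluster (0 + 2 * k) k r) N' (\<lambda>i. u + \<mu> * X i)"
        using N' by simp
      show "(t - u) / \<mu> \<ge> 0" if "t \<in> (\<lambda>t. u + \<mu> * t) ` I0" for t using that mu I0(1) by auto
    qed simp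
  qed
  have X0: "X i \<in> {0..}" if "i < 2 * k" for i using NX that by (auto simp: equioscillates_def)
  from I consider u v where "u < v" "I = {u..v}" | u where "I = {u..}" | u where "I = {..u}"
    by (auto simp: design_space_def)
  then show ?thesis
  proof cases
    case 1
    \<comment> \<open>The image of \<open>[0, V]\<close> under the affine map with slope \<open>(v - u) / V\<close> is the given interval.\<close>
    define V where "V = Max (X ` {..<2 * k})"
    have XV: "X i \<le> V" if "i < 2 * k" for i unfolding V_def using that by (intro Max_ge) auto
    have "0 < 2 * k" "1 < 2 * k" using k by auto
    then have "X 0 < X 1 \<or> X 1 < X 0"
      using NX by (auto simp: equioscillates_def monotone_on_def)
    then have V: "V > 0" using X0[of 0] X0[of 1] XV[of 0] XV[of 1] k by auto
    have "(\<lambda>t. u + (v - u) / V * t) ` {0..V} = {u..v}"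
      using image_affinity_atLeastAtMost[of "(v - u) / V" u 0 V] V 1(1) by (simp add: add.commute)
    then show ?thesis
      using scaled[of "{0..V}" "(v - u) / V" u] X0 XV V 1 by auto
  next
    case 2
    have "(\<lambda>t. u + 1 * t) ` {0..} = {u..}"
    proof (intro equalityI subsetI)
      fix t assume "t \<in> {u..}"
      then show "t \<in> (\<lambda>t. u + 1 * t) ` {0..}" by (intro image_eqI[of _ _ "t - u"]) auto
    qed auto
    then show ?thesis using scaled[of "{0..}" 1 u] X0 2 by auto
  next
    case 3
    have "(\<lambda>t. u + (-1) * t) ` {0..} = {..u}"
    proof (intro equalityI subsetI)
      fix t assume "t \<in> {..u}"
      then show "t \<in> (\<lambda>t. u + (-1) * t) ` {0..}" by (intro image_eqI[of _ _ "u - t"]) auto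
    qed auto
    then show ?thesis using scaled[of "{0..}" "-1" u] X0 3 by auto
  qed
qed

lemma Omega_E_nonempty_polynomial_part:
  assumes k: "k \<ge> 1" and s: "s \<ge> 1" and uv: "u < v"
  shows "Omega_E {u..v} s k \<noteq> {}"
proof -
  let ?m = "s + 2 * k"
  \<comment> \<open>A common upper bound of the quantities that \<open>\<mu>\<close> has to exceed.\<close>
  define \<mu> where "\<mu> = 1 + \<bar>u\<bar> + \<bar>v\<bar> + real s * (real ?m ^ (2 * k) * 6 ^ ?m)\<^sup>2"
  have nn: "real s * (real ?m ^ (2 * k) * 6 ^ ?m)\<^sup>2 \<ge> 0" by simp
  have mu: "\<mu> \<ge> 1" "\<bar>u\<bar> \<le> \<mu>" "\<bar>v\<bar> \<le> \<mu>" "real s * (real ?m ^ (2 * k) * 6 ^ ?m)\<^sup>2 \<le> \<mu>"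
    using nn unfolding \<mu>_def by linarith+
  let ?b = "\<lambda>r. u - \<mu> * pole_cluster ?m k r"
  have b: "?b r \<notin> {u..v}" if "r < k" for r
  proof -
    have "pole_cluster ?m k r \<ge> 1" using k that by (intro pole_cluster_bounds) auto
    then have "\<mu> * pole_cluster ?m k r > 0" using mu(1) by (intro mult_pos_pos) auto
    then show ?thesis by auto
  qed
  obtain N X where NX: "equioscillates {u..v} ?m k ?b N X"
    by (rule equioscillates_compact_interval[where b = ?b, OF s uv b])
  show ?thesis
  proof (rule Omega_E_nonempty_if_cluster[OF k _ _ _ NX])
    show "s = 0 \<or> \<mu> \<ge> 1 \<and> real s * (real ?m ^ (2 * k) * 6 ^ ?m)\<^sup>2 \<le> \<mu> \<and> \<bar>u\<bar> \<le> \<mu> \<and> (\<forall>t\<in>{u..v}. \<bar>t\<bar> \<le> \<mu>)"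
      using mu by (auto simp: abs_le_iff)
  qed (use mu(1) in auto)
qed

section \<open>Chebyshev points and E-optimal designs of the rational model\<close>

theorem theorem4p2:
  fixes s k :: nat
  assumes "k \<ge> 1"
  shows "(s = 1 \<longrightarrow>
           (\<forall>b \<in> param_space {-1..1} k.
              (\<exists>c x. chebyshev_polynomial_points {-1..1} (s + 2 * k) (rational_regression s k b) c x) \<and>
              (\<forall>c x \<tau>. chebyshev_polynomial_points {-1..1} (s + 2 * k) (rational_regression s k b) c x \<longrightarrow>
                 tau_of k b \<tau> \<longrightarrow>
                 (\<lambda>i. x $ i) ` {..<s + 2 * k} = {t. poly (chebyshev_points_poly s k \<tau>) t = 0}))) \<and>
         (\<forall>I. design_space s I \<longrightarrow> Omega_E I s k \<noteq> {})"
proof (intro conjI impI ballI allI)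
  fix b assume s: "s = 1" and b: "b \<in> param_space {-1..1} k"
  have pole: "b $ r \<notin> {-1..1}" if "r < k" for r using b that by (simp add: param_space_def)
  have s1: "s \<ge> 1" using s by simp
  obtain N X where "equioscillates {-1..1} (s + 2 * k) k (($) b) N X"
    by (rule equioscillates_unit_interval[where b = "\<lambda>r. b $ r", OF s1 pole])
  then obtain c x where "chebyshev_polynomial_points {-1..1} (s + 2 * k) (rational_regression s k b) c x"
    by (rule chebyshev_points_of_equioscillation[OF convex_real_interval(5) b])
  then show "\<exists>c x. chebyshev_polynomial_points {-1..1} (s + 2 * k) (rational_regression s k b) c x" by blast
  fix c x \<tau>
  assume "chebyshev_polynomial_points {-1..1} (s + 2 * k) (rational_regression s k b) c x" "tau_of k b \<tau>"
  then show "(\<lambda>i. x $ i) ` {..<s + 2 * k} = {t. poly (chebyshev_points_poly s k \<tau>) t = 0}"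
    using chebyshev_points_eq_zeros[OF assms b] unfolding s by blast
next
  fix I assume "design_space s I"
  then show "Omega_E I s k \<noteq> {}"
    using Omega_E_nonempty_no_polynomial_part[OF assms] Omega_E_nonempty_polynomial_part[OF assms]
    by (cases "s = 0") (auto simp: design_space_def)
qed

end
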